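(* Each of the two gate sets $$\{\mathrm{BRAID},\ \mathrm{CZ}^{\mathrm f},\ \mathrm{CZ}^{\mathrm{qf}},\ \mathrm H,\ \mathrm S,\ \mathrm T\}\quad\text{and}\quad \{\mathrm{BRAID},\ \mathrm{CZ}^{\mathrm f},\ \mathrm{CZ}^{\mathrm{qf}},\ \mathrm H,\ \mathrm S,\ \mathrm T^{\mathrm f}\}$$ is universal for qubit-fermion quantum computation. That is: for all integers $L_{\mathrm q},L_{\mathrm f}\ge0$, every unitary $U$ on a system of $L_{\mathrm q}$ qubits and $L_{\mathrm f}$ fermionic sites that commutes with the total fermion parity, and every $\varepsilon>0$, there exist finite numbers of ancilla qubits and ancilla fermionic sites, a fixed computational-basis/occupation-number state of the ancillas with projector $\Pi$, a circuit $V$ composed of gates from the gate set acting on the system and ancillas, and a phase $\varphi\in\mathbb R$ such that $$\left\|\left(V-e^{i\varphi}U\right)\Pi\right\|\le\varepsilon .$$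
   Context: Fermionic sites carry operators $p_i,p_i^\dagger$ with $\{p_i^\dagger,p_j\}=\delta_{ij}$, $\{p_i,p_j\}=0$, commuting with all qubit operators; $n_i=p_i^\dagger p_i$. The fermion parity is $\exp(i\pi\sum_i n_i)$ over the $L_{\mathrm f}$ system sites. For qubits, $n^{\mathrm q}_i=|1\rangle\langle1|_i$. The gates, which may be applied to any (distinct) qubits/sites, are $$\mathrm{BRAID}_{ij}=\exp\!\left(i\tfrac{\pi}{4}(p_i^\dagger-p_i)(p_j^\dagger+p_j)\right),\quad \mathrm{CZ}^{\mathrm f}_{ij}=e^{i\pi n_in_j},\quad \mathrm{CZ}^{\mathrm{qf}}_{ij}=e^{i\pi n_i^{\mathrm q}n_j},\quad \mathrm T^{\mathrm f}_i=e^{i\frac{\pi}{4}n_i},$$ and the qubit gates Hadamard $\mathrm H$, $\mathrm S=\mathrm{diag}(1,i)$, $\mathrm T=\mathrm{diag}(1,e^{i\pi/4})$. A parity-preserving $U$ is an even element of the algebra generated by the system's qubit and fermion operators, and in the displayed inequality it is regarded as acting on the joint system-plus-ancilla Fock space through that algebra. $\Pi$ is the projector onto the states in which each ancilla qubit is in its prescribed computational basis state and each ancilla site has its prescribed occupation number $0$ or $1$. The norm is the operator norm. *)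

theory Defs
  imports "Jordan_Normal_Form.Schur_Decomposition"
begin

text \<open>
  Operators on the Fock space of \<open>Nq\<close> qubits and \<open>Nf\<close> fermionic sites are square complex matrices
  of size \<open>2 ^ (Nq + Nf)\<close>. The basis vector with index \<open>x\<close> is the computational-basis /
  occupation-number state in which qubit \<open>i\<close> is \<open>bit x i\<close> and site \<open>j\<close> is \<open>bit x (Nq + j)\<close>.
\<close>

abbreviation fock_dim :: "nat \<Rightarrow> nat \<Rightarrow> nat" where
  "fock_dim Nq Nf \<equiv> 2 ^ (Nq + Nf)"

abbreviation fock_ops :: "nat \<Rightarrow> nat \<Rightarrow> complex mat set" where
  "fock_ops Nq Nf \<equiv> carrier_mat (fock_dim Nq Nf) (fock_dim Nq Nf)"

subsection \<open>Matrix notions\<close>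

definition mat_exp :: "complex mat \<Rightarrow> complex mat" where
  "mat_exp A = mat (dim_row A) (dim_row A) (\<lambda>xy. \<Sum>k. (A ^\<^sub>m k) $$ xy / fact k)"

definition unitary_mat :: "complex mat \<Rightarrow> bool" where
  "unitary_mat U \<longleftrightarrow> square_mat U \<and>
     U * mat_adjoint U = 1\<^sub>m (dim_row U) \<and> mat_adjoint U * U = 1\<^sub>m (dim_row U)"

definition vec_l2norm :: "complex vec \<Rightarrow> real" where
  "vec_l2norm v = sqrt (Re (v \<bullet>c v))"

definition op_norm :: "complex mat \<Rightarrow> real" where
  "op_norm A = (SUP v \<in> {v \<in> carrier_vec (dim_col A). vec_l2norm v \<le> 1}. vec_l2norm (A *\<^sub>v v))"

subsection \<open>Qubit and fermion operators\<close>

text \<open>The one-qubit operator \<open>M\<close> acting on qubit \<open>i\<close>.\<close>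

definition qubit_op :: "nat \<Rightarrow> nat \<Rightarrow> nat \<Rightarrow> complex mat \<Rightarrow> complex mat" where
  "qubit_op Nq Nf i M = mat (fock_dim Nq Nf) (fock_dim Nq Nf) (\<lambda>(x, y).
     if \<forall>k. k \<noteq> i \<longrightarrow> bit x k = bit y k
     then M $$ (of_bool (bit x i), of_bool (bit y i)) else 0)"

text \<open>
  The annihilation operator \<open>p\<^sub>j\<close> in the occupation-number basis; the sign counts the occupied sites
  before \<open>j\<close>. The canonical anticommutation relations are proved below.
\<close>

definition annih :: "nat \<Rightarrow> nat \<Rightarrow> nat \<Rightarrow> complex mat" where
  "annih Nq Nf j = mat (fock_dim Nq Nf) (fock_dim Nq Nf) (\<lambda>(x, y).
     if bit y (Nq + j) \<and> x = unset_bit (Nq + j) y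
     then (- 1) ^ card {l. l < j \<and> bit y (Nq + l)} else 0)"

definition creat :: "nat \<Rightarrow> nat \<Rightarrow> nat \<Rightarrow> complex mat" where
  "creat Nq Nf j = mat_adjoint (annih Nq Nf j)"

definition site_number :: "nat \<Rightarrow> nat \<Rightarrow> nat \<Rightarrow> complex mat" where
  "site_number Nq Nf j = creat Nq Nf j * annih Nq Nf j"

definition qubit_number :: "nat \<Rightarrow> nat \<Rightarrow> nat \<Rightarrow> complex mat" where
  "qubit_number Nq Nf i = qubit_op Nq Nf i (mat_of_rows_list 2 [[0, 0], [0, 1]])"

definition total_site_number :: "nat \<Rightarrow> nat \<Rightarrow> complex mat" where
  "total_site_number Nq Nf =
     mat (fock_dim Nq Nf) (fock_dim Nq Nf) (\<lambda>xy. \<Sum>j<Nf. site_number Nq Nf j $$ xy)"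

definition fermion_parity :: "nat \<Rightarrow> nat \<Rightarrow> complex mat" where
  "fermion_parity Nq Nf = mat_exp ((\<i> * pi) \<cdot>\<^sub>m total_site_number Nq Nf)"

subsection \<open>Gates and circuits\<close>

definition braid_gate :: "nat \<Rightarrow> nat \<Rightarrow> nat \<Rightarrow> nat \<Rightarrow> complex mat" where
  "braid_gate Nq Nf i j = mat_exp ((\<i> * (pi / 4)) \<cdot>\<^sub>m
     ((creat Nq Nf i - annih Nq Nf i) * (creat Nq Nf j + annih Nq Nf j)))"

definition CZf_gate :: "nat \<Rightarrow> nat \<Rightarrow> nat \<Rightarrow> nat \<Rightarrow> complex mat" where
  "CZf_gate Nq Nf i j = mat_exp ((\<i> * pi) \<cdot>\<^sub>m (site_number Nq Nf i * site_number Nq Nf j))"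

definition CZqf_gate :: "nat \<Rightarrow> nat \<Rightarrow> nat \<Rightarrow> nat \<Rightarrow> complex mat" where
  "CZqf_gate Nq Nf i j = mat_exp ((\<i> * pi) \<cdot>\<^sub>m (qubit_number Nq Nf i * site_number Nq Nf j))"

definition Tf_gate :: "nat \<Rightarrow> nat \<Rightarrow> nat \<Rightarrow> complex mat" where
  "Tf_gate Nq Nf j = mat_exp ((\<i> * (pi / 4)) \<cdot>\<^sub>m site_number Nq Nf j)"

definition H_gate :: "nat \<Rightarrow> nat \<Rightarrow> nat \<Rightarrow> complex mat" where
  "H_gate Nq Nf i =
     qubit_op Nq Nf i (complex_of_real (1 / sqrt 2) \<cdot>\<^sub>m mat_of_rows_list 2 [[1, 1], [1, - 1]])"

definition S_gate :: "nat \<Rightarrow> nat \<Rightarrow> nat \<Rightarrow> complex mat" where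
  "S_gate Nq Nf i = qubit_op Nq Nf i (mat_of_rows_list 2 [[1, 0], [0, \<i>]])"

definition T_gate :: "nat \<Rightarrow> nat \<Rightarrow> nat \<Rightarrow> complex mat" where
  "T_gate Nq Nf i = qubit_op Nq Nf i (mat_of_rows_list 2 [[1, 0], [0, exp (\<i> * (pi / 4))]])"

definition common_gates :: "nat \<Rightarrow> nat \<Rightarrow> complex mat set" where
  "common_gates Nq Nf =
     {braid_gate Nq Nf i j | i j. i < Nf \<and> j < Nf \<and> i \<noteq> j} \<union>
     {CZf_gate Nq Nf i j | i j. i < Nf \<and> j < Nf \<and> i \<noteq> j} \<union>
     {CZqf_gate Nq Nf i j | i j. i < Nq \<and> j < Nf} \<union>
     {H_gate Nq Nf i | i. i < Nq} \<union>
     {S_gate Nq Nf i | i. i < Nq}"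

definition gate_set_T :: "nat \<Rightarrow> nat \<Rightarrow> complex mat set" where
  "gate_set_T Nq Nf = common_gates Nq Nf \<union> {T_gate Nq Nf i | i. i < Nq}"

definition gate_set_Tf :: "nat \<Rightarrow> nat \<Rightarrow> complex mat set" where
  "gate_set_Tf Nq Nf = common_gates Nq Nf \<union> {Tf_gate Nq Nf j | j. j < Nf}"

definition circuit :: "nat \<Rightarrow> nat \<Rightarrow> complex mat list \<Rightarrow> complex mat" where
  "circuit Nq Nf gs = foldr (*) gs (1\<^sub>m (fock_dim Nq Nf))"

subsection \<open>System operators on the joint space\<close>

text \<open>
  Qubits \<open>0, \<dots>, Lq - 1\<close> and sites \<open>0, \<dots>, Lf - 1\<close> of the joint space form the system, the
  remaining \<open>Aq\<close> qubits and \<open>Af\<close> sites are ancillas. \<open>joint_action Lq Lf Aq Af U U'\<close> says that some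
  algebraic expression in the system's qubit and fermion operators evaluates to \<open>U\<close> on the system
  and to \<open>U'\<close> on the joint space; \<open>U'\<close> is determined by \<open>U\<close>, as proved below.
\<close>

inductive joint_action ::
    "nat \<Rightarrow> nat \<Rightarrow> nat \<Rightarrow> nat \<Rightarrow> complex mat \<Rightarrow> complex mat \<Rightarrow> bool"
  for Lq Lf Aq Af :: nat where
  one: "joint_action Lq Lf Aq Af (1\<^sub>m (fock_dim Lq Lf)) (1\<^sub>m (fock_dim (Lq + Aq) (Lf + Af)))"
| qubit: "joint_action Lq Lf Aq Af (qubit_op Lq Lf i M) (qubit_op (Lq + Aq) (Lf + Af) i M)"
    if "i < Lq" "M \<in> carrier_mat 2 2"
| annih: "joint_action Lq Lf Aq Af (annih Lq Lf j) (annih (Lq + Aq) (Lf + Af) j)"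
    if "j < Lf"
| creat: "joint_action Lq Lf Aq Af (creat Lq Lf j) (creat (Lq + Aq) (Lf + Af) j)"
    if "j < Lf"
| smult: "joint_action Lq Lf Aq Af (c \<cdot>\<^sub>m A) (c \<cdot>\<^sub>m A')"
    if "joint_action Lq Lf Aq Af A A'"
| add: "joint_action Lq Lf Aq Af (A + B) (A' + B')"
    if "joint_action Lq Lf Aq Af A A'" "joint_action Lq Lf Aq Af B B'"
| mult: "joint_action Lq Lf Aq Af (A * B) (A' * B')"
    if "joint_action Lq Lf Aq Af A A'" "joint_action Lq Lf Aq Af B B'"

definition ancilla_proj ::
    "nat \<Rightarrow> nat \<Rightarrow> nat \<Rightarrow> nat \<Rightarrow> (nat \<Rightarrow> bool) \<Rightarrow> (nat \<Rightarrow> bool) \<Rightarrow> complex mat" where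
  "ancilla_proj Lq Lf Aq Af bq bf =
     mat (fock_dim (Lq + Aq) (Lf + Af)) (fock_dim (Lq + Aq) (Lf + Af)) (\<lambda>(x, y). of_bool
       (x = y \<and> (\<forall>k<Aq. bit x (Lq + k) = bq k) \<and> (\<forall>k<Af. bit x (Lq + Aq + (Lf + k)) = bf k)))"

definition universal :: "(nat \<Rightarrow> nat \<Rightarrow> complex mat set) \<Rightarrow> bool" where
  "universal G \<longleftrightarrow>
     (\<forall>Lq Lf. \<forall>U \<in> fock_ops Lq Lf. \<forall>\<epsilon>::real. \<epsilon> > 0 \<and>
        unitary_mat U \<and> U * fermion_parity Lq Lf = fermion_parity Lq Lf * U \<longrightarrow>
        (\<exists>Aq Af bq bf gs (\<phi>::real) U'.
           set gs \<subseteq> G (Lq + Aq) (Lf + Af) \<and>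
           joint_action Lq Lf Aq Af U U' \<and>
           op_norm ((circuit (Lq + Aq) (Lf + Af) gs - exp (\<i> * \<phi>) \<cdot>\<^sub>m U')
             * ancilla_proj Lq Lf Aq Af bq bf) \<le> \<epsilon>))"

subsection \<open>Canonical (anti)commutation relations\<close>

definition jw_sign :: "nat \<Rightarrow> nat \<Rightarrow> nat \<Rightarrow> complex" where
  "jw_sign Nq j y = (- 1) ^ card {l. l < j \<and> bit y (Nq + l)}"

lemma jw_sign_sq: "jw_sign Nq j y * jw_sign Nq j y = 1"
  by (simp add: jw_sign_def flip: power_add mult_2)

lemma jw_sign_cong:
  "(\<And>l. l < j \<Longrightarrow> bit x (Nq + l) = bit y (Nq + l)) \<Longrightarrow> jw_sign Nq j x = jw_sign Nq j y"
  unfolding jw_sign_def by (metis (no_types, lifting))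

lemma jw_sign_unset:
  assumes "bit y (Nq + i)"
  shows "jw_sign Nq j (unset_bit (Nq + i) y) =
    (if i < j then - jw_sign Nq j y else jw_sign Nq j y)"
proof (cases "i < j")
  case True
  have "{l. l < j \<and> bit y (Nq + l)} =
      insert i {l. l < j \<and> bit (unset_bit (Nq + i) y) (Nq + l)}"
    using assms True by (auto simp: bit_unset_bit_iff)
  moreover have "i \<notin> {l. l < j \<and> bit (unset_bit (Nq + i) y) (Nq + l)}"
    by (simp add: bit_unset_bit_iff)
  ultimately show ?thesis using True by (simp add: jw_sign_def)
next
  case False
  then show ?thesis
    by (auto intro!: jw_sign_cong simp: bit_unset_bit_iff)
qed

lemma nat_bit_less:
  fixes x :: nat assumes "\<And>k. bit x k \<Longrightarrow> k < n" shows "x < 2 ^ n"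
proof -
  have "take_bit n x = x"
    by (rule bit_eqI) (use assms in \<open>auto simp: bit_take_bit_iff\<close>)
  then show ?thesis by (metis take_bit_nat_less_exp)
qed

lemma nat_bit_bound: "bit (x::nat) k \<Longrightarrow> x < 2 ^ n \<Longrightarrow> k < n"
  by (metis bit_take_bit_iff take_bit_nat_eq_self_iff)

lemma unset_bit_less: "x < 2 ^ n \<Longrightarrow> unset_bit k (x::nat) < 2 ^ n"
  by (rule nat_bit_less) (auto simp: bit_unset_bit_iff dest: nat_bit_bound)

lemma set_bit_less: "x < 2 ^ n \<Longrightarrow> k < n \<Longrightarrow> set_bit k (x::nat) < 2 ^ n"
  by (rule nat_bit_less) (auto simp: bit_set_bit_iff dest: nat_bit_bound)

lemma unset_bit_eq_iff:
  "bit w k \<and> v = unset_bit k w \<longleftrightarrow> \<not> bit v k \<and> w = set_bit k v" for v w k :: nat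
proof -
  have "set_bit k (unset_bit k w) = w" if "bit w k"
    by (rule bit_eqI) (use that in \<open>auto simp: bit_set_bit_iff bit_unset_bit_iff\<close>)
  moreover have "unset_bit k (set_bit k v) = v" if "\<not> bit v k"
    by (rule bit_eqI) (use that in \<open>auto simp: bit_set_bit_iff bit_unset_bit_iff\<close>)
  ultimately show ?thesis by (auto simp: bit_set_bit_iff bit_unset_bit_iff)
qed

lemma unset_bit_swap_iff:
  fixes x y a b :: nat
  assumes "a \<noteq> b"
  shows "\<not> bit x b \<and> \<not> bit y a \<and> set_bit b x = set_bit a y \<longleftrightarrow>
    bit x a \<and> bit y b \<and> unset_bit a x = unset_bit b y" (is "?P \<longleftrightarrow> ?Q")
proof
  assume P: ?P
  then have e: "bit (set_bit b x) n = bit (set_bit a y) n" for n by simp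
  have "bit x a" "bit y b" using e[of a] e[of b] assms by (auto simp: bit_set_bit_iff)
  moreover have "unset_bit a x = unset_bit b y"
  proof (rule bit_eqI)
    show "bit (unset_bit a x) n = bit (unset_bit b y) n" for n
      using e[of n] conjunct1[OF P] conjunct1[OF conjunct2[OF P]]
      by (cases "n = a"; cases "n = b") (auto simp: bit_set_bit_iff bit_unset_bit_iff)
  qed
  ultimately show ?Q by blast
next
  assume Q: ?Q
  then have e: "bit (unset_bit a x) n = bit (unset_bit b y) n" for n by simp
  have "\<not> bit x b" "\<not> bit y a" using e[of a] e[of b] assms by (auto simp: bit_unset_bit_iff)
  moreover have "set_bit b x = set_bit a y"
  proof (rule bit_eqI)
    show "bit (set_bit b x) n = bit (set_bit a y) n" for n
      using e[of n] conjunct1[OF Q] conjunct1[OF conjunct2[OF Q]]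
      by (cases "n = a"; cases "n = b") (auto simp: bit_set_bit_iff bit_unset_bit_iff)
  qed
  ultimately show ?P by blast
qed

lemma annih_carrier [simp]: "annih Nq Nf j \<in> fock_ops Nq Nf"
  by (simp add: annih_def)

lemma mat_adjoint_index:
  fixes A :: "complex mat"
  shows "i < dim_col A \<Longrightarrow> j < dim_row A \<Longrightarrow> mat_adjoint A $$ (i, j) = cnj (A $$ (j, i))"
  by (simp add: mat_adjoint_def mat_of_rows_index)

lemma mat_adjoint_dims [simp]:
  "dim_row (mat_adjoint A) = dim_col A" "dim_col (mat_adjoint A) = dim_row A"
  by (simp_all add: mat_adjoint_def)

lemma creat_carrier [simp]: "creat Nq Nf j \<in> fock_ops Nq Nf"
  by (rule carrier_matI) (simp_all add: creat_def annih_def)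

lemma annih_index:
  "x < fock_dim Nq Nf \<Longrightarrow> y < fock_dim Nq Nf \<Longrightarrow> annih Nq Nf j $$ (x, y) =
     (if bit y (Nq + j) \<and> x = unset_bit (Nq + j) y then jw_sign Nq j y else 0)"
  by (simp add: annih_def jw_sign_def)

lemma creat_index:
  "x < fock_dim Nq Nf \<Longrightarrow> y < fock_dim Nq Nf \<Longrightarrow> creat Nq Nf j $$ (x, y) =
     (if bit x (Nq + j) \<and> y = unset_bit (Nq + j) x then jw_sign Nq j x else 0)"
  unfolding creat_def by (subst mat_adjoint_index) (auto simp: annih_def jw_sign_def)

lemma mult_index:
  assumes "A \<in> carrier_mat n n" "B \<in> carrier_mat n n" "x < n" "y < n"
  shows "(A * B) $$ (x, y) = (\<Sum>z<n. A $$ (x, z) * B $$ (z, y))"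
  using assms by (simp add: scalar_prod_def atLeast0LessThan)

lemma creat_annih_index:
  assumes "x < fock_dim Nq Nf" "y < fock_dim Nq Nf"
  shows "(creat Nq Nf i * annih Nq Nf j) $$ (x, y) =
    (if bit x (Nq + i) \<and> bit y (Nq + j) \<and> unset_bit (Nq + i) x = unset_bit (Nq + j) y
     then jw_sign Nq i x * jw_sign Nq j y else 0)" (is "?L = ?R")
proof -
  have "?L = (\<Sum>z<fock_dim Nq Nf. if z = unset_bit (Nq + i) x then ?R else 0)"
    unfolding mult_index[OF creat_carrier annih_carrier assms]
    by (intro sum.cong) (use assms in \<open>auto simp: creat_index annih_index\<close>)
  also have "\<dots> = ?R"
    using unset_bit_less[OF assms(1)] by simp
  finally show ?thesis .
qed

lemma annih_creat_index:
  assumes "x < fock_dim Nq Nf" "y < fock_dim Nq Nf" "i < Nf" "j < Nf"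
  defines "z \<equiv> set_bit (Nq + j) x"
  shows "(annih Nq Nf j * creat Nq Nf i) $$ (x, y) =
    (if \<not> bit x (Nq + j) \<and> \<not> bit y (Nq + i) \<and> z = set_bit (Nq + i) y
     then jw_sign Nq j z * jw_sign Nq i z else 0)" (is "?L = ?R")
proof -
  note eq = unset_bit_eq_iff
  have "?L = (\<Sum>w<fock_dim Nq Nf. if w = z then ?R else 0)"
    unfolding mult_index[OF annih_carrier creat_carrier assms(1,2)]
    by (intro sum.cong) (use assms in \<open>auto simp: creat_index annih_index eq\<close>)
  also have "\<dots> = ?R"
    using set_bit_less[OF assms(1)] assms(4) by (simp add: z_def)
  finally show ?thesis .
qed

lemma annih_annih_index:
  assumes "x < fock_dim Nq Nf" "y < fock_dim Nq Nf"
  shows "(annih Nq Nf i * annih Nq Nf j) $$ (x, y) =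
    (if i \<noteq> j \<and> bit y (Nq + i) \<and> bit y (Nq + j) \<and> x = unset_bit (Nq + i) (unset_bit (Nq + j) y)
     then jw_sign Nq i (unset_bit (Nq + j) y) * jw_sign Nq j y else 0)" (is "?L = ?R")
proof -
  have "?L = (\<Sum>z<fock_dim Nq Nf. if z = unset_bit (Nq + j) y then ?R else 0)"
    unfolding mult_index[OF annih_carrier annih_carrier assms]
    by (intro sum.cong) (use assms in \<open>auto simp: annih_index bit_unset_bit_iff\<close>)
  also have "\<dots> = ?R"
    using unset_bit_less[OF assms(2)] by simp
  finally show ?thesis .
qed

lemma annih_annih_anticommute:
  "annih Nq Nf i * annih Nq Nf j + annih Nq Nf j * annih Nq Nf i
     = 0\<^sub>m (fock_dim Nq Nf) (fock_dim Nq Nf)"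
proof (rule eq_matI)
  fix x y assume xy: "x < dim_row (0\<^sub>m (fock_dim Nq Nf) (fock_dim Nq Nf) :: complex mat)"
    "y < dim_col (0\<^sub>m (fock_dim Nq Nf) (fock_dim Nq Nf) :: complex mat)"
  have comm: "unset_bit a (unset_bit b y) = unset_bit b (unset_bit a y)" for a b
    by (rule bit_eqI) (auto simp: bit_unset_bit_iff)
  have "(annih Nq Nf i * annih Nq Nf j) $$ (x, y) + (annih Nq Nf j * annih Nq Nf i) $$ (x, y) = 0"
    using xy by (auto simp: annih_annih_index jw_sign_unset comm)
  then show "(annih Nq Nf i * annih Nq Nf j + annih Nq Nf j * annih Nq Nf i) $$ (x, y) =
      0\<^sub>m (fock_dim Nq Nf) (fock_dim Nq Nf) $$ (x, y)"
    using xy by (simp add: annih_def)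
qed (simp_all add: annih_def)

lemma creat_annih_anticommute:
  assumes "i < Nf" "j < Nf"
  shows "creat Nq Nf i * annih Nq Nf j + annih Nq Nf j * creat Nq Nf i =
    (if i = j then 1\<^sub>m (fock_dim Nq Nf) else 0\<^sub>m (fock_dim Nq Nf) (fock_dim Nq Nf))" (is "?L = ?R")
proof (rule eq_matI)
  fix x y assume "x < dim_row ?R" "y < dim_col ?R"
  then have xy: "x < fock_dim Nq Nf" "y < fock_dim Nq Nf" by (auto split: if_splits)
  have "(creat Nq Nf i * annih Nq Nf j) $$ (x, y) + (annih Nq Nf j * creat Nq Nf i) $$ (x, y)
      = (if i = j \<and> x = y then 1 else 0)"
  proof (cases "i = j")
    case True
    have "bit x k \<and> bit y k \<and> unset_bit k x = unset_bit k y \<longleftrightarrow> bit x k \<and> x = y"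
      "\<not> bit x k \<and> \<not> bit y k \<and> set_bit k x = set_bit k y \<longleftrightarrow> \<not> bit x k \<and> x = y" for k
      using unset_bit_eq_iff[of x k] unset_bit_eq_iff[of y k]
        unset_bit_eq_iff[of _ k x] unset_bit_eq_iff[of _ k y] by metis+
    with True show ?thesis
      using xy assms by (auto simp: creat_annih_index annih_creat_index jw_sign_sq)
  next
    case False
    let ?a = "Nq + i" and ?b = "Nq + j"
    let ?C = "bit x ?a \<and> bit y ?b \<and> unset_bit ?a x = unset_bit ?b y"
    have C: "\<not> bit x ?b \<and> \<not> bit y ?a \<and> set_bit ?b x = set_bit ?a y \<longleftrightarrow> ?C"
      using False by (intro unset_bit_swap_iff) simp
    show ?thesis
    proof (cases ?C)
      case True
      let ?z = "set_bit ?b x"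
      have z: "x = unset_bit ?b ?z" "y = unset_bit ?a ?z" "bit ?z ?a" "bit ?z ?b"
      proof -
        have w: "\<not> bit x ?b" "\<not> bit y ?a" "?z = set_bit ?a y" using True C by auto
        show "x = unset_bit ?b ?z" using unset_bit_eq_iff[of ?z ?b x] w by blast
        show "y = unset_bit ?a ?z" using unset_bit_eq_iff[of ?z ?a y] w by blast
        show "bit ?z ?a" by (subst w(3)) (simp add: bit_set_bit_iff)
        show "bit ?z ?b" by (simp add: bit_set_bit_iff)
      qed
      have "jw_sign Nq i x = (if j < i then - jw_sign Nq i ?z else jw_sign Nq i ?z)"
        by (subst z(1), rule jw_sign_unset, rule z(4))
      moreover have "jw_sign Nq j y = (if i < j then - jw_sign Nq j ?z else jw_sign Nq j ?z)"
        by (subst z(2), rule jw_sign_unset, rule z(3))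
      ultimately show ?thesis
        using xy assms True C False
        by (simp add: creat_annih_index annih_creat_index)
    next
      case F: False
      with C have "\<not> (\<not> bit x ?b \<and> \<not> bit y ?a \<and> set_bit ?b x = set_bit ?a y)" by blast
      with F have "(creat Nq Nf i * annih Nq Nf j) $$ (x, y) = 0"
        "(annih Nq Nf j * creat Nq Nf i) $$ (x, y) = 0"
        unfolding creat_annih_index[OF xy] annih_creat_index[OF xy assms] by (auto simp only: if_False)
      with False show ?thesis by simp
    qed
  qed
  then show "?L $$ (x, y) = ?R $$ (x, y)"
    using xy by (simp add: annih_def creat_def)
qed (simp_all add: annih_def creat_def)

lemma qubit_op_annih_commute:
  assumes i: "i < Nq" and j: "j < Nf"
  shows "qubit_op Nq Nf i M * annih Nq Nf j = annih Nq Nf j * qubit_op Nq Nf i M" (is "?L = ?R")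
proof (rule eq_matI)
  fix x y assume "x < dim_row ?R" "y < dim_col ?R"
  then have xy: "x < fock_dim Nq Nf" "y < fock_dim Nq Nf" by (simp_all add: annih_def qubit_op_def)
  let ?Q = "qubit_op Nq Nf i M" and ?m = "Nq + j"
  have m: "?m < Nq + Nf" "?m \<noteq> i" using i j by auto
  have Q: "?Q \<in> fock_ops Nq Nf" by (simp add: qubit_op_def)
  have uy: "unset_bit ?m y < fock_dim Nq Nf" and sx: "set_bit ?m x < fock_dim Nq Nf"
    using unset_bit_less[OF xy(2)] set_bit_less[OF xy(1) m(1)] .
  have "?L $$ (x, y) = (\<Sum>z<fock_dim Nq Nf. if z = unset_bit ?m y then
      (if bit y ?m then ?Q $$ (x, unset_bit ?m y) * jw_sign Nq j y else 0) else 0)"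
    unfolding mult_index[OF Q annih_carrier xy]
    by (intro sum.cong) (use xy in \<open>auto simp: annih_index\<close>)
  also have "\<dots> = (if bit y ?m then ?Q $$ (x, unset_bit ?m y) * jw_sign Nq j y else 0)"
    using uy by simp
  finally have L: "?L $$ (x, y) = \<dots>" .
  have "?R $$ (x, y) = (\<Sum>z<fock_dim Nq Nf. if z = set_bit ?m x then
      (if bit x ?m then 0 else jw_sign Nq j (set_bit ?m x) * ?Q $$ (set_bit ?m x, y)) else 0)"
    unfolding mult_index[OF annih_carrier Q xy]
    by (intro sum.cong) (use xy in \<open>auto simp: annih_index unset_bit_eq_iff\<close>)
  also have "\<dots> = (if bit x ?m then 0 else jw_sign Nq j (set_bit ?m x) * ?Q $$ (set_bit ?m x, y))"
    using sx by simp
  finally have R: "?R $$ (x, y) = \<dots>" .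
  let ?P = "bit y ?m \<and> \<not> bit x ?m \<and> (\<forall>k. k \<noteq> i \<and> k \<noteq> ?m \<longrightarrow> bit x k = bit y k)"
  let ?v = "M $$ (of_bool (bit x i), of_bool (bit y i)) * jw_sign Nq j y"
  have P1: "bit y ?m \<and> (\<forall>k. k \<noteq> i \<longrightarrow> bit x k = bit (unset_bit ?m y) k) \<longleftrightarrow> ?P"
    using m(2) unfolding bit_unset_bit_iff by metis
  have P2: "\<not> bit x ?m \<and> (\<forall>k. k \<noteq> i \<longrightarrow> bit (set_bit ?m x) k = bit y k) \<longleftrightarrow> ?P"
    using m(2) unfolding bit_set_bit_iff by (metis bit_imp_possible_bit possible_bit_nat)
  have b: "bit (unset_bit ?m y) i = bit y i" "bit (set_bit ?m x) i = bit x i"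
    using m(2) by (auto simp: bit_unset_bit_iff bit_set_bit_iff)
  have s: "jw_sign Nq j (set_bit ?m x) = jw_sign Nq j y" if ?P
    by (rule jw_sign_cong) (use that i in \<open>auto simp: bit_set_bit_iff\<close>)
  have "?L $$ (x, y) = (if ?P then ?v else 0)"
    unfolding L P1[symmetric] using xy uy by (auto simp: qubit_op_def b)
  moreover have "?R $$ (x, y) = (if ?P then ?v else 0)"
  proof (cases ?P)
    case True
    then show ?thesis unfolding R using P2 s[OF True] xy sx by (simp add: qubit_op_def b)
  next
    case False
    then have "\<not> (\<not> bit x ?m \<and> (\<forall>k. k \<noteq> i \<longrightarrow> bit (set_bit ?m x) k = bit y k))"
      using P2 by blast
    with False show ?thesis unfolding R using xy sx by (auto simp: qubit_op_def)
  qed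
  ultimately show "?L $$ (x, y) = ?R $$ (x, y)" by simp
qed (simp_all add: annih_def qubit_op_def)

subsection \<open>System operators determine their action on the joint space\<close>

context
  fixes Lq Lf Aq Af :: nat
begin

definition sys_index :: "nat \<Rightarrow> nat" where
  "sys_index x = or (take_bit Lq x) (push_bit Lq (take_bit Lf (drop_bit (Lq + Aq) x)))"

definition anc_eq :: "nat \<Rightarrow> nat \<Rightarrow> bool" where
  "anc_eq x y \<longleftrightarrow> (\<forall>k. Lq \<le> k \<and> k < Lq + Aq \<or> Lq + Aq + Lf \<le> k \<longrightarrow> bit x k = bit y k)"

definition joint_ext :: "complex mat \<Rightarrow> complex mat" where
  "joint_ext U = mat (fock_dim (Lq + Aq) (Lf + Af)) (fock_dim (Lq + Aq) (Lf + Af))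
     (\<lambda>(x, y). if anc_eq x y then U $$ (sys_index x, sys_index y) else 0)"

lemma bit_sys_index:
  "bit (sys_index x) k \<longleftrightarrow> (if k < Lq then bit x k else k < Lq + Lf \<and> bit x (k + Aq))"
  by (auto simp: sys_index_def bit_or_iff bit_take_bit_iff bit_push_bit_iff bit_drop_bit_eq
      add.commute add.left_commute)

lemma sys_index_less: "sys_index x < fock_dim Lq Lf"
  by (rule nat_bit_less) (auto simp: bit_sys_index split: if_splits)

lemma bit_sys_index_site:
  assumes "Lq + Aq \<le> k" "k < Lq + Aq + Lf"
  shows "bit x k = bit (sys_index x) (k - Aq)"
proof -
  obtain l where "k = l + Aq" using assms by (intro that[of "k - Aq"]) simp
  with assms show ?thesis by (simp add: bit_sys_index)
qed

lemma anc_eq_trans: "anc_eq x z \<Longrightarrow> anc_eq z y \<longleftrightarrow> anc_eq x y"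
  by (simp add: anc_eq_def)

lemma anc_sys_eq: "x = y \<longleftrightarrow> anc_eq x y \<and> sys_index x = sys_index y"
proof
  assume a: "anc_eq x y \<and> sys_index x = sys_index y"
  show "x = y"
  proof (rule bit_eqI)
    fix k
    consider "Lq \<le> k \<and> k < Lq + Aq \<or> Lq + Aq + Lf \<le> k" | "k < Lq"
      | "Lq + Aq \<le> k" "k < Lq + Aq + Lf" by linarith
    then show "bit x k = bit y k"
    proof cases
      case 1 then show ?thesis using a unfolding anc_eq_def by blast
    next
      case 2 then show ?thesis using a bit_sys_index[of x k] bit_sys_index[of y k] by simp
    next
      case 3 then show ?thesis
        using a bit_sys_index_site[of k] by metis
    qed
  qed
qed (simp add: anc_eq_def)

lemma ex_index:
  assumes x: "x < fock_dim (Lq + Aq) (Lf + Af)" and w: "w < fock_dim Lq Lf"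
  obtains z where "z < fock_dim (Lq + Aq) (Lf + Af)" "anc_eq x z" "sys_index z = w"
proof -
  define f where "f k = (if k < Lq then bit w k
    else if Lq + Aq \<le> k \<and> k < Lq + Aq + Lf then bit w (k - Aq) else bit x k)" for k
  define z where "z = (horner_sum of_bool 2 (map f [0..<Lq + Aq + (Lf + Af)]) :: nat)"
  have b: "bit z k \<longleftrightarrow> k < Lq + Aq + (Lf + Af) \<and> f k" for k
    by (auto simp: z_def bit_horner_sum_bit_iff)
  show ?thesis
  proof
    show "z < fock_dim (Lq + Aq) (Lf + Af)" by (rule nat_bit_less) (simp add: b)
    have x': "bit x k \<Longrightarrow> k < Lq + Aq + (Lf + Af)" for k using nat_bit_bound[OF _ x] .
    have w': "bit w k \<Longrightarrow> k < Lq + Lf" for k using nat_bit_bound[OF _ w] .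
    show "anc_eq x z"
      unfolding anc_eq_def b f_def using x' by (metis leD le_add1 le_trans)
    show "sys_index z = w"
    proof (rule bit_eqI)
      show "bit (sys_index z) k = bit w k" for k
        by (cases "k < Lq"; cases "k < Lq + Lf") (auto simp: bit_sys_index b f_def dest: w')
    qed
  qed
qed

lemma joint_ext_mult:
  assumes U: "U \<in> fock_ops Lq Lf" and W: "W \<in> fock_ops Lq Lf"
  shows "joint_ext (U * W) = joint_ext U * joint_ext W"
proof (rule eq_matI)
  fix x y assume "x < dim_row (joint_ext U * joint_ext W)" "y < dim_col (joint_ext U * joint_ext W)"
  then have xy: "x < fock_dim (Lq + Aq) (Lf + Af)" "y < fock_dim (Lq + Aq) (Lf + Af)" by (simp_all add: joint_ext_def)
  have c: "joint_ext A \<in> fock_ops (Lq + Aq) (Lf + Af)" for A by (simp add: joint_ext_def)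
  have "(joint_ext U * joint_ext W) $$ (x, y) = (\<Sum>z<fock_dim (Lq + Aq) (Lf + Af). joint_ext U $$ (x, z) * joint_ext W $$ (z, y))"
    by (rule mult_index[OF c c xy])
  also have "\<dots> = (\<Sum>z\<in>{z. z < fock_dim (Lq + Aq) (Lf + Af) \<and> anc_eq x z}. if anc_eq x y then
      U $$ (sys_index x, sys_index z) * W $$ (sys_index z, sys_index y) else 0)"
  proof (rule sum.mono_neutral_cong_right)
    fix z assume z: "z \<in> {z. z < fock_dim (Lq + Aq) (Lf + Af) \<and> anc_eq x z}"
    then have "anc_eq z y = anc_eq x y" using anc_eq_trans by blast
    then show "joint_ext U $$ (x, z) * joint_ext W $$ (z, y) = (if anc_eq x y then
        U $$ (sys_index x, sys_index z) * W $$ (sys_index z, sys_index y) else 0)"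
      using z xy by (simp add: joint_ext_def)
  qed (use xy in \<open>auto simp: joint_ext_def\<close>)
  also have "\<dots> = (\<Sum>w<fock_dim Lq Lf. if anc_eq x y then
      U $$ (sys_index x, w) * W $$ (w, sys_index y) else 0)"
  proof (rule sum.reindex_bij_betw[of sys_index _ _ "\<lambda>w. if anc_eq x y then
      U $$ (sys_index x, w) * W $$ (w, sys_index y) else 0"], rule bij_betw_imageI)
    show "inj_on sys_index {z. z < fock_dim (Lq + Aq) (Lf + Af) \<and> anc_eq x z}"
    proof (rule inj_onI)
      fix z z' assume "z \<in> {z. z < fock_dim (Lq + Aq) (Lf + Af) \<and> anc_eq x z}" "z' \<in> {z. z < fock_dim (Lq + Aq) (Lf + Af) \<and> anc_eq x z}"
        and s: "sys_index z = sys_index z'"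
      then have "anc_eq z z'" by (simp add: anc_eq_def)
      with s show "z = z'" using anc_sys_eq by blast
    qed
    show "sys_index ` {z. z < fock_dim (Lq + Aq) (Lf + Af) \<and> anc_eq x z} = {..<fock_dim Lq Lf}"
    proof (intro equalityI subsetI)
      fix w assume "w \<in> {..<fock_dim Lq Lf}"
      then have "w < fock_dim Lq Lf" by simp
      then obtain z where "z < fock_dim (Lq + Aq) (Lf + Af)" "anc_eq x z" "sys_index z = w" by (rule ex_index[OF xy(1)])
      then show "w \<in> sys_index ` {z. z < fock_dim (Lq + Aq) (Lf + Af) \<and> anc_eq x z}" by blast
    qed (auto simp: sys_index_less)
  qed
  also have "\<dots> = (if anc_eq x y then (U * W) $$ (sys_index x, sys_index y) else 0)"
    unfolding mult_index[OF U W sys_index_less sys_index_less]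
    by (cases "anc_eq x y") (simp_all only: if_True if_False sum.neutral_const)
  also have "\<dots> = joint_ext (U * W) $$ (x, y)" using xy by (simp add: joint_ext_def)
  finally show "joint_ext (U * W) $$ (x, y) = (joint_ext U * joint_ext W) $$ (x, y)" by simp
qed (simp_all add: joint_ext_def)

lemma joint_ext_one: "joint_ext (1\<^sub>m (fock_dim Lq Lf)) = 1\<^sub>m (fock_dim (Lq + Aq) (Lf + Af))"
proof (rule eq_matI)
  fix x y assume "x < dim_row (1\<^sub>m (fock_dim (Lq + Aq) (Lf + Af)) :: complex mat)" "y < dim_col (1\<^sub>m (fock_dim (Lq + Aq) (Lf + Af)) :: complex mat)"
  then show "joint_ext (1\<^sub>m (fock_dim Lq Lf)) $$ (x, y) = 1\<^sub>m (fock_dim (Lq + Aq) (Lf + Af)) $$ (x, y)"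
    using anc_sys_eq[of x y] by (simp add: joint_ext_def sys_index_less)
qed (simp_all add: joint_ext_def)

lemma joint_ext_add:
  "U \<in> fock_ops Lq Lf \<Longrightarrow> W \<in> fock_ops Lq Lf \<Longrightarrow> joint_ext (U + W) = joint_ext U + joint_ext W"
  using sys_index_less by (intro eq_matI) (auto simp: joint_ext_def)

lemma joint_ext_smult:
  "U \<in> fock_ops Lq Lf \<Longrightarrow> joint_ext (c \<cdot>\<^sub>m U) = c \<cdot>\<^sub>m joint_ext U"
  using sys_index_less by (intro eq_matI) (auto simp: joint_ext_def)

lemma joint_ext_qubit:
  assumes "i < Lq"
  shows "joint_ext (qubit_op Lq Lf i M) = qubit_op (Lq + Aq) (Lf + Af) i M"
proof -
  have iff: "(anc_eq x y \<and> (\<forall>k. k \<noteq> i \<longrightarrow> bit (sys_index x) k = bit (sys_index y) k)) \<longleftrightarrow>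
      (\<forall>k. k \<noteq> i \<longrightarrow> bit x k = bit y k)" (is "?P \<longleftrightarrow> ?Q") for x y
  proof
    assume P: ?P
    show ?Q
    proof (intro allI impI)
      fix k assume k: "k \<noteq> i"
      consider "Lq \<le> k \<and> k < Lq + Aq \<or> Lq + Aq + Lf \<le> k" | "k < Lq"
        | "Lq + Aq \<le> k" "k < Lq + Aq + Lf" by linarith
      then show "bit x k = bit y k"
      proof cases
        case 1 then show ?thesis using P unfolding anc_eq_def by blast
      next
        case 2 then show ?thesis using P k bit_sys_index[of x k] bit_sys_index[of y k] by simp
      next
        case 3
        then have "k - Aq \<noteq> i" using assms by linarith
        with 3 show ?thesis
          using P bit_sys_index_site[of k] by metis
      qed
    qed
  next
    assume Q: ?Q
    have "anc_eq x y" unfolding anc_eq_def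
    proof (intro allI impI)
      fix k assume "Lq \<le> k \<and> k < Lq + Aq \<or> Lq + Aq + Lf \<le> k"
      then have "k \<noteq> i" using assms by linarith
      with Q show "bit x k = bit y k" by blast
    qed
    moreover have "bit (sys_index x) k = bit (sys_index y) k" if "k \<noteq> i" for k
    proof (cases "k < Lq")
      case True then show ?thesis using Q that by (simp add: bit_sys_index)
    next
      case False
      then have "k + Aq \<noteq> i" using assms by linarith
      with False show ?thesis using Q by (simp add: bit_sys_index)
    qed
    ultimately show ?P by blast
  qed
  have i: "bit (sys_index x) i = bit x i" for x using assms by (simp add: bit_sys_index)
  show ?thesis
  proof (rule eq_matI)
    fix x y assume "x < dim_row (qubit_op (Lq + Aq) (Lf + Af) i M)"
      "y < dim_col (qubit_op (Lq + Aq) (Lf + Af) i M)"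
    then have xy: "x < fock_dim (Lq + Aq) (Lf + Af)" "y < fock_dim (Lq + Aq) (Lf + Af)" by (simp_all add: qubit_op_def)
    have "joint_ext (qubit_op Lq Lf i M) $$ (x, y) =
        (if anc_eq x y \<and> (\<forall>k. k \<noteq> i \<longrightarrow> bit (sys_index x) k = bit (sys_index y) k)
         then M $$ (of_bool (bit x i), of_bool (bit y i)) else 0)"
      using xy by (auto simp: joint_ext_def qubit_op_def sys_index_less i)
    also have "\<dots> = qubit_op (Lq + Aq) (Lf + Af) i M $$ (x, y)"
      unfolding iff using xy by (simp add: qubit_op_def)
    finally show "joint_ext (qubit_op Lq Lf i M) $$ (x, y) = qubit_op (Lq + Aq) (Lf + Af) i M $$ (x, y)" .
  qed (simp_all add: joint_ext_def qubit_op_def)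
qed

lemma joint_ext_annih:
  assumes "j < Lf"
  shows "joint_ext (annih Lq Lf j) = annih (Lq + Aq) (Lf + Af) j"
proof (rule eq_matI)
  fix x y assume "x < dim_row (annih (Lq + Aq) (Lf + Af) j)" "y < dim_col (annih (Lq + Aq) (Lf + Af) j)"
  then have xy: "x < fock_dim (Lq + Aq) (Lf + Af)" "y < fock_dim (Lq + Aq) (Lf + Af)" by (simp_all add: annih_def)
  let ?k = "Lq + Aq + j"
  have b: "bit (sys_index y) (Lq + l) = bit y (Lq + Aq + l)" if "l < Lf" for l
    using that by (simp add: bit_sys_index add.commute add.left_commute)
  have s: "sys_index (unset_bit ?k y) = unset_bit (Lq + j) (sys_index y)"
    by (rule bit_eqI) (auto simp: bit_sys_index bit_unset_bit_iff)
  have a: "anc_eq x y \<longleftrightarrow> anc_eq x (unset_bit ?k y)"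
    using assms by (auto simp: anc_eq_def bit_unset_bit_iff)
  have eq: "x = unset_bit ?k y \<longleftrightarrow>
      anc_eq x y \<and> sys_index x = unset_bit (Lq + j) (sys_index y)"
    unfolding anc_sys_eq[of x] s a ..
  have "jw_sign Lq j (sys_index y) = jw_sign (Lq + Aq) j y"
  proof -
    have "{l. l < j \<and> bit (sys_index y) (Lq + l)} = {l. l < j \<and> bit y (Lq + Aq + l)}"
      using b assms by (intro Collect_cong) (meson order.strict_trans)
    then show ?thesis by (simp only: jw_sign_def)
  qed
  moreover have "joint_ext (annih Lq Lf j) $$ (x, y) =
      (if anc_eq x y then annih Lq Lf j $$ (sys_index x, sys_index y) else 0)"
    using xy by (simp add: joint_ext_def)
  ultimately show "joint_ext (annih Lq Lf j) $$ (x, y) = annih (Lq + Aq) (Lf + Af) j $$ (x, y)"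
    unfolding annih_index[OF xy] annih_index[OF sys_index_less sys_index_less] eq b[OF assms] by simp
qed (simp_all add: joint_ext_def annih_def)

lemma joint_ext_creat:
  assumes "j < Lf"
  shows "joint_ext (creat Lq Lf j) = creat (Lq + Aq) (Lf + Af) j"
proof -
  have "joint_ext (mat_adjoint U) = mat_adjoint (joint_ext U)" if "U \<in> fock_ops Lq Lf" for U
    using that by (intro eq_matI)
      (auto simp: joint_ext_def mat_adjoint_index sys_index_less anc_eq_def)
  then show ?thesis
    unfolding creat_def using joint_ext_annih[OF assms] by simp
qed

lemma joint_action_ext:
  "joint_action Lq Lf Aq Af U U' \<Longrightarrow> U \<in> fock_ops Lq Lf \<and> U' = joint_ext U"
proof (induction rule: joint_action.induct)
  case (qubit i M)
  then show ?case by (simp add: joint_ext_qubit) (simp add: qubit_op_def)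
next
  case (mult A A' B B')
  then show ?case using joint_ext_mult by (metis mult_carrier_mat)
next
  case (add A A' B B')
  then show ?case using joint_ext_add by (metis add_carrier_mat)
qed (simp_all add: joint_ext_one joint_ext_annih joint_ext_creat joint_ext_smult)

lemma joint_action_unique:
  "joint_action Lq Lf Aq Af U U' \<Longrightarrow> joint_action Lq Lf Aq Af U U'' \<Longrightarrow> U' = U''"
  using joint_action_ext by blast

end

end

theory Submission
  imports "HOL-Analysis.Kronecker_Approximation_Theorem" Defs
begin

text \<open>
  In the occupation-number basis a Majorana operator is, by its Jordan-Wigner sign, a Pauli string on
  the bits of the basis index, so every even operator is a combination of Pauli strings whose flip
  mask has even weight on the sites. Each gate is, up to a phase, a rotation
  \<open>e\<^bsup>i t P\<^esup> = cos t + i sin t P\<close> about a Hermitian Pauli string, or acts on such strings by conjugation.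
  If \<open>P\<close> and \<open>Q\<close> anticommute, conjugation with \<open>e\<^bsup>i \<pi>/4 Q\<^esup>\<close> turns rotations about \<open>P\<close> into rotations
  about \<open>\<plusminus>iPQ\<close>. With one ancilla qubit and two ancilla sites, this reaches every string \<open>P Z\<close> with
  \<open>P\<close> an even system string and \<open>Z\<close> on the ancilla qubit. The angles \<open>\<pi>/8\<close> supplied by \<open>T\<close> or \<open>T\<^sup>f\<close>
  about two anticommuting strings combine into a rotation by an irrational angle, hence all angles are
  approximated. On the ancilla state \<open>0\<close> the factor \<open>Z\<close> drops out. Finally, sums of
  commuting strings give two-level rotations and diagonal phases, into which Givens elimination
  decomposes every parity-preserving unitary.
\<close>

subsection \<open>Characters of bit strings\<close>

text \<open>A quarter turn acts as a product only between anticommuting strings, so a product of two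
  commuting strings is not directly within reach. The ancilla qubit removes this obstacle: different
  Pauli operators on it, attached to the two factors, make any commuting pair anticommute. The
  \<open>Z\<close> that stays attached is harmless because the ancilla starts in one of its
  eigenstates. Circuits form a monoid, and no inverses are assumed. Each rotation taken from a gate
  has finite order, so its inverse is a power. Carrying both \<open>t\<close> and \<open>- t\<close>
  makes the sign of a string immaterial, and the sign is never tracked. The palindrome has no
  quaternion component along \<open>P * Q\<close>, so its axis stays in the plane of
  \<open>P\<close> and \<open>Q\<close>. The squared cosine of its angle a lies in Q(sqrt 2), and b
  = 2a satisfies 2 cos b = 1/sqrt 2 - 1. This value makes a parity argument in Z[sqrt 2]
  possible.\<close>

definition chi :: "nat \<Rightarrow> nat \<Rightarrow> nat \<Rightarrow> real" where
  "chi N a b = (\<Prod>k<N. if bit a k \<and> bit b k then - 1 else 1)"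

lemma chi_commute: "chi N a b = chi N b a"
  unfolding chi_def by (intro prod.cong) auto

lemma chi_xor_left: "chi N (xor a b) c = chi N a c * chi N b c"
  unfolding chi_def prod.distrib[symmetric] by (intro prod.cong) (auto simp: bit_xor_iff)

lemma chi_xor_right: "chi N a (xor b c) = chi N a b * chi N a c"
  using chi_xor_left chi_commute by metis

lemma chi_zero [simp]: "chi N 0 a = 1" "chi N a 0 = 1"
  by (simp_all add: chi_def)

lemma chi_square [simp]: "chi N a b * chi N a b = 1"
  unfolding chi_def prod.distrib[symmetric] by (intro prod.neutral) auto

lemma chi_cases: "chi N a b = 1 \<or> chi N a b = - 1"
  using chi_square[of N a b] square_eq_1_iff by blast

lemma chi_exp_right: "k < N \<Longrightarrow> chi N a (2 ^ k) = (if bit a k then - 1 else 1)"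
proof -
  assume k: "k < N"
  have "chi N a (2 ^ k) = (\<Prod>l<N. if l = k then (if bit a k then - 1 else 1) else 1)"
    unfolding chi_def by (intro prod.cong) (auto simp: bit_exp_iff possible_bit_def)
  also have "\<dots> = (if bit a k then - 1 else 1)" using k by (simp add: prod.delta)
  finally show ?thesis .
qed

lemma chi_exp_left: "k < N \<Longrightarrow> chi N (2 ^ k) a = (if bit a k then - 1 else 1)"
  using chi_exp_right chi_commute by metis

lemma chi_eq_1: "(\<And>k. k < N \<Longrightarrow> \<not> (bit a k \<and> bit b k)) \<Longrightarrow> chi N a b = 1"
  unfolding chi_def by (intro prod.neutral) auto

lemma xor_less_exp: "a < 2 ^ N \<Longrightarrow> b < 2 ^ N \<Longrightarrow> xor a b < (2 ^ N :: nat)"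
  by (rule nat_bit_less) (auto simp: bit_xor_iff dest: nat_bit_bound)

lemma xor_cancel [simp]: "xor (xor a m) m = a" "xor m (xor m a) = a" for a m :: nat
  by (simp_all add: xor.assoc) (simp flip: xor.assoc)

lemma xor_eq_iff: "x = xor y m \<longleftrightarrow> y = xor x m" for x y m :: nat
  by auto

lemma bit_exp_nat [simp]: "bit (2 ^ k :: nat) l \<longleftrightarrow> l = k"
  by (auto simp: bit_exp_iff possible_bit_def)

text \<open>For nonzero \<open>w\<close>, flipping a bit that is set in \<open>w\<close> permutes
  the indices and negates every summand.\<close>

lemma sum_chi:
  assumes "w < 2 ^ N"
  shows "(\<Sum>z<2 ^ N. chi N z w) = (if w = 0 then 2 ^ N else 0)"
proof (cases "w = 0")
  case False
  then obtain k where k: "bit w k" by (metis bit_eqI bit_0_eq bot_apply bot_bool_def)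
  then have kN: "k < N" using assms nat_bit_bound by blast
  have lt: "2 ^ k < (2 ^ N :: nat)" using kN by simp
  have "(\<Sum>z<2 ^ N. chi N z w) = (\<Sum>z<2 ^ N. chi N (xor z (2 ^ k)) w)"
    by (rule sum.reindex_bij_witness[of _ "\<lambda>z. xor z (2 ^ k)" "\<lambda>z. xor z (2 ^ k)"])
      (use lt in \<open>auto intro: xor_less_exp\<close>)
  also have "\<dots> = - (\<Sum>z<2 ^ N. chi N z w)"
    using k kN by (simp add: chi_xor_left chi_exp_left sum_negf)
  finally show ?thesis using False by simp
qed simp

lemma sum_chi_delta:
  assumes "x < 2 ^ N" "y < 2 ^ N"
  shows "(\<Sum>z<2 ^ N. chi N z x * chi N z y) = (if x = y then 2 ^ N else 0)"
proof -
  have "xor x y = 0 \<longleftrightarrow> x = y" by (metis xor_cancel(2) xor.right_neutral xor_self_eq)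
  then show ?thesis using sum_chi[OF xor_less_exp[OF assms]] by (simp add: chi_xor_right)
qed

subsection \<open>Pauli strings\<close>

text \<open>This is X^m Z^z with the signs applied first. Without a phase the entries stay real, and
  strings multiply by \<open>xor\<close> of both masks up to a sign.\<close>

definition pauli :: "nat \<Rightarrow> nat \<Rightarrow> nat \<Rightarrow> complex mat" where
  "pauli N m z = mat (2 ^ N) (2 ^ N) (\<lambda>(x, y). if x = xor y m then of_real (chi N z y) else 0)"

lemma pauli_carrier [simp]: "pauli N m z \<in> carrier_mat (2 ^ N) (2 ^ N)"
  by (simp add: pauli_def)

lemma pauli_dim [simp]: "dim_row (pauli N m z) = 2 ^ N" "dim_col (pauli N m z) = 2 ^ N"
  by (simp_all add: pauli_def)

lemma pauli_index:
  "x < 2 ^ N \<Longrightarrow> y < 2 ^ N \<Longrightarrow>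
    pauli N m z $$ (x, y) = (if x = xor y m then of_real (chi N z y) else 0)"
  by (simp add: pauli_def)

lemma pauli_zero: "pauli N 0 0 = 1\<^sub>m (2 ^ N)"
  by (rule eq_matI) (auto simp: pauli_index)

lemma mult_pauli_index:
  assumes A: "A \<in> carrier_mat (2 ^ N) (2 ^ N)" and m: "m < 2 ^ N" and xy: "x < 2 ^ N" "y < 2 ^ N"
  shows "(A * pauli N m z) $$ (x, y) = of_real (chi N z y) * A $$ (x, xor y m)"
proof -
  have "(A * pauli N m z) $$ (x, y) =
      (\<Sum>w<2 ^ N. if w = xor y m then of_real (chi N z y) * A $$ (x, w) else 0)"
    unfolding mult_index[OF A pauli_carrier xy]
    by (intro sum.cong) (use xy in \<open>auto simp: pauli_index\<close>)
  also have "\<dots> = of_real (chi N z y) * A $$ (x, xor y m)"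
    using xor_less_exp[OF xy(2) m] by simp
  finally show ?thesis .
qed

lemma pauli_mult:
  assumes m: "m < 2 ^ N" "m' < 2 ^ N"
  shows "pauli N m z * pauli N m' z' =
    complex_of_real (chi N z m') \<cdot>\<^sub>m pauli N (xor m m') (xor z z')"
proof (rule eq_matI)
  fix x y
  assume "x < dim_row (complex_of_real (chi N z m') \<cdot>\<^sub>m pauli N (xor m m') (xor z z'))"
    "y < dim_col (complex_of_real (chi N z m') \<cdot>\<^sub>m pauli N (xor m m') (xor z z'))"
  then have xy: "x < 2 ^ N" "y < 2 ^ N" by simp_all
  show "(pauli N m z * pauli N m' z') $$ (x, y) =
      (complex_of_real (chi N z m') \<cdot>\<^sub>m pauli N (xor m m') (xor z z')) $$ (x, y)"
    unfolding mult_pauli_index[OF pauli_carrier m(2) xy]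
    using xy xor_less_exp[OF xy(2) m(2)]
    by (auto simp: pauli_index chi_xor_left chi_xor_right xor.assoc xor.commute[of m])
qed simp_all

lemma smult_smult_mat: "a \<cdot>\<^sub>m (b \<cdot>\<^sub>m A) = (a * b) \<cdot>\<^sub>m (A :: complex mat)"
  by (rule eq_matI) auto

lemma one_smult_mat [simp]: "1 \<cdot>\<^sub>m (A :: complex mat) = A"
  by (rule eq_matI) auto

text \<open>X^m Z^z squares to the sign \<open>chi N z m\<close>, so one factor i turns the negative
  case into an involution. Hermitian strings are thereby fixed only up to sign: two \<open>Y\<close>
  factors, for instance, come out as minus their product.\<close>

definition pauli_phase :: "nat \<Rightarrow> nat \<Rightarrow> nat \<Rightarrow> complex" where
  "pauli_phase N m z = (if chi N m z = 1 then 1 else \<i>)"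

lemma pauli_phase_square: "pauli_phase N m z * pauli_phase N m z = of_real (chi N z m)"
  using chi_cases[of N m z] chi_commute[of N m z] by (auto simp: pauli_phase_def)

definition herm_pauli :: "nat \<Rightarrow> nat \<Rightarrow> nat \<Rightarrow> complex mat" where
  "herm_pauli N m z = pauli_phase N m z \<cdot>\<^sub>m pauli N m z"

lemma herm_pauli_carrier [simp]: "herm_pauli N m z \<in> carrier_mat (2 ^ N) (2 ^ N)"
  by (simp add: herm_pauli_def)

lemma smult_pauli_mult:
  assumes "m < 2 ^ N" "m' < 2 ^ N"
  shows "(c \<cdot>\<^sub>m pauli N m z) * (c' \<cdot>\<^sub>m pauli N m' z') =
    (c * c' * complex_of_real (chi N z m')) \<cdot>\<^sub>m pauli N (xor m m') (xor z z')"
proof -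
  have "(c \<cdot>\<^sub>m pauli N m z) * (c' \<cdot>\<^sub>m pauli N m' z') =
      c \<cdot>\<^sub>m (c' \<cdot>\<^sub>m (pauli N m z * pauli N m' z'))"
    by (simp add: mult_smult_assoc_mat[of _ "2^N" "2^N" _ "2^N"]
        mult_smult_distrib[of _ "2^N" "2^N" _ "2^N"]
        smult_smult_mat mult.commute)
  then show ?thesis by (simp add: pauli_mult[OF assms] smult_smult_mat mult.assoc)
qed

lemma herm_pauli_square:
  "m < 2 ^ N \<Longrightarrow> herm_pauli N m z * herm_pauli N m z = 1\<^sub>m (2 ^ N)"
proof -
  assume m: "m < 2 ^ N"
  have "of_real (chi N z m) * of_real (chi N z m) = (1::complex)"
    by (simp flip: of_real_mult)
  then show ?thesis
    unfolding herm_pauli_def smult_pauli_mult[OF m m] pauli_phase_square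
    by (simp add: pauli_zero)
qed

text \<open>The square fixes the scalar up to sign. This replaces phase bookkeeping: an involution
  that is a multiple of a string is the Hermitian string or its negative.\<close>

lemma smult_pauli_eq_herm_pauli:
  assumes m: "m < 2 ^ N" and sq: "(c \<cdot>\<^sub>m pauli N m z) * (c \<cdot>\<^sub>m pauli N m z) = 1\<^sub>m (2 ^ N)"
  shows "c \<cdot>\<^sub>m pauli N m z = herm_pauli N m z \<or> c \<cdot>\<^sub>m pauli N m z = (- 1) \<cdot>\<^sub>m herm_pauli N m z"
proof -
  have "((c * c * complex_of_real (chi N z m)) \<cdot>\<^sub>m 1\<^sub>m (2 ^ N)) $$ (0, 0) =
      (1\<^sub>m (2 ^ N) :: complex mat) $$ (0, 0)"
    using sq unfolding smult_pauli_mult[OF m m] by (simp add: pauli_zero)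
  then have "c * c * complex_of_real (chi N z m) = 1" by simp
  then have "(c * c) * (complex_of_real (chi N z m) * complex_of_real (chi N z m)) =
      complex_of_real (chi N z m)"
    by (metis mult.assoc mult_1)
  then have "c * c = complex_of_real (chi N z m)" by (simp flip: of_real_mult)
  then have "c * c = pauli_phase N m z * pauli_phase N m z" by (simp add: pauli_phase_square)
  then have "c = pauli_phase N m z \<or> c = - pauli_phase N m z" by (rule square_eq_iff[THEN iffD1])
  then show ?thesis by (auto simp: herm_pauli_def smult_smult_mat)
qed

subsection \<open>Rotations and quaternions generated by anticommuting involutions\<close>

text \<open>This is exp(itP) when \<open>P\<close> squares to the identity; the closed form
  postpones the exponential series until gates are evaluated.\<close>

definition rot :: "complex mat \<Rightarrow> real \<Rightarrow> complex mat" where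
  "rot P t = of_real (cos t) \<cdot>\<^sub>m 1\<^sub>m (dim_row P) + (\<i> * of_real (sin t)) \<cdot>\<^sub>m P"

lemma rot_carrier [simp]: "P \<in> carrier_mat n n \<Longrightarrow> rot P t \<in> carrier_mat n n"
  by (auto simp: rot_def)

lemma rot_index:
  "P \<in> carrier_mat n n \<Longrightarrow> x < n \<Longrightarrow> y < n \<Longrightarrow>
    rot P t $$ (x, y) = (if x = y then of_real (cos t) else 0) + \<i> * of_real (sin t) * P $$
        (x, y)"
  by (auto simp: rot_def)

lemma rot_uminus: "P \<in> carrier_mat n n \<Longrightarrow> rot ((- 1) \<cdot>\<^sub>m P) t = rot P (- t)"
  by (rule eq_matI) (auto simp: rot_def)

text \<open>The quaternion units are \<open>iP\<close>, \<open>iQ\<close> and their product \<open>-PQ\<close>.\<close>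

definition quat :: "complex mat \<Rightarrow> complex mat \<Rightarrow> real \<Rightarrow> real \<Rightarrow> real \<Rightarrow> real \<Rightarrow> complex mat" where
  "quat P Q a b c d = of_real a \<cdot>\<^sub>m 1\<^sub>m (dim_row P) + (\<i> * of_real b) \<cdot>\<^sub>m P + (\<i> * of_real c) \<cdot>\<^sub>m
      Q
     + (- of_real d) \<cdot>\<^sub>m (P * Q)"

context
  fixes n :: nat and P Q :: "complex mat"
  assumes P [simp]: "P \<in> carrier_mat n n" and Q [simp]: "Q \<in> carrier_mat n n"
    and PP: "P * P = 1\<^sub>m n" and QQ: "Q * Q = 1\<^sub>m n" and QP: "Q * P = (- 1) \<cdot>\<^sub>m (P * Q)"
begin

lemma PQ_carrier [simp]: "P * Q \<in> carrier_mat n n"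
  using P Q by (rule mult_carrier_mat)

lemma quat_carrier [simp]: "quat P Q a b c d \<in> carrier_mat n n"
  unfolding quat_def using P Q PQ_carrier by (metis add_carrier_mat smult_carrier_mat)

lemma anticommuting_dims: "dim_row P = n" "dim_col P = n" "dim_row Q = n" "dim_col Q = n"
  by (rule carrier_matD[OF P] carrier_matD[OF Q])+

lemma quat_index:
  "x < n \<Longrightarrow> y < n \<Longrightarrow> quat P Q a b c d $$ (x, y) = (if x = y then of_real a else 0)
    + \<i> * of_real b * P $$ (x, y) + \<i> * of_real c * Q $$ (x, y) - of_real d * (P * Q) $$ (x, y)"
  unfolding quat_def using anticommuting_dims by (simp del: index_mult_mat(1))

lemma quat_dim: "dim_row (quat P Q a b c d) = n" "dim_col (quat P Q a b c d) = n"
  using quat_carrier by blast+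

lemma anticommuting_products:
  "P * (P * Q) = Q" "(P * Q) * Q = P" "Q * (P * Q) = (- 1) \<cdot>\<^sub>m P" "(P * Q) * P = (- 1) \<cdot>\<^sub>m Q"
  "(P * Q) * (P * Q) = (- 1) \<cdot>\<^sub>m 1\<^sub>m n"
proof -
  show 1: "P * (P * Q) = Q" by (simp add: PP left_mult_one_mat[OF Q] flip:
      assoc_mult_mat[OF P P Q])
  show 2: "(P * Q) * Q = P" by (simp add: QQ right_mult_one_mat[OF P] assoc_mult_mat[OF P Q Q])
  have "Q * (P * Q) = (Q * P) * Q" by (simp add: assoc_mult_mat[OF Q P Q])
  also have "\<dots> = (- 1) \<cdot>\<^sub>m P" unfolding QP by (simp add: mult_smult_assoc_mat[OF PQ_carrier Q] 2)
  finally show 3: "Q * (P * Q) = (- 1) \<cdot>\<^sub>m P" .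
  have "(P * Q) * P = P * (Q * P)" by (simp add: assoc_mult_mat[OF P Q P])
  also have "\<dots> = (- 1) \<cdot>\<^sub>m Q" unfolding QP by (simp add: mult_smult_distrib[OF P PQ_carrier] 1)
  finally show 4: "(P * Q) * P = (- 1) \<cdot>\<^sub>m Q" .
  have "(P * Q) * (P * Q) = P * (Q * (P * Q))" by (simp add: assoc_mult_mat[OF P Q PQ_carrier])
  also have "\<dots> = (- 1) \<cdot>\<^sub>m 1\<^sub>m n" unfolding 3 by (simp add: mult_smult_distrib[OF P P] PP)
  finally show "(P * Q) * (P * Q) = (- 1) \<cdot>\<^sub>m 1\<^sub>m n" .
qed

lemma quat_mult:
  "quat P Q a b c d * quat P Q a' b' c' d' =
    quat P Q (a * a' - b * b' - c * c' - d * d') (a * b' + b * a' + c * d' - d * c')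
      (a * c' - b * d' + c * a' + d * b') (a * d' + b * c' - c * b' + d * a')" (is "?L = ?R")
proof -
  note PQ = PQ_carrier
  have d: "dim_row P = n" by (rule anticommuting_dims)
  have q: "quat P Q a b c d = of_real a \<cdot>\<^sub>m 1\<^sub>m n + (\<i> * of_real b) \<cdot>\<^sub>m P + (\<i> * of_real c) \<cdot>\<^sub>m Q
     + (- of_real d) \<cdot>\<^sub>m (P * Q)" for a b c d
    by (simp add: quat_def d)
  have l: "M * quat P Q a' b' c' d' = of_real a' \<cdot>\<^sub>m M + (\<i> * of_real b') \<cdot>\<^sub>m (M * P)
      + (\<i> * of_real c') \<cdot>\<^sub>m (M * Q) + (- of_real d') \<cdot>\<^sub>m (M * (P * Q))"
    if M: "M \<in> carrier_mat n n" for M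
    using M by (simp add: q mult_add_distrib_mat[of _ n n _ n] mult_smult_distrib[of _ n n _ n]
      right_mult_one_mat[OF M])
  have "?L = of_real a \<cdot>\<^sub>m quat P Q a' b' c' d' + (\<i> * of_real b) \<cdot>\<^sub>m (P * quat P Q a' b' c' d')
      + (\<i> * of_real c) \<cdot>\<^sub>m (Q * quat P Q a' b' c' d')
      + (- of_real d) \<cdot>\<^sub>m ((P * Q) * quat P Q a' b' c' d')"
    unfolding q[of a b c d]
    by (simp add: add_mult_distrib_mat[of _ n n _ _ n] mult_smult_assoc_mat[of _ n n _ n]
      left_mult_one_mat[OF quat_carrier])
  also have "\<dots> = ?R"
    unfolding l[OF P] l[OF Q] l[OF PQ] anticommuting_products PP QQ QP
    using anticommuting_dims by (intro eq_matI)
        (simp_all add: quat_dim quat_index algebra_simps del: index_mult_mat(1))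
  finally show ?thesis .
qed

lemma rot_eq_quat:
  "rot P t = quat P Q (cos t) (sin t) 0 0" "rot Q t = quat P Q (cos t) 0 (sin t) 0"
  unfolding rot_def quat_def using anticommuting_dims by
      (auto simp del: index_mult_mat(1) intro!: eq_matI)

text \<open>The pair \<open>(Q, -P)\<close> is \<open>(P, Q)\<close> turned by a right angle in its
  plane, with the same product. A fact about one axis in the plane thus transfers to the
  perpendicular one.\<close>

lemma quat_swap: "quat Q ((- 1) \<cdot>\<^sub>m P) a b c d = quat P Q a (- c) b d"
proof -
  have "Q * ((- 1) \<cdot>\<^sub>m P) = P * Q"
    by (simp add: mult_smult_distrib[OF Q P] QP smult_smult_mat)
  then show ?thesis
    unfolding quat_def using anticommuting_dims by (intro eq_matI)
        (simp_all del: index_mult_mat(1))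
qed

lemma rot_product: "rot ((- \<i>) \<cdot>\<^sub>m (P * Q)) t = quat P Q (cos t) 0 0 (- sin t)"
  unfolding rot_def quat_def using anticommuting_dims
  by (intro eq_matI) (simp_all add: algebra_simps del: index_mult_mat(1))

text \<open>Conjugation with angle pi/4 is a quarter turn about the axis \<open>Q\<close>; it
  carries the axis \<open>P\<close> to the third axis.\<close>

lemma rot_conj:
  "rot Q (pi / 4) * rot P t * rot Q (- (pi / 4)) = rot ((- \<i>) \<cdot>\<^sub>m (P * Q)) t"
  unfolding rot_product unfolding rot_eq_quat quat_mult
  by (simp add: cos_45 sin_45 flip: real_sqrt_mult)

end

lemma rot_add:
  assumes P: "P \<in> carrier_mat n n" and PP: "P * P = 1\<^sub>m n"
  shows "rot P s * rot P t = rot P (s + t)"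
proof -
  have "rot P s * rot P t = of_real (cos s) \<cdot>\<^sub>m rot P t + (\<i> * of_real (sin s)) \<cdot>\<^sub>m (P * rot P t)"
    unfolding rot_def[of P s] using P
    by (simp add: add_mult_distrib_mat[of _ n n _ _ n] mult_smult_assoc_mat[of _ n n _ n]
      left_mult_one_mat[OF rot_carrier[OF P]])
  moreover have "P * rot P t = of_real (cos t) \<cdot>\<^sub>m P + (\<i> * of_real (sin t)) \<cdot>\<^sub>m 1\<^sub>m n"
    unfolding rot_def using P
    by (simp add: mult_add_distrib_mat[of _ n n _ n] mult_smult_distrib[of _ n n _ n] PP)
  ultimately show ?thesis
    using P by (intro eq_matI) (auto simp: rot_def cos_add sin_add algebra_simps)
qed

lemma rot_zero: "P \<in> carrier_mat n n \<Longrightarrow> rot P 0 = 1\<^sub>m n"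
  by (auto simp: rot_def intro!: eq_matI)

subsection \<open>An irrational angle\<close>

text \<open>
  In \<open>\<int>[\<surd>2]\<close> the number \<open>\<surd>2 ^ n * 2 cos (n b)\<close> has an odd rational part for \<open>n > 0\<close>, which
  rules out \<open>cos (n b) = 1\<close>.
\<close>

lemma cos_multiple_odd:
  assumes b: "2 * cos b = 1 / sqrt 2 - 1"
  shows "\<exists>(p::int) (q::int) (p'::int) (q'::int). sqrt 2 ^ n * (2 * cos (real n * b)) =
      p + q * sqrt 2 \<and>
    sqrt 2 ^ Suc n * (2 * cos (real (Suc n) * b)) = p' + q' * sqrt 2 \<and> (n > 0 \<longrightarrow> odd p) \<and> odd p'"
proof (induction n)
  case 0
  \<comment> \<open>For n = 0 the number is 2, with even rational part, hence the guard
    \<open>n > 0\<close>; for n = 1 it is 1 - sqrt 2.\<close>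
  have "sqrt 2 * (2 * cos b) = 1 - sqrt 2" unfolding b by (simp add: field_simps)
  then show ?case
    by (intro exI[of _ 2] exI[of _ 0] exI[of _ 1] exI[of _ "- 1"]) simp
next
  case (Suc n)
  then obtain p q p' q' :: int where
    1: "sqrt 2 ^ n * (2 * cos (real n * b)) = p + q * sqrt 2" and
    2: "sqrt 2 ^ Suc n * (2 * cos (real (Suc n) * b)) = p' + q' * sqrt 2" "odd p'"
    by blast
  define C where "C k = cos (real k * b)" for k
  have "C (Suc (Suc n)) + C n = 2 * cos b * C (Suc n)"
    unfolding C_def cos_plus_cos by (simp add: algebra_simps add_divide_distrib flip:
        diff_divide_distrib)
  then have C2: "C (Suc (Suc n)) = 2 * cos b * C (Suc n) - C n" by (simp add: eq_diff_eq)
  have "sqrt 2 ^ Suc (Suc n) * (2 * C (Suc (Suc n))) =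
      sqrt 2 * (2 * cos b) * (sqrt 2 ^ Suc n * (2 * C (Suc n))) - (sqrt 2)\<^sup>2 *
          (sqrt 2 ^ n * (2 * C n))"
    unfolding C2 by (simp add: power2_eq_square algebra_simps)
  also have "\<dots> = (1 - sqrt 2) * (p' + q' * sqrt 2) - 2 * (p + q * sqrt 2)"
    using 1 2(1) unfolding C_def b by (simp add: field_simps)
  \<comment> \<open>The new rational part is \<open>p'\<close> minus an even number, so oddness
    passes on. Scaling by powers of sqrt 2 keeps the coefficients integral because 2 cos b = (1 -
    sqrt 2) / sqrt 2.\<close>
  also have "\<dots> = (p' - 2 * q' - 2 * p) + (q' - p' - 2 * q) * sqrt 2"
    by (simp add: algebra_simps)
  finally have "sqrt 2 ^ Suc (Suc n) * (2 * cos (real (Suc (Suc n)) * b)) =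
    of_int (p' - 2 * q' - 2 * p) + of_int (q' - p' - 2 * q) * sqrt 2"
    unfolding C_def by simp
  moreover have "odd (p' - 2 * q' - 2 * p)" using 2(2) by simp
  ultimately show ?case using 2 by blast
qed

lemma odd_square_neq:
  fixes p e :: int assumes "odd p" shows "real_of_int p \<noteq> real_of_int e * sqrt 2"
proof
  assume "real_of_int p = real_of_int e * sqrt 2"
  then have "(real_of_int p)\<^sup>2 = 2 * (real_of_int e)\<^sup>2" by (simp add: power_mult_distrib)
  then have "real_of_int (p\<^sup>2) = real_of_int (2 * e\<^sup>2)" by simp
  then have "p\<^sup>2 = 2 * e\<^sup>2" by (simp only: of_int_eq_iff)
  with assms show False by (metis dvd_triv_left even_power)
qed

text \<open>The number \<open>2 * sqrt 2 ^ n\<close> is an integer for even \<open>n\<close> and an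
  integer multiple of sqrt 2 for odd \<open>n\<close>. Either way the odd part \<open>p\<close>
  would yield an odd integer that is an integer multiple of sqrt 2.\<close>

lemma cos_multiple_neq_1:
  assumes b: "2 * cos b = 1 / sqrt 2 - 1" and n: "n > 0"
  shows "cos (real n * b) \<noteq> 1"
proof
  assume c: "cos (real n * b) = 1"
  obtain p q :: int where pq: "sqrt 2 ^ n * (2 * cos (real n * b)) = p + q * sqrt 2" "odd p"
    using cos_multiple_odd[OF b, of n] n by blast
  define k where "k = n div 2"
  have p2: "sqrt 2 ^ (2 * k) = real_of_int (2 ^ k)" by (simp add: power_mult)
  show False
  proof (cases "even n")
    case True
    then have "real_of_int (p - 2 * 2 ^ k) = real_of_int (- q) * sqrt 2"
      using pq(1) p2 unfolding c by (simp add: k_def)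
    moreover have "odd (p - 2 * 2 ^ k)" using pq(2) by simp
    ultimately show False using odd_square_neq by blast
  next
    case False
    then have "n = Suc (2 * k)" by (simp add: k_def)
    then have "real_of_int p = real_of_int (2 * 2 ^ k - q) * sqrt 2"
      using pq(1) p2 unfolding c by (simp add: algebra_simps)
    then show False using odd_square_neq[OF pq(2)] by blast
  qed
qed

lemma abs_cos_diff_le: "\<bar>cos x - cos y\<bar> \<le> \<bar>x - y :: real\<bar>"
proof -
  have "\<bar>cos x - cos y\<bar> = 2 * \<bar>sin ((x + y) / 2)\<bar> * \<bar>sin ((y - x) / 2)\<bar>"
    by (simp add: cos_diff_cos abs_mult)
  also have "\<dots> \<le> 2 * 1 * \<bar>(y - x) / 2\<bar>"
    by (intro mult_mono abs_sin_x_le_abs_x) auto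
  finally show ?thesis by simp
qed

lemma abs_sin_diff_le: "\<bar>sin x - sin y\<bar> \<le> \<bar>x - y :: real\<bar>"
  using abs_cos_diff_le[of "pi / 2 - x" "pi / 2 - y"] by (simp add: cos_diff)

text \<open>The hypothesis makes \<open>b / (2 * pi)\<close> irrational, and Kronecker's theorem in
  one dimension approximates \<open>t\<close> modulo full turns. The multiplier is positive, so
  powers of a rotation suffice.\<close>

lemma multiples_dense:
  assumes b: "\<And>n::nat. n > 0 \<Longrightarrow> cos (real n * b) \<noteq> 1" and e: "e > 0"
  obtains k :: nat where "\<bar>cos (real k * b) - cos t\<bar> \<le> e" "\<bar>sin (real k * b) - sin t\<bar> \<le> e"
proof -
  have "b / (2 * pi) \<notin> \<rat>"
  proof
    assume "b / (2 * pi) \<in> \<rat>"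
    then obtain i j :: int where ij: "b / (2 * pi) = of_int i / of_int j" "j > 0"
      by (meson Rats_cases')
    then have "of_int j * b = 2 * pi * of_int i" by (simp add: field_simps)
    then have "real (nat j) * b = 2 * pi * of_int i" using ij(2) by simp
    then have "cos (real (nat j) * b) = 1" using cos_int_2pin[of i] by simp
    then show False using b[of "nat j"] ij(2) by simp
  qed
  then obtain h k :: int where k: "k > 0" "\<bar>of_int k * (b / (2 * pi)) - of_int h - t / (2 * pi)\<bar> <
      e / (2 * pi)"
    using sequence_of_fractional_parts_is_dense[of "b / (2 * pi)" "e / (2 * pi)" "t / (2 * pi)"] e
    by (metis divide_pos_pos mult_pos_pos pi_gt_zero zero_less_numeral)
  have "of_int k * (b / (2 * pi)) - of_int h - t / (2 * pi) =
      (of_int k * b - 2 * pi * of_int h - t) / (2 * pi)"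
    by (simp add: field_simps)
  then have "\<bar>of_int k * (b / (2 * pi)) - of_int h - t / (2 * pi)\<bar> =
      \<bar>of_int k * b - 2 * pi * of_int h - t\<bar> / (2 * pi)"
    by (simp add: abs_divide)
  then have d: "\<bar>of_int k * b - (t + 2 * pi * of_int h)\<bar> \<le> e"
    using k(2) by (simp add: field_simps)
  have "cos (t + 2 * pi * of_int h) = cos t" "sin (t + 2 * pi * of_int h) = sin t"
    by (simp_all add: cos_add sin_add)
  then show ?thesis
    using that[of "nat k"] k(1) abs_cos_diff_le[of "of_int k * b" "t + 2 * pi * of_int h"]
      abs_sin_diff_le[of "of_int k * b" "t + 2 * pi * of_int h"] d by simp
qed

subsection \<open>Closed monoids of operators\<close>

text \<open>Inverses are not assumed, since circuits supply only products. Entrywise closure is norm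
  closure in a fixed finite dimension, and phases are included because the target is approximated
  only up to a phase.\<close>

locale approx_monoid =
  fixes n :: nat and G :: "complex mat set"
  assumes carrier: "A \<in> G \<Longrightarrow> A \<in> carrier_mat n n"
    and one: "1\<^sub>m n \<in> G"
    and mult: "A \<in> G \<Longrightarrow> B \<in> G \<Longrightarrow> A * B \<in> G"
    and phase: "A \<in> G \<Longrightarrow> cmod c = 1 \<Longrightarrow> c \<cdot>\<^sub>m A \<in> G"
    and closed: "A \<in> carrier_mat n n \<Longrightarrow>
      (\<And>e. e > 0 \<Longrightarrow> \<exists>B\<in>G. \<forall>x<n. \<forall>y<n. cmod (B $$ (x, y) - A $$ (x, y)) \<le> e) \<Longrightarrow> A \<in> G"
begin

lemma rot_multiple:
  assumes P: "P \<in> carrier_mat n n" "P * P = 1\<^sub>m n" and G: "rot P t \<in> G"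
  shows "rot P (real k * t) \<in> G"
proof (induction k)
  case 0
  then show ?case using one P by (simp add: rot_zero)
next
  case (Suc k)
  have "rot P (real (Suc k) * t) = rot P (real k * t) * rot P t"
    by (simp add: rot_add[OF P] algebra_simps)
  then show ?case using mult[OF Suc G] by simp
qed

lemma rot_dense:
  assumes P: "P \<in> carrier_mat n n" "P * P = 1\<^sub>m n" and G: "rot P b \<in> G"
    and b: "\<And>k::nat. k > 0 \<Longrightarrow> cos (real k * b) \<noteq> 1"
  shows "rot P t \<in> G"
proof (rule closed)
  show "rot P t \<in> carrier_mat n n" using P by simp
next
  fix e :: real assume e: "e > 0"
  \<comment> \<open>\<open>K\<close> dominates 1 plus the modulus of any entry of \<open>P\<close>,
    so errors \<open>e / K\<close> in cosine and sine give entry errors of at most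
    \<open>e\<close>.\<close>
  define K where "K = 1 + (\<Sum>x<n. \<Sum>y<n. cmod (P $$ (x, y)))"
  have K: "1 + cmod (P $$ (x, y)) \<le> K" if "x < n" "y < n" for x y
  proof -
    have "cmod (P $$ (x, y)) \<le> (\<Sum>y<n. cmod (P $$ (x, y)))"
      using that by (intro member_le_sum) auto
    also have "\<dots> \<le> (\<Sum>x<n. \<Sum>y<n. cmod (P $$ (x, y)))"
      using that by (intro member_le_sum[of x _ "\<lambda>x. \<Sum>y<n. cmod (P $$ (x, y))"] sum_nonneg) auto
    finally show ?thesis by (simp add: K_def)
  qed
  have K0: "K > 0" by (auto simp: K_def intro!: add_pos_nonneg sum_nonneg)
  obtain k :: nat where k: "\<bar>cos (real k * b) - cos t\<bar> \<le> e / K"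
      "\<bar>sin (real k * b) - sin t\<bar> \<le> e / K"
    using multiples_dense[OF b, of "e / K" t] e K0 by (metis divide_pos_pos)
  have "cmod (rot P (real k * b) $$ (x, y) - rot P t $$ (x, y)) \<le> e" if xy: "x < n" "y < n" for x
      y
  proof -
    have "rot P (real k * b) $$ (x, y) - rot P t $$ (x, y) =
        (if x = y then of_real (cos (real k * b) - cos t) else 0) + \<i> * of_real
            (sin (real k * b) - sin t) * P $$ (x, y)"
      unfolding rot_index[OF P(1) xy] by (simp add: algebra_simps)
    also have "cmod \<dots> \<le> \<bar>cos (real k * b) - cos t\<bar> + \<bar>sin (real k * b) - sin t\<bar> * cmod
        (P $$ (x, y))"
      by (rule norm_triangle_le) (auto simp: norm_mult simp del: of_real_diff)
    also have "\<dots> \<le> e / K + e / K * cmod (P $$ (x, y))"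
      using k by (intro add_mono mult_right_mono) auto
    also have "\<dots> = e / K * (1 + cmod (P $$ (x, y)))" by (simp add: algebra_simps)
    also have "\<dots> \<le> e / K * K" using e K0 K[OF xy] by (intro mult_left_mono) auto
    finally show ?thesis using K0 by simp
  qed
  then show "\<exists>B\<in>G. \<forall>x<n. \<forall>y<n. cmod (B $$ (x, y) - rot P t $$ (x, y)) \<le> e"
    using rot_multiple[OF P G] by blast
qed

text \<open>
  The palindrome \<open>e\<^bsup>i\<pi>P/8\<^esup> e\<^bsup>i\<pi>Q/8\<^esup> e\<^bsup>i\<pi>P/8\<^esup>\<close> rotates about an axis in the plane of \<open>P\<close> and \<open>Q\<close>, by an
  angle that is not a rational multiple of \<open>\<pi>\<close>.
\<close>

lemma palindrome_rot:
  assumes P: "P \<in> carrier_mat n n" "P * P = 1\<^sub>m n" and Q: "Q \<in> carrier_mat n n" "Q * Q = 1\<^sub>m n"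
    and QP: "Q * P = (- 1) \<cdot>\<^sub>m (P * Q)"
    and G: "rot P (pi / 8) \<in> G" "rot Q (pi / 8) \<in> G"
  defines "c \<equiv> cos (pi / 8) / sqrt 2" and "s \<equiv> sin (pi / 8)"
  defines "r \<equiv> sqrt (1 - c\<^sup>2)"
  shows "quat P Q (cos t) (c / r * sin t) (s / r * sin t) 0 \<in> G" and "c\<^sup>2 + s\<^sup>2 = r\<^sup>2" and "r > 0"
proof -
  note qm = quat_mult[OF P(1) Q(1) P(2) Q(2) QP] and rq = rot_eq_quat[OF P(1) Q(1) P(2) Q(2) QP]
  have "sqrt 2 / 2 = 2 * (cos (pi / 8))\<^sup>2 - 1"
    using cos_double_cos[of "pi / 8"] by (simp add: cos_45)
  then have "(cos (pi / 8))\<^sup>2 = 1 / 2 + sqrt 2 / 4" by linarith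
  then have c2: "c\<^sup>2 = 1 / 4 + sqrt 2 / 8" by (simp add: c_def power_divide)
  have s2: "s\<^sup>2 = 1 - 2 * c\<^sup>2" by (simp add: s_def c_def power_divide sin_squared_eq)
  have sqrt2: "sqrt 2 < 2" by (simp add: real_less_lsqrt)
  have "c\<^sup>2 < 1" unfolding c2 using sqrt2 by simp
  then have r2: "r\<^sup>2 = 1 - c\<^sup>2" and r0: "r > 0" by (simp_all add: r_def)
  then show cs: "c\<^sup>2 + s\<^sup>2 = r\<^sup>2" and "r > 0" using s2 by simp_all
  have c0: "c \<ge> 0" unfolding c_def by (auto intro!: divide_nonneg_nonneg cos_ge_zero)
  define a where "a = arccos c"
  have "c \<le> 1" using \<open>c\<^sup>2 < 1\<close> abs_square_less_1[of c] by simp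
  then have a: "cos a = c" "sin a = r" using c0
    by (simp_all add: a_def r_def sin_arccos)
  define R where "R = of_real (c / r) \<cdot>\<^sub>m P + of_real (s / r) \<cdot>\<^sub>m Q"
  have R: "R \<in> carrier_mat n n" using P Q by (simp add: R_def)
  have iR: "\<i> \<cdot>\<^sub>m R = quat P Q 0 (c / r) (s / r) 0"
    using anticommuting_dims[OF P(1) Q(1) P(2) Q(2) QP] unfolding R_def quat_def
    by (intro eq_matI) (simp_all add: algebra_simps del: index_mult_mat(1))
  have rotR: "rot R t = quat P Q (cos t) (c / r * sin t) (s / r * sin t) 0" for t
    using anticommuting_dims[OF P(1) Q(1) P(2) Q(2) QP] unfolding rot_def R_def quat_def
    by (intro eq_matI) (simp_all add: algebra_simps del: index_mult_mat(1))
  have sum1: "c / r * (c / r) + s / r * (s / r) = 1"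
    using cs r0 by (simp add: field_simps power2_eq_square)
  have sum1': "0 * 0 - c / r * (c / r) - s / r * (s / r) - 0 * 0 = - 1" using sum1 by linarith
  have "(\<i> \<cdot>\<^sub>m R) * (\<i> \<cdot>\<^sub>m R) = quat P Q (- 1) 0 0 0"
    unfolding iR qm sum1' by simp
  also have "\<dots> = (- 1) \<cdot>\<^sub>m 1\<^sub>m n"
    using anticommuting_dims[OF P(1) Q(1) P(2) Q(2) QP] unfolding quat_def by (intro eq_matI)
        (simp_all del: index_mult_mat(1))
  finally have RR: "(- 1) \<cdot>\<^sub>m (R * R) = (- 1) \<cdot>\<^sub>m 1\<^sub>m n"
    by (simp add: mult_smult_assoc_mat[OF R smult_carrier_mat[OF R]] mult_smult_distrib[OF R R]
        smult_smult_mat)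
  have "R * R = (- 1) \<cdot>\<^sub>m ((- 1) \<cdot>\<^sub>m (R * R))" by (simp add: smult_smult_mat)
  also have "\<dots> = 1\<^sub>m n" unfolding RR by (simp add: smult_smult_mat)
  finally have RR: "R * R = 1\<^sub>m n" .
  \<comment> \<open>The symmetric order cancels the \<open>P * Q\<close> components. The scalar part
    cos(pi/8) cos(pi/4) and the \<open>P\<close> part cos(pi/8) sin(pi/4) agree, which is why
    \<open>c\<close> appears twice.\<close>
  have "rot P (pi / 8) * rot Q (pi / 8) * rot P (pi / 8) = quat P Q c c s 0"
  proof -
    let ?c = "cos (pi / 8)"
    have 1: "?c * ?c + s * s = 1" unfolding s_def by (metis sin_cos_squared_add3)
    have 2: "?c * ?c - s * s = 1 / sqrt 2" "2 * (s * ?c) = 1 / sqrt 2"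
    proof -
      have h: "1 / sqrt 2 = sqrt 2 / 2" by (simp add: field_simps)
      have "cos (2 * (pi / 8)) = ?c * ?c - s * s" "sin (2 * (pi / 8)) = 2 * (s * ?c)"
        by (simp_all only: cos_double sin_double s_def power2_eq_square mult.assoc)
      then show "?c * ?c - s * s = 1 / sqrt 2" "2 * (s * ?c) = 1 / sqrt 2"
        unfolding h by (simp_all add: cos_45 sin_45)
    qed
    have "rot P (pi / 8) * rot Q (pi / 8) * rot P (pi / 8) =
        quat P Q (?c * (?c * ?c - s * s)) (?c * (2 * (s * ?c))) (s * (?c * ?c + s * s)) 0"
      unfolding rq qm s_def[symmetric] by (simp add: algebra_simps)
    then show ?thesis unfolding 1 2 by (simp add: c_def)
  qed
  also have "\<dots> = rot R a" unfolding rotR using a r0 by simp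
  finally have Ga: "rot R a \<in> G" using mult[OF mult[OF G] G(1)] by simp
  \<comment> \<open>The angle is doubled because cos(2a) = 2 c^2 - 1 lies in Q(sqrt 2), where the
    parity argument applies.\<close>
  have G2: "rot R (2 * a) \<in> G" using rot_multiple[OF R RR Ga, of 2] by simp
  have "2 * cos (2 * a) = 1 / sqrt 2 - 1"
    unfolding cos_double_cos a(1) c2 by (simp add: real_div_sqrt field_simps)
  then have "rot R t \<in> G"
    using rot_dense[OF R RR G2] cos_multiple_neq_1 by blast
  then show "quat P Q (cos t) (c / r * sin t) (s / r * sin t) 0 \<in> G" unfolding rotR .
qed

text \<open>The palindromes of \<open>(P, Q)\<close> and \<open>(Q, -P)\<close> give all rotations
  about the perpendicular axes a P + b Q and a Q - b P. A quarter turn about the second carries the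
  first to the axis of \<open>P * Q\<close>, so the skew direction drops out.\<close>

lemma rot_all_angles:
  assumes P: "P \<in> carrier_mat n n" "P * P = 1\<^sub>m n" and Q: "Q \<in> carrier_mat n n" "Q * Q = 1\<^sub>m n"
    and QP: "Q * P = (- 1) \<cdot>\<^sub>m (P * Q)"
    and G: "rot P (pi / 8) \<in> G" "rot P (- (pi / 8)) \<in> G" "rot Q (pi / 8) \<in> G"
  shows "rot ((- \<i>) \<cdot>\<^sub>m (P * Q)) t \<in> G"
proof -
  note qm = quat_mult[OF P(1) Q(1) P(2) Q(2) QP] and rq = rot_eq_quat[OF P(1) Q(1) P(2) Q(2) QP]
  define c where "c = cos (pi / 8) / sqrt 2"
  define s where "s = sin (pi / 8)"
  define r where "r = sqrt (1 - c\<^sup>2)"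
  note pr = palindrome_rot[OF P Q QP G(1,3), folded c_def s_def, folded r_def]
  let ?P = "(- 1) \<cdot>\<^sub>m P"
  have P': "?P \<in> carrier_mat n n" "?P * ?P = 1\<^sub>m n"
    using P by (simp_all add: mult_smult_assoc_mat[OF P(1) smult_carrier_mat[OF P(1)]]
      mult_smult_distrib[OF P(1) P(1)] smult_smult_mat)
  have QP': "?P * Q = (- 1) \<cdot>\<^sub>m (Q * ?P)"
    by (simp add: mult_smult_assoc_mat[OF P(1) Q(1)] mult_smult_distrib[OF Q(1) P(1)] QP
        smult_smult_mat)
  have "rot ?P (pi / 8) \<in> G" using G(2) by (simp add: rot_uminus[OF P(1)])
  note pr' = palindrome_rot[OF Q P' QP' G(3) this, folded c_def s_def, folded r_def,
    unfolded quat_swap[OF P(1) Q(1) P(2) Q(2) QP]]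
  define a b where "a = c / r" and "b = s / r"
  have ab: "a * a + b * b = 1"
    using pr(2,3) by (simp add: a_def b_def field_simps power2_eq_square)
  have "quat P Q (cos (pi / 4)) (- (b * sin (pi / 4))) (a * sin (pi / 4)) 0 *
      quat P Q (cos t) (a * sin t) (b * sin t) 0 *
      quat P Q (cos (- (pi / 4))) (- (b * sin (- (pi / 4)))) (a * sin (- (pi / 4))) 0 \<in> G"
    unfolding a_def b_def using mult[OF mult[OF pr'(1) pr(1)] pr'(1)] .
  also have "quat P Q (cos (pi / 4)) (- (b * sin (pi / 4))) (a * sin (pi / 4)) 0 *
      quat P Q (cos t) (a * sin t) (b * sin t) 0 *
      quat P Q (cos (- (pi / 4))) (- (b * sin (- (pi / 4)))) (a * sin (- (pi / 4))) 0 =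
      quat P Q (cos t) 0 0 (- sin t)"
  proof -
    define w :: real where "w = sqrt 2 / 2"
    have w: "w * w = 1 / 2" by (simp add: w_def)
    have 1: "cos (pi / 4) = w" "sin (pi / 4) = w" by (simp_all add: w_def cos_45 sin_45)
    have "quat P Q w (- (b * w)) (a * w) 0 * quat P Q (cos t) (a * sin t) (b * sin t) 0 *
        quat P Q w (- (b * - w)) (a * - w) 0 =
        quat P Q ((w * w) * (cos t + (a * a + b * b) * cos t))
          ((w * w) * (a * sin t - (a * a + b * b) * (a * sin t)))
          ((w * w) * (b * sin t - (a * a + b * b) * (b * sin t)))
          ((w * w) * (- 2 * (a * a + b * b) * sin t))"
      unfolding qm by (simp add: algebra_simps)
    then show ?thesis unfolding cos_minus sin_minus 1 ab w by simp
  qed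
  finally show ?thesis unfolding rot_product[OF P(1) Q(1) P(2) Q(2) QP] .
qed

end

subsection \<open>Rotations about Pauli strings\<close>

definition anticomm :: "nat \<Rightarrow> nat \<Rightarrow> nat \<Rightarrow> nat \<Rightarrow> nat \<Rightarrow> bool" where
  "anticomm N m z m' z' \<longleftrightarrow> chi N z m' * chi N z' m = - 1"

text \<open>With both signs of the angle the predicate is insensitive to the sign of the Hermitian
  string, and it provides the inverse that a conjugation requires.\<close>

definition pauli_angle :: "complex mat set \<Rightarrow> nat \<Rightarrow> real \<Rightarrow> nat \<Rightarrow> nat \<Rightarrow> bool" where
  "pauli_angle G N t m z \<longleftrightarrow> m < 2 ^ N \<and> rot (herm_pauli N m z) t \<in> G \<and>
      rot (herm_pauli N m z) (- t) \<in> G"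

lemma herm_pauli_anticommute:
  assumes m: "m < 2 ^ N" "m' < 2 ^ N" and a: "anticomm N m z m' z'"
  shows "herm_pauli N m' z' * herm_pauli N m z =
      (- 1) \<cdot>\<^sub>m (herm_pauli N m z * herm_pauli N m' z')"
proof -
  have "chi N z' m = - chi N z m'"
    using a chi_cases[of N z m'] by (auto simp: anticomm_def)
  then show ?thesis
    unfolding herm_pauli_def smult_pauli_mult[OF m] smult_pauli_mult[OF m(2,1)]
    by (simp add: smult_smult_mat xor.commute mult.commute mult.left_commute)
qed

lemma herm_pauli_product:
  assumes m: "m < 2 ^ N" "m' < 2 ^ N" and a: "anticomm N m z m' z'"
  defines "R \<equiv> (- \<i>) \<cdot>\<^sub>m (herm_pauli N m z * herm_pauli N m' z')"
  shows "R = herm_pauli N (xor m m') (xor z z') \<or> R =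
      (- 1) \<cdot>\<^sub>m herm_pauli N (xor m m') (xor z z')"
proof -
  let ?P = "herm_pauli N m z" and ?Q = "herm_pauli N m' z'"
  have PQ: "?P * ?Q \<in> carrier_mat (2 ^ N) (2 ^ N)" by (meson herm_pauli_carrier mult_carrier_mat)
  have "(?P * ?Q) * (?P * ?Q) = (- 1) \<cdot>\<^sub>m 1\<^sub>m (2 ^ N)"
    by (rule anticommuting_products(5)) (simp_all add: herm_pauli_square m
        herm_pauli_anticommute[OF m a])
  then have "R * R = 1\<^sub>m (2 ^ N)"
    unfolding R_def by (simp add: mult_smult_assoc_mat[OF PQ smult_carrier_mat[OF PQ]]
        mult_smult_distrib[OF PQ PQ] smult_smult_mat)
  moreover obtain c where "R = c \<cdot>\<^sub>m pauli N (xor m m') (xor z z')"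
    unfolding R_def herm_pauli_def smult_pauli_mult[OF m] smult_smult_mat by blast
  ultimately show ?thesis
    using smult_pauli_eq_herm_pauli[OF xor_less_exp[OF m]] by blast
qed

lemma pauli_angle_iff:
  assumes "R = herm_pauli N m z \<or> R = (- 1) \<cdot>\<^sub>m herm_pauli N m z"
  shows "pauli_angle G N t m z \<longleftrightarrow> m < 2 ^ N \<and> rot R t \<in> G \<and> rot R (- t) \<in> G"
  using assms rot_uminus[OF herm_pauli_carrier] by (auto simp: pauli_angle_def)

locale pauli_monoid = approx_monoid "2 ^ N" G for N :: nat and G
begin

lemma pauli_angle_conj:
  assumes a: "pauli_angle G N t m z" "pauli_angle G N (pi / 4) m' z'" and ac:
      "anticomm N m z m' z'"
  shows "pauli_angle G N t (xor m m') (xor z z')"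
proof -
  have m: "m < 2 ^ N" "m' < 2 ^ N" using a by (simp_all add: pauli_angle_def)
  note rc = rot_conj[OF herm_pauli_carrier herm_pauli_carrier herm_pauli_square[OF m(1)]
      herm_pauli_square[OF m(2)] herm_pauli_anticommute[OF m ac]]
  show ?thesis
    unfolding pauli_angle_iff[OF herm_pauli_product[OF m ac]] rc[symmetric]
    using a mult xor_less_exp[OF m] unfolding pauli_angle_def by blast
qed

text \<open>A rotation of finite order has its inverse among its powers: \<open>k - 1\<close> steps
  of \<open>t\<close> differ from a full turn by \<open>- t\<close>.\<close>

lemma pauli_angle_minus:
  assumes m: "m < 2 ^ N" and G: "rot (herm_pauli N m z) t \<in> G" and k: "\<bar>real k * t\<bar> = 2 * pi"
  shows "pauli_angle G N t m z"
proof -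
  have k0: "k > 0" using k by (cases k) auto
  have "real (k - 1) * t = real k * t - t" using k0 by (simp add: algebra_simps of_nat_diff)
  then have "rot (herm_pauli N m z) (real k * t - t) \<in> G"
    using rot_multiple[OF herm_pauli_carrier herm_pauli_square[OF m] G, of "k - 1"] by simp
  moreover have "real k * t = 2 * pi \<or> real k * t = - (2 * pi)" using k by linarith
  then have "rot (herm_pauli N m z) (real k * t - t) = rot (herm_pauli N m z) (- t)"
    by (auto simp: rot_def cos_diff sin_diff)
  ultimately show ?thesis using m G by (simp add: pauli_angle_def)
qed

lemma pauli_angle_all:
  assumes a: "pauli_angle G N (pi / 8) m z" "pauli_angle G N (pi / 8) m' z'" and ac:
      "anticomm N m z m' z'"
  shows "pauli_angle G N t (xor m m') (xor z z')"
proof -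
  have m: "m < 2 ^ N" "m' < 2 ^ N" using a by (simp_all add: pauli_angle_def)
  show ?thesis
    unfolding pauli_angle_iff[OF herm_pauli_product[OF m ac]]
    using a xor_less_exp[OF m] rot_all_angles[OF herm_pauli_carrier herm_pauli_square[OF m(1)]
        herm_pauli_carrier herm_pauli_square[OF m(2)] herm_pauli_anticommute[OF m ac]]
    unfolding pauli_angle_def by blast
qed

end

lemma anticomm_iff_odd:
  "anticomm N m z m' z' \<longleftrightarrow> chi N z m' \<noteq> chi N z' m"
  using chi_cases[of N z m'] chi_cases[of N z' m] by (auto simp: anticomm_def)

subsection \<open>Pauli strings generated by the gates\<close>

text \<open>Clearing one set bit lowers the weight, so single flips reach every mask supported on
  \<open>K\<close> from 0.\<close>

lemma bit_string_induct [consumes 1, case_names zero flip]: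
  fixes d :: nat
  assumes "\<forall>k. bit d k \<longrightarrow> k \<in> K" and "P 0"
    and "\<And>d k. P d \<Longrightarrow> k \<in> K \<Longrightarrow> P (xor d (2 ^ k))"
  shows "P d"
  using assms(1)
proof (induction "card {k. bit d k}" arbitrary: d rule: less_induct)
  case less
  show ?case
  proof (cases "d = 0")
    case False
    then obtain k where k: "bit d k" by (metis bit_eqI bit_0_eq bot_apply bot_bool_def)
    have fin: "finite {l. bit d l}"
      by (rule finite_subset[of _ "{..<Suc d}"])
        (auto simp: less_Suc_eq_le dest!: nat_bit_bound[of _ _ d] intro: less_imp_le)
    have "{l. bit (xor d (2 ^ k)) l} = {l. bit d l} - {k}" using k by (auto simp: bit_xor_iff)
    then have "card {l. bit (xor d (2 ^ k)) l} < card {l. bit d l}"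
      using fin k by (metis card_Diff1_less mem_Collect_eq)
    moreover have "\<forall>l. bit (xor d (2 ^ k)) l \<longrightarrow> l \<in> K"
      using less.prems k by (auto simp: bit_xor_iff split: if_splits)
    ultimately have "P (xor d (2 ^ k))" using less.hyps by blast
    then show ?thesis using assms(3)[of "xor d (2 ^ k)" k] less.prems k by simp
  qed (simp add: assms(2))
qed

definition between_mask :: "nat \<Rightarrow> nat \<Rightarrow> nat" where
  "between_mask j k = push_bit (Suc j) (mask (k - Suc j))"

lemma bit_between_mask: "bit (between_mask j k) i \<longleftrightarrow> j < i \<and> i < k"
  unfolding between_mask_def bit_push_bit_iff bit_mask_iff by auto

definition site_mask :: "nat \<Rightarrow> nat \<Rightarrow> nat" where
  "site_mask Nq N = push_bit Nq (mask (N - Nq))"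

lemma bit_site_mask: "bit (site_mask Nq N) i \<longleftrightarrow> Nq \<le> i \<and> i < N"
  by (auto simp: site_mask_def bit_push_bit_iff bit_mask_iff)

text \<open>The locale states what the gates contribute, with signs and phases dropped: quarter
  turns about \<open>Z\<close> and \<open>X\<close> on qubits, braid strings, and conjugation by a
  qubit-site controlled sign. Two sites ensure that each site has a braiding partner; qubit
  \<open>q\<close> later becomes the ancilla.\<close>

locale gate_monoid = pauli_monoid N G for N G +
  fixes Nq q :: nat
  assumes q: "q < Nq" and sites: "Nq + 2 \<le> N"
    and Z: "i < Nq \<Longrightarrow> pauli_angle G N (pi / 4) 0 (2 ^ i)"
    and X: "i < Nq \<Longrightarrow> pauli_angle G N (pi / 4) (2 ^ i) 0"
    and braid: "Nq \<le> j \<Longrightarrow> j < k \<Longrightarrow> k < N \<Longrightarrow>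
      pauli_angle G N (pi / 4) (xor (2 ^ j) (2 ^ k)) (between_mask j k)"
    and CZ: "i < Nq \<Longrightarrow> Nq \<le> j \<Longrightarrow> j < N \<Longrightarrow> pauli_angle G N (pi / 4) m z \<Longrightarrow>
      pauli_angle G N (pi / 4) m
        (xor z (xor (if bit m i then 2 ^ j else 0) (if bit m j then 2 ^ i else 0)))"
begin

text \<open>
  A fact about \<open>S\<close> is named after the factors of its string: \<open>B\<close> is a braid string \<open>(m, b)\<close> through
  site \<open>j\<close>, and \<open>X\<close>, \<open>Y\<close>, \<open>Z\<close> are Pauli operators on single qubits or sites. No gate couples two
  qubits directly, so \<open>ZZ\<close> on a pair of qubits is built through a site.
\<close>

abbreviation S :: "nat \<Rightarrow> nat \<Rightarrow> bool" where "S \<equiv> pauli_angle G N (pi / 4)"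

lemma less_N: "i < Nq \<Longrightarrow> i < N" "q < N"
  using q sites by simp_all

lemma S_mult:
  assumes "S m z" "S m' z'" "anticomm N m z m' z'" "xor m m' = m''" "xor z z' = z''"
  shows "S m'' z''"
  using pauli_angle_conj[OF assms(1-3)] assms(4,5) by simp

lemmas anticomm_simps = anticomm_def chi_xor_left chi_xor_right chi_exp_right chi_exp_left less_N
    bit_xor_iff

lemma Y: "i < Nq \<Longrightarrow> S (2 ^ i) (2 ^ i)"
  by (rule S_mult[OF X Z]) (simp_all add: anticomm_simps)

lemma chi_between_mask:
  "a < b \<Longrightarrow> b < N \<Longrightarrow> chi N (between_mask a b) (xor (2 ^ a) (2 ^ b)) = 1"
  by (simp add: anticomm_simps bit_between_mask)

lemma site_partner:
  assumes j: "Nq \<le> j" "j < N"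
  obtains m b where "S m b" "bit m j" "\<not> bit b j" "\<And>i. i < Nq \<Longrightarrow> \<not> bit m i \<and> \<not> bit b i"
    "chi N b m = 1"
proof -
  \<comment> \<open>The partner is the first site, or the second when \<open>j\<close> is itself the
    first.\<close>
  define k where "k = (if j = Nq then Suc Nq else Nq)"
  have k: "Nq \<le> k" "k < N" "k \<noteq> j" using j sites by (auto simp: k_def)
  let ?a = "min j k" and ?b = "max j k"
  have ab: "Nq \<le> ?a" "?a < ?b" "?b < N" using j k by auto
  show ?thesis
  proof (rule that)
    show "S (xor (2 ^ ?a) (2 ^ ?b)) (between_mask ?a ?b)" by (rule braid[OF ab])
    show "chi N (between_mask ?a ?b) (xor (2 ^ ?a) (2 ^ ?b)) = 1"
      by (rule chi_between_mask[OF ab(2,3)])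
  qed (use ab j k in \<open>auto simp: bit_xor_iff bit_between_mask min_def max_def\<close>)
qed

lemma ZX: "i < Nq \<Longrightarrow> Nq \<le> j \<Longrightarrow> j < N \<Longrightarrow> S (2 ^ i) (2 ^ j)"
  using CZ[OF _ _ _ X, of i j i] by auto

lemma ZZ_site:
  assumes "Nq \<le> j" "j < N" shows "S 0 (xor (2 ^ j) (2 ^ q))"
  by (rule S_mult[OF ZX[OF q assms] Y[OF q]]) (use q assms in \<open>auto simp: anticomm_simps\<close>)

context
  fixes j m b
  assumes j: "Nq \<le> j" "j < N" and S: "S m b" and mb: "bit m j" "\<not> bit b j"
    and nq: "\<And>i. i < Nq \<Longrightarrow> \<not> bit m i \<and> \<not> bit b i" and bm: "chi N b m = 1"
begin

lemma BZ: "i < Nq \<Longrightarrow> S m (xor b (2 ^ i))"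
  using CZ[OF _ j S, of i] nq mb by simp

lemma BX: "i < Nq \<Longrightarrow> S (xor m (2 ^ i)) b"
  by (rule S_mult[OF BZ Y]) (use nq in \<open>auto simp: anticomm_simps xor.assoc\<close>)

lemma ZBX: "S (xor (2 ^ q) m) (xor (2 ^ j) b)"
  by (rule S_mult[OF ZX[OF q j] S]) (use nq mb q j in \<open>auto simp: anticomm_simps\<close>)

text \<open>No gate common to both sets acts on a single site. Here \<open>Z_j\<close> is the
  product of \<open>X_q Z_j B\<close> and \<open>B X_q\<close>, in which the braid string and the
  flip of \<open>q\<close> cancel.\<close>

lemma Z_site_aux: "S 0 (2 ^ j)"
  by (rule S_mult[OF ZBX BX[OF q]])
    (use nq mb bm q j in \<open>auto simp: anticomm_simps xor.assoc xor.commute xor.left_commute\<close>)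

lemma ZB: "S m (xor (2 ^ j) b)"
  by (rule S_mult[OF Z_site_aux S]) (use nq mb q j in \<open>auto simp: anticomm_simps\<close>)

lemma ZBZ: "S m (xor (xor (2 ^ j) b) (2 ^ q))"
  using CZ[OF q j ZB] nq[OF q] mb by simp

lemma ZXZ: "i < Nq \<Longrightarrow> i \<noteq> q \<Longrightarrow> S (2 ^ i) (xor (2 ^ j) (2 ^ q))"
  by (rule S_mult[OF BX ZBZ])
    (use nq mb bm q j in \<open>auto simp: anticomm_simps xor.assoc xor.commute xor.left_commute\<close>)

text \<open>The strings \<open>X_i Z_j Z_q\<close> and \<open>X_i Z_j Z_i\<close> anticommute on
  qubit \<open>i\<close> alone, and in their product the mediating site and the flip cancel.\<close>

lemma ZZ_qubit_aux: "i < Nq \<Longrightarrow> i \<noteq> q \<Longrightarrow> S 0 (xor (2 ^ i) (2 ^ q))"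
proof -
  assume i: "i < Nq" "i \<noteq> q"
  have "S (2 ^ i) (xor (2 ^ j) (2 ^ i))"
    by (rule S_mult[OF ZX[OF i(1) j] Z[OF i(1)]]) (use i j in \<open>auto simp: anticomm_simps\<close>)
  then show ?thesis
    by (rule S_mult[OF ZXZ[OF i]])
      (use i q j in \<open>auto simp: anticomm_simps xor.assoc xor.commute xor.left_commute\<close>)
qed

text \<open>An arbitrary angle moves off the site along \<open>Z_j\<close>, \<open>Z_j B\<close>,
  \<open>X_q Z_j\<close>, \<open>Z_q\<close>, each time by conjugation with an anticommuting quarter
  turn. This makes \<open>T^f\<close> on a site as good as \<open>T\<close> on qubit
  \<open>q\<close>.\<close>

lemma angle_site_to_qubit_aux:
  assumes "pauli_angle G N t 0 (2 ^ j)" shows "pauli_angle G N t 0 (2 ^ q)"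
proof -
  have "S (2 ^ q) (xor (2 ^ j) (2 ^ q))"
    by (rule S_mult[OF ZX[OF q j] Z[OF q]]) (use q j in \<open>auto simp: anticomm_simps\<close>)
  moreover have "pauli_angle G N t m (xor (2 ^ j) b)"
    using pauli_angle_conj[OF assms S] nq mb q j by (simp add: anticomm_simps)
  then have "pauli_angle G N t (xor m (xor m (2 ^ q))) (xor (xor (2 ^ j) b) b)"
    by (rule pauli_angle_conj[OF _ BX[OF q]]) (use nq mb bm q j in \<open>auto simp: anticomm_simps\<close>)
  then have "pauli_angle G N t (2 ^ q) (2 ^ j)" by simp
  ultimately have "pauli_angle G N t (xor (2 ^ q) (2 ^ q)) (xor (2 ^ j) (xor (2 ^ j) (2 ^ q)))"
    by - (rule pauli_angle_conj, assumption+, use q j in \<open>auto simp: anticomm_simps\<close>)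
  then show ?thesis by simp
qed

end

lemma Z_all: "k < N \<Longrightarrow> S 0 (2 ^ k)"
proof (cases "k < Nq")
  case False
  moreover assume "k < N"
  ultimately have k: "Nq \<le> k" "k < N" by simp_all
  show ?thesis by (rule site_partner[OF k], rule Z_site_aux[OF k])
qed (rule Z)

lemma ZZ_all: "k < N \<Longrightarrow> k \<noteq> q \<Longrightarrow> S 0 (xor (2 ^ k) (2 ^ q))"
proof (cases "k < Nq")
  case True
  moreover assume "k \<noteq> q"
  moreover have Nq: "Nq \<le> Nq" "Nq < N" using sites by simp_all
  ultimately show ?thesis
    by - (rule site_partner[OF Nq], rule ZZ_qubit_aux[OF Nq])
qed (simp add: ZZ_site)

lemma XZ: "i < Nq \<Longrightarrow> i \<noteq> q \<Longrightarrow> S (2 ^ i) (2 ^ q)"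
  by (rule S_mult[OF ZZ_all Y]) (use less_N in
      \<open>auto simp: anticomm_simps xor.assoc xor.commute xor.left_commute\<close>)

lemma braid_Z:
  assumes "Nq \<le> j" "j < k" "k < N"
  shows "S (xor (2 ^ j) (2 ^ k)) (xor (between_mask j k) (2 ^ q))"
  using CZ[OF q _ _ braid[OF assms], of j] assms q by (simp add: bit_xor_iff)

lemma angle_site_to_qubit:
  "Nq \<le> j \<Longrightarrow> j < N \<Longrightarrow> pauli_angle G N t 0 (2 ^ j) \<Longrightarrow> pauli_angle G N t 0 (2 ^ q)"
  by (rule site_partner[of j], assumption, assumption) (rule angle_site_to_qubit_aux[of j])

text \<open>
  If the two strings commute, \<open>X\<close> and \<open>Z\<close> on qubit \<open>q\<close> are attached to make them anticommute, and
  the remaining factor \<open>Y\<close> is turned back into \<open>Z\<close>.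
\<close>

lemma S_step:
  assumes P: "S m (xor z (2 ^ q))" "\<not> bit m q" "\<not> bit z q"
    and g: "S m' z'" "S m' (xor z' (2 ^ q))" "\<not> bit m' q" "\<not> bit z' q"
  shows "S (xor m m') (xor (xor z z') (2 ^ q))"
proof (cases "anticomm N m z m' z'")
  case True
  then show ?thesis
    by (intro S_mult[OF P(1) g(1)])
      (use g P in \<open>auto simp: anticomm_simps xor.assoc xor.commute xor.left_commute\<close>)
next
  case False
  have 1: "S (xor m (2 ^ q)) (xor z (2 ^ q))"
    by (rule S_mult[OF P(1) X[OF q]]) (use P q in \<open>auto simp: anticomm_simps\<close>)
  have "chi N z m' = chi N z' m" using False anticomm_iff_odd by blast
  then have 2: "S (xor (xor m m') (2 ^ q)) (xor z z')"
    by (intro S_mult[OF 1 g(2)])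
      (use g P q in \<open>auto simp: anticomm_simps xor.assoc xor.commute xor.left_commute\<close>)
  show ?thesis
    by (rule S_mult[OF 2 Y[OF q]])
      (use g P q in \<open>auto simp: anticomm_simps xor.assoc xor.commute xor.left_commute\<close>)
qed

text \<open>The sign mask changes bit by bit; \<open>Z_k\<close> and \<open>Z_k Z_q\<close> are the
  two versions of a factor that \<open>S_step\<close> asks for.\<close>

lemma S_all_Z:
  assumes S: "S m (xor z (2 ^ q))" "\<not> bit m q" "\<not> bit z q"
    and z': "z' < 2 ^ N" "\<not> bit z' q" and z: "z < 2 ^ N"
  shows "S m (xor z' (2 ^ q))"
proof -
  have d: "\<forall>k. bit (xor z z') k \<longrightarrow> k \<in> {..<N} - {q}"
    using z z' S(3) nat_bit_bound xor_less_exp[OF z z'(1)] by (auto simp: bit_xor_iff)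
  have "\<not> bit (xor z d) q \<and> S m (xor (xor z d) (2 ^ q))"
    if "\<forall>k. bit d k \<longrightarrow> k \<in> {..<N} - {q}" for d
    using that
  proof (induction d rule: bit_string_induct)
    case zero
    then show ?case using S by simp
  next
    case (flip d k)
    then have "S (xor m 0) (xor (xor (xor z d) (2 ^ k)) (2 ^ q))"
      by (intro S_step) (use S(2) Z_all ZZ_all in auto)
    then show ?case using flip by (auto simp: bit_xor_iff xor.assoc)
  qed
  from this[OF d] show ?thesis by simp
qed

text \<open>Induction on the weight of the flip mask: qubit flips are peeled off singly, site flips
  in pairs through a braid. The character of \<open>site_mask\<close> counts flipped sites modulo 2,
  so a flipped site always has a second one.\<close>

lemma S_even:
  assumes m: "m < 2 ^ N" "\<not> bit m q" "chi N (site_mask Nq N) m = 1"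
  shows "z < 2 ^ N \<Longrightarrow> \<not> bit z q \<Longrightarrow> S m (xor z (2 ^ q))"
  using m
proof (induction "card {k. bit m k}" arbitrary: m z rule: less_induct)
  case less
  have step: "S m (xor z (2 ^ q))"
    if d: "{l. bit (xor m m') l} \<subset> {l. bit m l}" and m': "m' < 2 ^ N" "z' < 2 ^ N" "\<not> bit m' q"
      "\<not> bit z' q" "chi N (site_mask Nq N) m' = 1" "S m' z'" "S m' (xor z' (2 ^ q))" for m' z'
  proof -
    have fin: "finite {l. bit m l}"
      by (rule finite_subset[of _ "{..<N}"]) (use less.prems nat_bit_bound in auto)
    have "card {l. bit (xor m m') l} < card {l. bit m l}" by (rule psubset_card_mono[OF fin d])
    then have "S (xor m m') (xor (xor z z') (2 ^ q))"
      by (rule less.hyps) (use less.prems m' in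
          \<open>auto simp: bit_xor_iff chi_xor_right intro: xor_less_exp\<close>)
    then have "S (xor (xor m m') m') (xor (xor (xor z z') z') (2 ^ q))"
      by (rule S_step) (use less.prems m' in \<open>auto simp: bit_xor_iff\<close>)
    then show ?thesis by simp
  qed
  show ?case
  proof (cases "m = 0")
    case True
    have "S 0 (xor 0 (2 ^ q))" using Z[OF q] by simp
    then show ?thesis unfolding True by (rule S_all_Z) (use less.prems in auto)
  next
    case False
    then obtain k where k: "bit m k" by (metis bit_eqI bit_0_eq bot_apply bot_bool_def)
    then have kN: "k < N" using less.prems nat_bit_bound by blast
    have kq: "k \<noteq> q" using k less.prems by blast
    show ?thesis
    proof (cases "k < Nq")
      case True
      show ?thesis
        by (rule step[of "2 ^ k" 0]) (use k kq True kN X[OF True] XZ[OF True kq] in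
          \<open>auto simp: bit_xor_iff chi_exp_right bit_site_mask\<close>)
    next
      case site: False
      have "\<exists>l. l \<noteq> k \<and> bit m l \<and> Nq \<le> l"
      proof (rule ccontr)
        assume "\<not> ?thesis"
        then have "chi N (site_mask Nq N) (xor m (2 ^ k)) = 1"
          using k by (intro chi_eq_1) (auto simp: bit_site_mask bit_xor_iff)
        then show False
          using less.prems(5) site k kN by (simp add: chi_xor_right chi_exp_right bit_site_mask)
      qed
      then obtain l where l: "l \<noteq> k" "bit m l" "Nq \<le> l" by blast
      then have lN: "l < N" using less.prems nat_bit_bound by blast
      let ?a = "min k l" and ?b = "max k l"
      have ab: "Nq \<le> ?a" "?a < ?b" "?b < N" "bit m ?a" "bit m ?b"
        using l site k kN lN by (auto simp: min_def max_def)
      have 1: "between_mask ?a ?b < 2 ^ N"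
        by (rule nat_bit_less) (use ab in \<open>auto simp: bit_between_mask\<close>)
      have 2: "{i. bit (xor m (xor (2 ^ ?a) (2 ^ ?b))) i} \<subset> {i. bit m i}"
        using ab by (auto simp: bit_xor_iff)
      have 3: "xor (2 ^ ?a) (2 ^ ?b) < (2 ^ N :: nat)"
        using ab by (intro xor_less_exp) auto
      show ?thesis
        by (rule step[OF 2 3 1 _ _ _ braid[OF ab(1-3)] braid_Z[OF ab(1-3)]])
          (use ab q in \<open>auto simp: bit_xor_iff bit_between_mask chi_xor_right chi_exp_right
              bit_site_mask\<close>)
    qed
  qed
qed

text \<open>Arbitrary angles are produced on qubit \<open>q\<close> only, from \<open>X_q\<close>
  and \<open>Y_q\<close> at pi/8. Quarter turns carry them from \<open>Z_q\<close> to
  \<open>X_q\<close>, to \<open>X_q P Z_q\<close> and to \<open>P Z_q\<close>; passing through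
  \<open>X_q\<close> guarantees anticommutation with \<open>P Z_q\<close> whatever the string
  \<open>P\<close> off \<open>q\<close> is.\<close>

theorem pauli_angle_even:
  assumes t8: "pauli_angle G N (pi / 8) 0 (2 ^ k)" "k = q \<or> Nq \<le> k" "k < N"
    and m: "m < 2 ^ N" "\<not> bit m q" "chi N (site_mask Nq N) m = 1" and z: "z < 2 ^ N" "\<not> bit z q"
  shows "pauli_angle G N t m (xor z (2 ^ q))"
proof -
  have Z8: "pauli_angle G N (pi / 8) 0 (2 ^ q)"
    using t8 angle_site_to_qubit by blast
  have ac: "anticomm N 0 (2 ^ q) (2 ^ q) (2 ^ q)" "anticomm N 0 (2 ^ q) (2 ^ q) 0"
    "anticomm N (2 ^ q) 0 (2 ^ q) (2 ^ q)"
    using q by (simp_all add: anticomm_simps)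
  have X8: "pauli_angle G N (pi / 8) (2 ^ q) 0"
    using pauli_angle_conj[OF Z8 Y[OF q] ac(1)] by simp
  have Y8: "pauli_angle G N (pi / 8) (2 ^ q) (2 ^ q)"
    using pauli_angle_conj[OF Z8 X[OF q] ac(2)] by simp
  have "pauli_angle G N t 0 (2 ^ q)"
    using pauli_angle_all[OF X8 Y8 ac(3)] by simp
  then have "pauli_angle G N t (2 ^ q) 0"
    using pauli_angle_conj[OF _ Y[OF q] ac(1)] by simp
  then have "pauli_angle G N t (xor (2 ^ q) m) (xor 0 (xor z (2 ^ q)))"
    by (rule pauli_angle_conj[OF _ S_even]) (use m z q in \<open>auto simp: anticomm_simps\<close>)
  then have "pauli_angle G N t (xor (xor (2 ^ q) m) (2 ^ q)) (xor (xor 0 (xor z (2 ^ q))) 0)"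
    by (rule pauli_angle_conj[OF _ X[OF q]]) (use m z q in \<open>auto simp: anticomm_simps\<close>)
  then show ?thesis by (simp add: xor.commute xor.left_commute)
qed

end

subsection \<open>Two-level rotations and diagonal phases\<close>

lemma xor_eq_simps [simp]:
  fixes x y m :: nat
  shows "xor x m = xor y m \<longleftrightarrow> x = y" "xor m x = xor m y \<longleftrightarrow> x = y"
    "xor x m = x \<longleftrightarrow> m = 0" "x = xor x m \<longleftrightarrow> m = 0"
proof -
  show "xor x m = xor y m \<longleftrightarrow> x = y" by (metis xor_cancel(1))
  show "xor m x = xor m y \<longleftrightarrow> x = y" by (metis xor_cancel(2))
  show "xor x m = x \<longleftrightarrow> m = 0" by (metis xor_cancel(2) xor.right_neutral xor_self_eq)
  then show "x = xor x m \<longleftrightarrow> m = 0" by auto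
qed

text \<open>On each pair \<open>{y, xor y m}\<close> on which \<open>g\<close> is constant this is
  exp(i g X), with an angle that may vary from pair to pair. The invariance hypotheses on
  \<open>g\<close> below express this constancy.\<close>

definition flip_rot :: "nat \<Rightarrow> nat \<Rightarrow> (nat \<Rightarrow> real) \<Rightarrow> complex mat" where
  "flip_rot N m g = mat (2 ^ N) (2 ^ N) (\<lambda>(x, y).
     if x = y then of_real (cos (g y)) else if x = xor y m then \<i> * of_real (sin (g y)) else 0)"

definition diag_phase :: "nat \<Rightarrow> (nat \<Rightarrow> real) \<Rightarrow> complex mat" where
  "diag_phase N g = mat (2 ^ N) (2 ^ N) (\<lambda>(x, y). if x = y then cis (g y) else 0)"

lemma flip_rot_carrier [simp]: "flip_rot N m g \<in> carrier_mat (2 ^ N) (2 ^ N)"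
  and diag_phase_carrier [simp]: "diag_phase N g \<in> carrier_mat (2 ^ N) (2 ^ N)"
  by (simp_all add: flip_rot_def diag_phase_def)

lemma flip_rot_mult_index:
  assumes m: "m < 2 ^ N" "m \<noteq> 0" and g: "g (xor x m) = g x"
    and B: "B \<in> carrier_mat (2 ^ N) (2 ^ N)" and xy: "x < 2 ^ N" "y < 2 ^ N"
  shows "(flip_rot N m g * B) $$ (x, y) =
    of_real (cos (g x)) * B $$ (x, y) + \<i> * of_real (sin (g x)) * B $$ (xor x m, y)"
proof -
  have neq: "xor x m \<noteq> x" using m(2) by (metis xor_cancel(2) xor_self_eq)
  have "(flip_rot N m g * B) $$ (x, y) = (\<Sum>w<2 ^ N.
      (if w = x then of_real (cos (g x)) * B $$ (x, y) else 0)
      + (if w = xor x m then \<i> * of_real (sin (g x)) * B $$ (xor x m, y) else 0))"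
    unfolding mult_index[OF flip_rot_carrier B xy]
  proof (intro sum.cong refl)
    fix w assume "w \<in> {..<(2 ^ N :: nat)}"
    then show "flip_rot N m g $$ (x, w) * B $$ (w, y) =
        (if w = x then of_real (cos (g x)) * B $$ (x, y) else 0)
        + (if w = xor x m then \<i> * of_real (sin (g x)) * B $$ (xor x m, y) else 0)"
      using xy neq g xor_eq_iff[of x w m] by (auto simp: flip_rot_def)
  qed
  also have "\<dots> = of_real (cos (g x)) * B $$ (x, y) + \<i> * of_real (sin (g x)) * B $$ (xor x m, y)"
    using xy xor_less_exp[OF xy(1) m(1)] by (simp add: sum.distrib)
  finally show ?thesis .
qed

lemma diag_phase_mult_index:
  assumes B: "B \<in> carrier_mat (2 ^ N) (2 ^ N)" and xy: "x < 2 ^ N" "y < 2 ^ N"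
  shows "(diag_phase N g * B) $$ (x, y) = cis (g x) * B $$ (x, y)"
proof -
  have "(diag_phase N g * B) $$ (x, y) = (\<Sum>w<2 ^ N. if w = x then cis (g x) * B $$ (x, y) else 0)"
    unfolding mult_index[OF diag_phase_carrier B xy]
    by (intro sum.cong) (use xy in \<open>auto simp: diag_phase_def\<close>)
  then show ?thesis using xy by simp
qed

lemma flip_rot_add:
  assumes m: "m < 2 ^ N" "m \<noteq> 0" and g: "\<And>x. g (xor x m) = g x" and h: "\<And>x. h (xor x m) = h x"
  shows "flip_rot N m g * flip_rot N m h = flip_rot N m (\<lambda>x. g x + h x)"
proof (rule eq_matI)
  fix x y assume "x < dim_row (flip_rot N m (\<lambda>x. g x + h x))"
      "y < dim_col (flip_rot N m (\<lambda>x. g x + h x))"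
  then have xy: "x < 2 ^ N" "y < 2 ^ N" by (simp_all add: flip_rot_def)
  have neq: "xor y m \<noteq> y" for y using m(2) by (metis xor_cancel(2) xor_self_eq)
  have x': "xor x m < 2 ^ N" using xor_less_exp[OF xy(1) m(1)] .
  show "(flip_rot N m g * flip_rot N m h) $$ (x, y) = flip_rot N m (\<lambda>x. g x + h x) $$ (x, y)"
    unfolding flip_rot_mult_index[where g = g, OF m g flip_rot_carrier xy]
    using xy x' neq[of x] neq[of y] g[of y] h[of y] xor_eq_iff[of x y m]
    by (auto simp: flip_rot_def cos_add sin_add algebra_simps)
qed (simp_all add: flip_rot_def)

lemma diag_phase_add: "diag_phase N g * diag_phase N h = diag_phase N (\<lambda>x. g x + h x)"
proof (rule eq_matI)
  fix x y assume "x < dim_row (diag_phase N (\<lambda>x. g x + h x))"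
      "y < dim_col (diag_phase N (\<lambda>x. g x + h x))"
  then have xy: "x < 2 ^ N" "y < 2 ^ N" by (simp_all add: diag_phase_def)
  show "(diag_phase N g * diag_phase N h) $$ (x, y) = diag_phase N (\<lambda>x. g x + h x) $$ (x, y)"
    unfolding diag_phase_mult_index[OF diag_phase_carrier xy]
    using xy by (simp add: diag_phase_def cis_mult)
qed (simp_all add: diag_phase_def)

lemma flip_rot_cong:
  "(\<And>x. x < 2 ^ N \<Longrightarrow> g x = h x) \<Longrightarrow> flip_rot N m g = flip_rot N m h"
  by (rule eq_matI) (auto simp: flip_rot_def)

lemma diag_phase_cong:
  "(\<And>x. x < 2 ^ N \<Longrightarrow> g x = h x) \<Longrightarrow> diag_phase N g = diag_phase N h"
  by (rule eq_matI) (auto simp: diag_phase_def)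

lemma flip_rot_zero: "flip_rot N m (\<lambda>_. 0) = 1\<^sub>m (2 ^ N)"
  and diag_phase_zero: "diag_phase N (\<lambda>_. 0) = 1\<^sub>m (2 ^ N)"
  by (auto simp: flip_rot_def diag_phase_def intro!: eq_matI)

text \<open>Under this hypothesis the string carries no factor i. Its signs move into the angle
  because sine is odd and cosine is even.\<close>

lemma rot_herm_pauli_eq:
  assumes "chi N m z = 1" "m < 2 ^ N"
  shows "rot (herm_pauli N m z) t =
    (if m = 0 then diag_phase N (\<lambda>y. t * chi N z y) else flip_rot N m (\<lambda>y. t * chi N z y))"
proof (rule eq_matI)
  fix x y assume "x < dim_row (if m = 0 then diag_phase N (\<lambda>y. t * chi N z y) else flip_rot N m
      (\<lambda>y. t * chi N z y))"
    "y < dim_col (if m = 0 then diag_phase N (\<lambda>y. t * chi N z y) else flip_rot N m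
        (\<lambda>y. t * chi N z y))"
  then have xy: "x < 2 ^ N" "y < 2 ^ N" by (auto simp: flip_rot_def diag_phase_def split:
      if_splits)
  have h: "herm_pauli N m z $$ (x, y) = (if x = xor y m then of_real (chi N z y) else 0)"
    using xy assms by (simp add: herm_pauli_def pauli_phase_def pauli_index)
  show "rot (herm_pauli N m z) t $$ (x, y) = (if m = 0 then diag_phase N (\<lambda>y. t * chi N z y)
      else flip_rot N m (\<lambda>y. t * chi N z y)) $$ (x, y)"
    unfolding rot_index[OF herm_pauli_carrier xy] h
    using chi_cases[of N z y] xy xor_cancel(2)[of y m]
    by (auto simp: flip_rot_def diag_phase_def cis_conv_exp complex_eq_iff Re_exp Im_exp)
qed (auto simp: rot_def flip_rot_def diag_phase_def herm_pauli_def)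

section \<open>Adjoints and isometries\<close>

lemma mat_adjoint_mult:
  fixes A B :: "complex mat"
  assumes A: "A \<in> carrier_mat n n" and B: "B \<in> carrier_mat n n"
  shows "mat_adjoint (A * B) = mat_adjoint B * mat_adjoint A"
proof (rule eq_matI)
  have c: "mat_adjoint A \<in> carrier_mat n n" "mat_adjoint B \<in> carrier_mat n n"
      "A * B \<in> carrier_mat n n"
    using A B by auto
  fix x y assume "x < dim_row (mat_adjoint B * mat_adjoint A)"
      "y < dim_col (mat_adjoint B * mat_adjoint A)"
  then have xy: "x < n" "y < n" using A B by auto
  then have "mat_adjoint (A * B) $$ (x, y) = cnj ((A * B) $$ (y, x))"
    using A B by (intro mat_adjoint_index) auto
  also have "\<dots> = (\<Sum>z<n. cnj (A $$ (y, z)) * cnj (B $$ (z, x)))"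
    using xy by (simp add: mult_index[OF A B])
  also have "\<dots> = (mat_adjoint B * mat_adjoint A) $$ (x, y)"
    unfolding mult_index[OF c(2,1) xy] using A B xy
    by (intro sum.cong) (auto simp: mat_adjoint_index mult.commute)
  finally show "mat_adjoint (A * B) $$ (x, y) = (mat_adjoint B * mat_adjoint A) $$ (x, y)" .
qed (use A B in auto)

definition isometry :: "nat \<Rightarrow> complex mat \<Rightarrow> bool" where
  "isometry n V \<longleftrightarrow> V \<in> carrier_mat n n \<and> mat_adjoint V * V = 1\<^sub>m n"

lemma isometry_mult:
  assumes "isometry n A" "isometry n B"
  shows "isometry n (A * B)"
proof -
  have c: "A \<in> carrier_mat n n" "B \<in> carrier_mat n n" "mat_adjoint A \<in> carrier_mat n n"
    "mat_adjoint B \<in> carrier_mat n n"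
    using assms by (auto simp: isometry_def)
  have "mat_adjoint (A * B) * (A * B) = mat_adjoint B * ((mat_adjoint A * A) * B)"
    unfolding mat_adjoint_mult[OF c(1,2)] assoc_mult_mat[OF c(3,1,2)]
    by (rule assoc_mult_mat[OF c(4,3) mult_carrier_mat[OF c(1,2)]])
  also have "mat_adjoint A * A = 1\<^sub>m n" using assms(1) by (simp add: isometry_def)
  also have "1\<^sub>m n * B = B" using c(2) by (rule left_mult_one_mat)
  finally show ?thesis using assms(2) mult_carrier_mat[OF c(1,2)] unfolding isometry_def by simp
qed

lemma isometry_flip_rot:
  assumes m: "m < 2 ^ N" "m \<noteq> 0" and g: "\<And>x. g (xor x m) = g x"
  shows "isometry (2 ^ N) (flip_rot N m g)"
proof -
  have "mat_adjoint (flip_rot N m g) = flip_rot N m (\<lambda>x. - g x)"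
  proof (rule eq_matI)
    fix x y assume "x < dim_row (flip_rot N m (\<lambda>x. - g x))"
        "y < dim_col (flip_rot N m (\<lambda>x. - g x))"
    then show "mat_adjoint (flip_rot N m g) $$ (x, y) = flip_rot N m (\<lambda>x. - g x) $$ (x, y)"
      using xor_eq_iff[of x y m] g[of y] by (auto simp: mat_adjoint_index flip_rot_def)
  qed (simp_all add: flip_rot_def)
  then have "mat_adjoint (flip_rot N m g) * flip_rot N m g = flip_rot N m (\<lambda>_. 0)"
    using flip_rot_add[where g = "\<lambda>x. - g x" and h = g, OF m] g by simp
  then show ?thesis by (simp add: isometry_def flip_rot_zero)
qed

lemma isometry_diag_phase: "isometry (2 ^ N) (diag_phase N g)"
proof -
  have "mat_adjoint (diag_phase N g) = diag_phase N (\<lambda>x. - g x)"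
    by (rule eq_matI) (auto simp: mat_adjoint_index diag_phase_def cis_cnj)
  then show ?thesis by (simp add: isometry_def diag_phase_add diag_phase_zero)
qed

lemma isometry_col_norm:
  assumes V: "isometry n V" and k: "k < n"
  shows "(\<Sum>x<n. (cmod (V $$ (x, k)))\<^sup>2) = 1"
proof -
  have c: "V \<in> carrier_mat n n" "mat_adjoint V \<in> carrier_mat n n"
    using V by (auto simp: isometry_def)
  have "(mat_adjoint V * V) $$ (k, k) = (\<Sum>x<n. of_real ((cmod (V $$ (x, k)))\<^sup>2))"
    unfolding mult_index[OF c(2,1) k k] complex_norm_square using c(1) k
    by (intro sum.cong) (auto simp: mat_adjoint_index)
  then have "complex_of_real (\<Sum>x<n. (cmod (V $$ (x, k)))\<^sup>2) = of_real 1"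
    using V k by (simp add: isometry_def)
  then show ?thesis by (simp only: of_real_eq_iff)
qed

text \<open>A left inverse of a square matrix is also a right inverse, so rows are normalized as
  well as columns.\<close>

lemma isometry_row_norm:
  assumes V: "isometry n V" and k: "k < n"
  shows "(\<Sum>y<n. (cmod (V $$ (k, y)))\<^sup>2) = 1"
proof -
  have c: "V \<in> carrier_mat n n" "mat_adjoint V \<in> carrier_mat n n"
    using V by (auto simp: isometry_def)
  have "V * mat_adjoint V = 1\<^sub>m n"
    using V mat_mult_left_right_inverse[OF c(2,1)] by (simp add: isometry_def)
  moreover have "(V * mat_adjoint V) $$ (k, k) = (\<Sum>y<n. of_real ((cmod (V $$ (k, y)))\<^sup>2))"
    unfolding mult_index[OF c k k] complex_norm_square using c(1) k
    by (intro sum.cong) (auto simp: mat_adjoint_index)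
  ultimately have "complex_of_real (\<Sum>y<n. (cmod (V $$ (k, y)))\<^sup>2) = of_real 1"
    using k by simp
  then show ?thesis by (simp only: of_real_eq_iff)
qed

lemma sum_eq_single:
  fixes f :: "nat \<Rightarrow> real"
  assumes "(\<Sum>x<n. f x) = f k" "k < n" "\<And>x. f x \<ge> 0" "x < n" "x \<noteq> k"
  shows "f x = 0"
proof -
  have "(\<Sum>x\<in>{..<n} - {k}. f x) = 0"
    using assms(1,2) by (simp add: sum_diff1)
  then show ?thesis using assms by (subst (asm) sum_nonneg_eq_0_iff) auto
qed

section \<open>Fourier synthesis of two-level rotations, and elimination with them\<close>

locale rotation_monoid =
  fixes N f :: nat and G :: "complex mat set"
  assumes mult: "A \<in> G \<Longrightarrow> B \<in> G \<Longrightarrow> A * B \<in> G"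
    and rots: "m < 2 ^ N \<Longrightarrow> z < 2 ^ N \<Longrightarrow> chi N f m = 1 \<Longrightarrow> rot (herm_pauli N m z) t \<in> G"
begin

lemma one: "1\<^sub>m (2 ^ N) \<in> G"
  using rots[of 0 0 0] by (simp add: rot_zero[OF herm_pauli_carrier])

text \<open>Rotations with one flip mask and invariant characters commute, and their angle functions
  add.\<close>

lemma flip_rot_characters:
  assumes m: "m < 2 ^ N" "m \<noteq> 0" "chi N f m = 1" and Z: "finite Z"
      "\<And>z. z \<in> Z \<Longrightarrow> z < 2 ^ N \<and> chi N z m = 1"
  shows "flip_rot N m (\<lambda>y. \<Sum>z\<in>Z. c z * chi N z y) \<in> G"
  using Z
proof (induction Z rule: finite_induct)
  case empty
  then show ?case using one by (simp add: flip_rot_zero)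
next
  case (insert z Z)
  have inv: "chi N w (xor x m) = chi N w x" if "w \<in> insert z Z" for w x
    using insert.prems[OF that] by (simp add: chi_xor_right)
  have "rot (herm_pauli N m z) (c z) \<in> G" using rots m insert.prems by blast
  then have "flip_rot N m (\<lambda>y. c z * chi N z y) \<in> G"
    using rot_herm_pauli_eq[of N m z "c z"] m insert.prems[of z] by (simp add: chi_commute)
  then have "flip_rot N m (\<lambda>y. c z * chi N z y) * flip_rot N m (\<lambda>y. \<Sum>z\<in>Z. c z * chi N z y) \<in> G"
    using mult insert by blast
  also have "flip_rot N m (\<lambda>y. c z * chi N z y) * flip_rot N m (\<lambda>y. \<Sum>z\<in>Z. c z * chi N z y) =
      flip_rot N m (\<lambda>y. c z * chi N z y + (\<Sum>z\<in>Z. c z * chi N z y))"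
    by (rule flip_rot_add[OF m(1,2)]) (auto simp: inv)
  finally show ?case using insert by simp
qed

lemma diag_phase_characters:
  assumes Z: "finite Z" "\<And>z. z \<in> Z \<Longrightarrow> z < 2 ^ N"
  shows "diag_phase N (\<lambda>y. \<Sum>z\<in>Z. c z * chi N z y) \<in> G"
  using Z
proof (induction Z rule: finite_induct)
  case empty
  then show ?case using one by (simp add: diag_phase_zero)
next
  case (insert z Z)
  have "rot (herm_pauli N 0 z) (c z) \<in> G" using rots[of 0 z] insert.prems by simp
  then have "diag_phase N (\<lambda>y. c z * chi N z y) \<in> G"
    using rot_herm_pauli_eq[of N 0 z "c z"] by simp
  then have "diag_phase N (\<lambda>y. c z * chi N z y) * diag_phase N (\<lambda>y. \<Sum>z\<in>Z. c z * chi N z y) \<in> G"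
    using mult insert by blast
  then show ?case using insert by (simp add: diag_phase_add)
qed

text \<open>The characters span all real functions on bit strings; \<open>c\<close> is the Fourier
  transform of \<open>g\<close>.\<close>

lemma diag_phase_mem: "diag_phase N g \<in> G"
proof -
  define c where "c z = (\<Sum>x<2 ^ N. g x * chi N z x) / 2 ^ N" for z
  have "g y = (\<Sum>z<2 ^ N. c z * chi N z y)" if y: "y < 2 ^ N" for y
  proof -
    have "(\<Sum>z<2 ^ N. c z * chi N z y) = (\<Sum>z<2 ^ N. \<Sum>x<2 ^ N. g x * (chi N z x * chi N z y)) / 2 ^
        N"
      by (simp add: c_def sum_divide_distrib sum_distrib_right mult.assoc)
    also have "\<dots> = (\<Sum>x<2 ^ N. g x * (\<Sum>z<2 ^ N. chi N z x * chi N z y)) / 2 ^ N"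
      by (subst sum.swap) (simp add: sum_distrib_left)
    also have "\<dots> = (\<Sum>x<2 ^ N. if x = y then g x * 2 ^ N else 0) / 2 ^ N"
      using y by (intro arg_cong[where f = "\<lambda>s. s / 2 ^ N"] sum.cong refl)
          (auto simp: sum_chi_delta)
    also have "\<dots> = g y" using y by simp
    finally show ?thesis by simp
  qed
  then have "diag_phase N g = diag_phase N (\<lambda>y. \<Sum>z\<in>{..<2 ^ N}. c z * chi N z y)"
    by (rule diag_phase_cong)
  then show ?thesis using diag_phase_characters[of "{..<2 ^ N}" c] by simp
qed

text \<open>The indicator of the pair has Fourier coefficients
  \<open>(1 + chi N z m) * chi N z x / 2 ^ N\<close>. They vanish unless the character is invariant
  under \<open>m\<close>, and otherwise the bracket is the 2 in the expansion.\<close>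

lemma flip_rot_mem:
  assumes m: "m < 2 ^ N" "m \<noteq> 0" "chi N f m = 1" and x: "x < 2 ^ N"
  shows "flip_rot N m (\<lambda>y. if y = x \<or> y = xor x m then t else 0) \<in> G"
proof -
  define Z where "Z = {z. z < 2 ^ N \<and> chi N z m = 1}"
  have "(if y = x \<or> y = xor x m then t else 0) = (\<Sum>z\<in>Z. (2 * t / 2 ^ N * chi N z x) * chi N z y)"
    if y: "y < 2 ^ N" for y
  proof -
    have neq: "x \<noteq> xor x m" using m(2) by (metis xor_cancel(2) xor_self_eq)
    have "(\<Sum>z\<in>Z. (2 * t / 2 ^ N * chi N z x) * chi N z y) =
        (\<Sum>z<2 ^ N. t / 2 ^ N * (chi N z x * chi N z y + chi N z (xor x m) * chi N z y))"
    proof (rule sum.mono_neutral_cong_left)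
      show "\<forall>z\<in>{..<2 ^ N} - Z. t / 2 ^ N * (chi N z x * chi N z y + chi N z (xor x m) * chi N z y)
          = 0"
      proof
        fix z assume "z \<in> {..<2 ^ N} - Z"
        then have "chi N z m = - 1" using chi_cases[of N z m] by (auto simp: Z_def)
        then show "t / 2 ^ N * (chi N z x * chi N z y + chi N z (xor x m) * chi N z y) = 0"
          by (simp add: chi_xor_right)
      qed
    qed (auto simp: Z_def chi_xor_right)
    also have "\<dots> = t / 2 ^ N * ((\<Sum>z<2 ^ N. chi N z x * chi N z y) +
        (\<Sum>z<2 ^ N. chi N z (xor x m) * chi N z y))"
      by (simp only: sum_distrib_left[symmetric] sum.distrib)
    also have "\<dots> = (if y = x \<or> y = xor x m then t else 0)"
      unfolding sum_chi_delta[OF x y] sum_chi_delta[OF xor_less_exp[OF x m(1)] y] using neq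
      by (cases "y = x"; cases "y = xor x m") simp_all
    finally show ?thesis by simp
  qed
  then have eq: "flip_rot N m (\<lambda>y. if y = x \<or> y = xor x m then t else 0) =
      flip_rot N m (\<lambda>y. \<Sum>z\<in>Z. (2 * t / 2 ^ N * chi N z x) * chi N z y)"
    by (rule flip_rot_cong)
  have Z: "finite Z" "\<And>z. z \<in> Z \<Longrightarrow> z < 2 ^ N \<and> chi N z m = 1"
    by (auto simp: Z_def)
  show ?thesis unfolding eq by (rule flip_rot_characters[OF m Z])
qed

lemma diag_phase_reduce:
  assumes V: "V \<in> carrier_mat (2 ^ N) (2 ^ N)" and "diag_phase N g * V \<in> G"
  shows "V \<in> G"
proof -
  have "diag_phase N (\<lambda>x. - g x) * (diag_phase N g * V) \<in> G"
    using mult diag_phase_mem assms(2) by blast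
  then show ?thesis
    using V by (simp add: diag_phase_add diag_phase_zero flip:
        assoc_mult_mat[OF diag_phase_carrier diag_phase_carrier V])
qed

lemma flip_rot_reduce:
  fixes t :: real
  assumes m: "m < 2 ^ N" "m \<noteq> 0" "chi N f m = 1" and x: "x < 2 ^ N"
  defines "g \<equiv> \<lambda>y. if y = x \<or> y = xor x m then t else 0"
  assumes V: "V \<in> carrier_mat (2 ^ N) (2 ^ N)" and "flip_rot N m g * V \<in> G"
  shows "V \<in> G"
proof -
  have inv: "g (xor y m) = g y" for y
    using xor_eq_iff[of x y m] by (auto simp: g_def)
  have "flip_rot N m (\<lambda>y. if y = x \<or> y = xor x m then - t else 0) * (flip_rot N m g * V) \<in> G"
    using mult flip_rot_mem[OF m x] assms(7) by blast
  moreover have "(\<lambda>y. if y = x \<or> y = xor x m then - t else 0) = (\<lambda>y. - g y)"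
    by (auto simp: g_def)
  moreover have "flip_rot N m (\<lambda>y. - g y) * flip_rot N m g = 1\<^sub>m (2 ^ N)"
    using flip_rot_add[OF m(1,2), of "\<lambda>y. - g y" g] inv by (simp add: flip_rot_zero)
  ultimately show ?thesis
    using V by (simp flip: assoc_mult_mat[OF flip_rot_carrier flip_rot_carrier V])
qed

text \<open>Givens elimination: columns are turned into unit vectors from left to right.\<close>

definition even_op :: "complex mat \<Rightarrow> bool" where
  "even_op V \<longleftrightarrow> (\<forall>x<2 ^ N. \<forall>y<2 ^ N. chi N f x \<noteq> chi N f y \<longrightarrow> V $$ (x, y) = 0)"

definition fixes_below :: "nat \<Rightarrow> complex mat \<Rightarrow> bool" where
  "fixes_below k V \<longleftrightarrow> (\<forall>y<k. \<forall>x<2 ^ N. V $$ (x, y) = (if x = y then 1 else 0))"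

text \<open>A finished column puts a 1 on the diagonal, which exhausts the norm of that row.\<close>

lemma rows_below:
  assumes V: "isometry (2 ^ N) V" "fixes_below k V" and k: "k \<le> 2 ^ N" and x: "x < k" "y < 2 ^ N"
      "x \<noteq> y"
  shows "V $$ (x, y) = 0"
proof -
  have "V $$ (x, x) = 1" using V(2) x k by (simp add: fixes_below_def)
  then have "(\<Sum>y<2 ^ N. (cmod (V $$ (x, y)))\<^sup>2) = (cmod (V $$ (x, x)))\<^sup>2"
    using isometry_row_norm[OF V(1), of x] x k by simp
  then have "(cmod (V $$ (x, y)))\<^sup>2 = 0"
    by (rule sum_eq_single) (use x k in auto)
  then show ?thesis by simp
qed

text \<open>Left factors whose inverses also lie in \<open>G\<close> do not affect membership, and
  each two-level rotation lowers the number of nonzero entries below the diagonal.\<close>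

lemma eliminate_column:
  assumes next_col: "\<And>V. isometry (2 ^ N) V \<Longrightarrow> even_op V \<Longrightarrow> fixes_below (Suc k) V \<Longrightarrow> V \<in> G"
    and k: "k < 2 ^ N"
  shows "isometry (2 ^ N) V \<Longrightarrow> even_op V \<Longrightarrow> fixes_below k V \<Longrightarrow> V \<in> G"
proof (induction "card {x. k < x \<and> x < 2 ^ N \<and> V $$ (x, k) \<noteq> 0}" arbitrary: V rule: less_induct)
  case less
  note V = less.prems
  have Vc: "V \<in> carrier_mat (2 ^ N) (2 ^ N)" using V(1) by (simp add: isometry_def)
  note dm = diag_phase_mult_index[OF Vc]
  show ?case
  proof (cases "\<exists>l. k < l \<and> l < 2 ^ N \<and> V $$ (l, k) \<noteq> 0")
    case False
    then have col: "V $$ (x, k) = 0" if "x < 2 ^ N" "x \<noteq> k" for x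
      using rows_below[OF V(1,3)] that k by (cases "x < k") auto
    have "1 = (\<Sum>x<2 ^ N. (cmod (V $$ (x, k)))\<^sup>2)" by (simp add: isometry_col_norm[OF V(1) k])
    also have "\<dots> = (\<Sum>x<2 ^ N. if x = k then (cmod (V $$ (k, k)))\<^sup>2 else 0)"
      by (intro sum.cong) (auto simp: col)
    finally have n1: "cmod (V $$ (k, k)) = 1" using k by (simp add: abs_square_eq_1)
    \<comment> \<open>Only the diagonal entry of the column is left; it has modulus 1, and this
      phase turns it into 1.\<close>
    define g where "g x = (if x = k then - Arg (V $$ (k, k)) else 0)" for x
    have "cis (- Arg (V $$ (k, k))) * V $$ (k, k) = 1"
      using rcis_cmod_Arg[of "V $$ (k, k)"] n1 by
          (metis cis_mult cis_zero add.left_inverse cis_rcis_eq)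
    then have "fixes_below (Suc k) (diag_phase N g * V)"
      using V(3) k col by (auto simp: fixes_below_def dm g_def less_Suc_eq)
    moreover have "even_op (diag_phase N g * V)" using V(2) by (simp add: even_op_def dm)
    ultimately have "diag_phase N g * V \<in> G"
      using next_col isometry_mult[OF isometry_diag_phase V(1)] by blast
    then show ?thesis by (rule diag_phase_reduce[OF Vc])
  next
    case True
    then obtain l where l: "k < l" "l < 2 ^ N" "V $$ (l, k) \<noteq> 0" by blast
    define a b where "a = V $$ (k, k)" and "b = V $$ (l, k)"
    define r where "r = sqrt ((cmod a)\<^sup>2 + (cmod b)\<^sup>2)"
    have r: "r > 0" using l by (simp add: r_def b_def sum_power2_gt_zero_iff)
    have "(cmod a / r)\<^sup>2 + (cmod b / r)\<^sup>2 = ((cmod a)\<^sup>2 + (cmod b)\<^sup>2) / r\<^sup>2"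
      by (simp add: power_divide add_divide_distrib)
      also have "(cmod a)\<^sup>2 + (cmod b)\<^sup>2 = r\<^sup>2" by (simp add: r_def)
    also have "r\<^sup>2 / r\<^sup>2 = 1" using r by simp
    finally obtain t where t: "cos t = cmod a / r" "sin t = cmod b / r"
      using sincos_total_2pi_le by (metis (no_types, opaque_lifting))
    \<comment> \<open>The phases turn the entries at \<open>k\<close> and \<open>l\<close> into |a|
      and -i |b|. The extra pi/2 offsets the factor i off the diagonal of \<open>flip_rot\<close>,
      so that the angle \<open>t\<close> cancels the entry at \<open>l\<close>.\<close>
    define h where "h x = (if x = k then - Arg a else if x = l then - Arg b - pi / 2 else 0)" for
        x
    define m where "m = xor k l"
    have kl: "xor k m = l" "xor l m = k" unfolding m_def by (simp_all add: xor.left_commute[of l])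
    \<comment> \<open>The entry at \<open>(l, k)\<close> is nonzero, so \<open>l\<close> and
      \<open>k\<close> have equal parity; the mask flipping one into the other is even and its
      rotations are available.\<close>
    have "chi N f l = chi N f k" using V(2) l k unfolding even_op_def by metis
    then have m: "m < 2 ^ N" "m \<noteq> 0" "chi N f m = 1"
    proof -
      show "m < 2 ^ N" unfolding m_def by (rule xor_less_exp[OF k l(2)])
      show "m \<noteq> 0" using kl(1) l(1) by (metis less_irrefl xor.right_neutral)
    qed (simp add: m_def chi_xor_right)
    define g where "g y = (if y = k \<or> y = xor k m then t else 0)" for y
    have inv: "g (xor y m) = g y" for y
      using xor_eq_iff[of k y m] by (auto simp: g_def)
    let ?W = "diag_phase N h * V"
    let ?U = "flip_rot N m g * ?W"
    have Wc: "?W \<in> carrier_mat (2 ^ N) (2 ^ N)" using Vc by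
        (meson diag_phase_carrier mult_carrier_mat)
    have U: "?U $$ (x, y) = of_real (cos (g x)) * (cis (h x) * V $$ (x, y)) +
        \<i> * of_real (sin (g x)) * (cis (h (xor x m)) * V $$ (xor x m, y))"
      if "x < 2 ^ N" "y < 2 ^ N" for x y
      using that xor_less_exp[OF that(1) m(1)] by
          (simp add: flip_rot_mult_index[where g = g, OF m(1,2) inv Wc] dm)
    have other: "?U $$ (x, y) = V $$ (x, y)" if "x < 2 ^ N" "y < 2 ^ N" "x \<noteq> k" "x \<noteq> l" for x y
      using U[OF that(1,2)] that by (simp add: g_def h_def kl)
    have "?U $$ (l, k) = of_real (cos t) * (cis (- Arg b - pi / 2) * b) + \<i> * of_real (sin t) *
        (cis (- Arg a) * a)"
      using U[OF l(2) k] l by (simp add: g_def h_def kl a_def b_def)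
    also have "cis (- Arg b - pi / 2) * b = - \<i> * of_real (cmod b)"
    proof -
      have "cis (- Arg b - pi / 2) * b = of_real (cmod b) *
          (cis (- Arg b - pi / 2) * cis (Arg b))"
        by (subst rcis_cmod_Arg[of b, symmetric]) (simp add: rcis_def)
      also have "cis (- Arg b - pi / 2) * cis (Arg b) = - \<i>"
        by (simp add: cis_mult complex_eq_iff)
      finally show ?thesis by simp
    qed
    also have "cis (- Arg a) * a = of_real (cmod a)"
    proof -
      have "cis (- Arg a) * a = of_real (cmod a) * (cis (- Arg a) * cis (Arg a))"
        by (subst rcis_cmod_Arg[of a, symmetric]) (simp add: rcis_def)
      then show ?thesis by (simp add: cis_mult)
    qed
    finally have Ul: "?U $$ (l, k) = 0" unfolding t by simp
    have "{x. k < x \<and> x < 2 ^ N \<and> ?U $$ (x, k) \<noteq> 0} \<subset> {x. k < x \<and> x < 2 ^ N \<and> V $$ (x, k) \<noteq> 0}"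
    proof
      have "V $$ (x, k) \<noteq> 0" if x: "k < x" "x < 2 ^ N" "?U $$ (x, k) \<noteq> 0" for x
      proof (cases "x = l")
        case False
        then have "?U $$ (x, k) = V $$ (x, k)" using x by (intro other k) auto
        then show ?thesis using x(3) by metis
      qed (use l in simp)
      then show "{x. k < x \<and> x < 2 ^ N \<and> ?U $$ (x, k) \<noteq> 0} \<subseteq>
          {x. k < x \<and> x < 2 ^ N \<and> V $$ (x, k) \<noteq> 0}"
        by blast
      show "{x. k < x \<and> x < 2 ^ N \<and> ?U $$ (x, k) \<noteq> 0} \<noteq> {x. k < x \<and> x < 2 ^ N \<and> V $$ (x, k) \<noteq> 0}"
        using l Ul by blast
    qed
    moreover have "finite {x. k < x \<and> x < 2 ^ N \<and> V $$ (x, k) \<noteq> 0}"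
      by (rule finite_subset[of _ "{..<2 ^ N}"]) auto
    ultimately have "card {x. k < x \<and> x < 2 ^ N \<and> ?U $$ (x, k) \<noteq> 0} < card
        {x. k < x \<and> x < 2 ^ N \<and> V $$ (x, k) \<noteq> 0}"
      by (rule psubset_card_mono[rotated])
    moreover have "isometry (2 ^ N) ?U"
      using isometry_mult isometry_flip_rot[where g = g, OF m(1,2) inv] isometry_diag_phase V(1)
          by blast
    moreover have "even_op ?U"
      unfolding even_op_def
    proof (intro allI impI)
      fix x y assume xy: "x < 2 ^ N" "y < 2 ^ N" "chi N f x \<noteq> chi N f y"
      moreover have "chi N f (xor x m) = chi N f x" using m by (simp add: chi_xor_right)
      ultimately have "V $$ (x, y) = 0" "V $$ (xor x m, y) = 0"
        using V(2) xor_less_exp[OF xy(1) m(1)] unfolding even_op_def by metis+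
      then show "?U $$ (x, y) = 0" using U xy by simp
    qed
    moreover have "fixes_below k ?U"
      unfolding fixes_below_def
    proof (intro allI impI)
      fix y x :: nat assume y: "y < k" and x: "x < 2 ^ N"
      show "?U $$ (x, y) = (if x = y then 1 else 0)"
      \<comment> \<open>Rows \<open>k\<close> and \<open>l\<close> vanish in the finished columns,
        so mixing them changes nothing there.\<close>
      proof (cases "x = k \<or> x = l")
        case True
        then have "V $$ (x, y) = 0" "V $$ (xor x m, y) = 0" "x \<noteq> y"
          using V(3) y l k kl unfolding fixes_below_def by auto
        then show ?thesis using U x y k by simp
      next
        case False
        then show ?thesis using other x y k V(3) by (simp add: fixes_below_def)
      qed
    qed
    ultimately have "?U \<in> G" by (rule less.hyps)
    then have "?W \<in> G" unfolding g_def by (rule flip_rot_reduce[OF m k Wc])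
    then show ?thesis by (rule diag_phase_reduce[OF Vc])
  qed
qed

theorem even_isometry_mem:
  assumes "isometry (2 ^ N) V" "even_op V"
  shows "V \<in> G"
proof -
  have "isometry (2 ^ N) V \<Longrightarrow> even_op V \<Longrightarrow> fixes_below k V \<Longrightarrow> V \<in> G" if "k \<le> 2 ^ N" for k V
    using that
  proof (induction k arbitrary: V rule: inc_induct)
    case base
    then have "V = 1\<^sub>m (2 ^ N)"
      by (intro eq_matI) (auto simp: isometry_def fixes_below_def)
    then show ?case using one by simp
  next
    case (step k)
    show ?case by (rule eliminate_column[OF step.IH step.hyps(2) step.prems])
  qed
  from this[of 0] show ?thesis using assms by (simp add: fixes_below_def)
qed

end

subsection \<open>Fermion operators as Pauli strings\<close>

lemma jw_sign_prod: "jw_sign Nq j y = (\<Prod>l<j. if bit y (Nq + l) then - 1 else 1)"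
proof (induction j)
  case (Suc j)
  have "{l. l < Suc j \<and> bit y (Nq + l)} =
      (if bit y (Nq + j) then insert j {l. l < j \<and> bit y (Nq + l)} else
          {l. l < j \<and> bit y (Nq + l)})"
    by (auto simp: less_Suc_eq)
  then have "jw_sign Nq (Suc j) y = (if bit y (Nq + j) then - 1 else 1) * jw_sign Nq j y"
    by (simp add: jw_sign_def)
  then show ?case using Suc by simp
qed (simp add: jw_sign_def)

lemma jw_sign_eq_chi:
  "Nq + j \<le> N \<Longrightarrow> jw_sign Nq j y = of_real (chi N (site_mask Nq (Nq + j)) y)"
proof (induction j)
  case 0
  have "site_mask Nq (Nq + 0) = 0" by (rule bit_eqI) (simp add: bit_site_mask)
  then show ?case by (simp add: jw_sign_def)
next
  case (Suc j)
  have "site_mask Nq (Nq + Suc j) = xor (site_mask Nq (Nq + j)) (2 ^ (Nq + j))"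
    by (rule bit_eqI) (auto simp: bit_site_mask bit_xor_iff)
  then show ?case using Suc by (simp add: jw_sign_prod chi_xor_left chi_exp_left)
qed

lemma xor_exp_nat: "xor y (2 ^ k) = (if bit y k then unset_bit k y else set_bit k y)" for y :: nat
  by (rule bit_eqI) (auto simp: bit_xor_iff bit_unset_bit_iff bit_set_bit_iff)

lemma majorana_index:
  assumes j: "j < Nf" and xy: "x < fock_dim Nq Nf" "y < fock_dim Nq Nf"
  shows "creat Nq Nf j $$ (x, y) =
      (if x = xor y (2 ^ (Nq + j)) \<and> \<not> bit y (Nq + j) then of_real
          (chi (Nq + Nf) (site_mask Nq (Nq + j)) y) else 0)"
    and "annih Nq Nf j $$ (x, y) =
      (if x = xor y (2 ^ (Nq + j)) \<and> bit y (Nq + j) then of_real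
          (chi (Nq + Nf) (site_mask Nq (Nq + j)) y) else 0)"
proof -
  have s: "jw_sign Nq j w = of_real (chi (Nq + Nf) (site_mask Nq (Nq + j)) w)" for w
    using j by (intro jw_sign_eq_chi) simp
  have "jw_sign Nq j (set_bit (Nq + j) y) = jw_sign Nq j y"
    by (rule jw_sign_cong) (simp add: bit_set_bit_iff)
  then show "creat Nq Nf j $$ (x, y) =
      (if x = xor y (2 ^ (Nq + j)) \<and> \<not> bit y (Nq + j) then of_real
          (chi (Nq + Nf) (site_mask Nq (Nq + j)) y) else 0)"
    unfolding creat_index[OF xy] unset_bit_eq_iff xor_exp_nat s[symmetric] by auto
  show "annih Nq Nf j $$ (x, y) =
      (if x = xor y (2 ^ (Nq + j)) \<and> bit y (Nq + j) then of_real
          (chi (Nq + Nf) (site_mask Nq (Nq + j)) y) else 0)"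
    unfolding annih_index[OF xy] xor_exp_nat s[symmetric] by auto
qed

lemma creat_plus_annih:
  assumes j: "j < Nf"
  shows "creat Nq Nf j + annih Nq Nf j = pauli (Nq + Nf) (2 ^ (Nq + j)) (site_mask Nq (Nq + j))"
proof (rule eq_matI)
  fix x y assume "x < dim_row (pauli (Nq + Nf) (2 ^ (Nq + j)) (site_mask Nq (Nq + j)))"
    "y < dim_col (pauli (Nq + Nf) (2 ^ (Nq + j)) (site_mask Nq (Nq + j)))"
  then have xy: "x < fock_dim Nq Nf" "y < fock_dim Nq Nf" by simp_all
  then have "(creat Nq Nf j + annih Nq Nf j) $$ (x, y) =
      creat Nq Nf j $$ (x, y) + annih Nq Nf j $$ (x, y)"
    by (simp add: annih_def)
  also have "\<dots> = pauli (Nq + Nf) (2 ^ (Nq + j)) (site_mask Nq (Nq + j)) $$ (x, y)"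
    unfolding majorana_index[OF j xy] pauli_index[OF xy] by simp
  finally show "(creat Nq Nf j + annih Nq Nf j) $$ (x, y) = \<dots>" .
qed (simp_all add: annih_def)

text \<open>Compared with the sum, the part acting on occupied states changes sign, which is a
  \<open>Z\<close> on the site itself.\<close>

lemma creat_minus_annih:
  assumes j: "j < Nf"
  shows "creat Nq Nf j - annih Nq Nf j =
    pauli (Nq + Nf) (2 ^ (Nq + j)) (xor (site_mask Nq (Nq + j)) (2 ^ (Nq + j)))"
proof (rule eq_matI)
  fix x y assume "x < dim_row (pauli (Nq + Nf) (2 ^ (Nq + j))
      (xor (site_mask Nq (Nq + j)) (2 ^ (Nq + j))))"
    "y < dim_col (pauli (Nq + Nf) (2 ^ (Nq + j)) (xor (site_mask Nq (Nq + j)) (2 ^ (Nq + j))))"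
  then have xy: "x < fock_dim Nq Nf" "y < fock_dim Nq Nf" by simp_all
  then have "(creat Nq Nf j - annih Nq Nf j) $$ (x, y) =
      creat Nq Nf j $$ (x, y) - annih Nq Nf j $$ (x, y)"
    by (simp add: annih_def)
  also have "\<dots> = pauli (Nq + Nf) (2 ^ (Nq + j)) (xor (site_mask Nq (Nq + j)) (2 ^ (Nq + j))) $$
      (x, y)"
    unfolding majorana_index[OF j xy] pauli_index[OF xy] using j by
        (simp add: chi_xor_left chi_exp_left)
  finally show "(creat Nq Nf j - annih Nq Nf j) $$ (x, y) = \<dots>" .
qed (simp_all add: annih_def)

lemma site_number_index:
  "x < fock_dim Nq Nf \<Longrightarrow> y < fock_dim Nq Nf \<Longrightarrow>
    site_number Nq Nf j $$ (x, y) = (if x = y then of_bool (bit x (Nq + j)) else 0)"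
  unfolding site_number_def creat_annih_index
  using unset_bit_eq_iff[of x "Nq + j" "unset_bit (Nq + j) x"]
      unset_bit_eq_iff[of y "Nq + j" "unset_bit (Nq + j) x"]
  by (auto simp: jw_sign_sq)

lemma site_number_carrier [simp]: "site_number Nq Nf j \<in> fock_ops Nq Nf"
  unfolding site_number_def by (rule mult_carrier_mat[OF creat_carrier annih_carrier])

lemma mat_of_rows_list_2_index:
  "mat_of_rows_list 2 [[a, b], [c, d]] $$ (of_bool p, of_bool r) =
      (if p then if r then d else c else if r then b else a)"
  by (cases p; cases r) (simp_all add: mat_of_rows_list_def)

lemma mat_of_rows_list_2_carrier: "mat_of_rows_list 2 [[a, b], [c, d]] \<in> carrier_mat 2 2"
  by (rule carrier_matI) (simp_all add: mat_of_rows_list_def)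

lemma bits_eq_off_iff:
  "(\<forall>k. k \<noteq> i \<longrightarrow> bit x k = bit y k) \<longleftrightarrow> x = y \<or> x = xor y (2 ^ i)" for x y :: nat
proof
  assume a: "\<forall>k. k \<noteq> i \<longrightarrow> bit x k = bit y k"
  show "x = y \<or> x = xor y (2 ^ i)"
  proof (cases "bit x i = bit y i")
    case True
    then have "x = y" using a by (intro bit_eqI) metis
    then show ?thesis ..
  next
    case False
    then have "x = xor y (2 ^ i)" using a by (intro bit_eqI) (auto simp: bit_xor_iff)
    then show ?thesis ..
  qed
qed (auto simp: bit_xor_iff)

lemma qubit_op_index:
  assumes xy: "x < fock_dim Nq Nf" "y < fock_dim Nq Nf"
  shows "qubit_op Nq Nf i (mat_of_rows_list 2 [[a, b], [c, d]]) $$ (x, y) =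
    (if x = y then if bit y i then d else a else if x = xor y (2 ^ i) then if bit y i then b else
        c else 0)"
  using xy by (auto simp: qubit_op_def mat_of_rows_list_2_index bits_eq_off_iff bit_xor_iff)

lemma qubit_op_carrier [simp]: "qubit_op Nq Nf i M \<in> fock_ops Nq Nf"
  by (simp add: qubit_op_def)

lemma qubit_op_dim [simp]: "dim_row (qubit_op Nq Nf i M) = fock_dim Nq Nf"
    "dim_col (qubit_op Nq Nf i M) = fock_dim Nq Nf"
  by (simp_all add: qubit_op_def)

subsection \<open>The system operators generate the full matrix algebra\<close>

text \<open>The mask \<open>m\<close> selects the entries with row \<open>xor y m\<close>; along
  them the coefficients form a Fourier expansion in the sign mask.\<close>

lemma pauli_expansion:
  assumes U: "U \<in> carrier_mat (2 ^ N) (2 ^ N)" and xy: "x < 2 ^ N" "y < 2 ^ N"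
  shows "U $$ (x, y) = (\<Sum>m<2 ^ N. \<Sum>z<2 ^ N.
    (\<Sum>w<2 ^ N. U $$ (xor w m, w) * of_real (chi N z w)) / 2 ^ N * pauli N m z $$ (x, y))"
proof -
  define c where "c m z = (\<Sum>w<2 ^ N. U $$ (xor w m, w) * of_real (chi N z w)) / 2 ^ N" for m z
  define m0 where "m0 = xor x y"
  have m0: "m0 < 2 ^ N" "x = xor y m \<longleftrightarrow> m = m0" for m
  proof -
    show "m0 < 2 ^ N" using xy by (simp add: m0_def xor_less_exp)
    show "x = xor y m \<longleftrightarrow> m = m0" unfolding m0_def by (metis xor.commute xor_cancel(1))
  qed
  have "(\<Sum>m<2 ^ N. \<Sum>z<2 ^ N. c m z * pauli N m z $$ (x, y)) =
      (\<Sum>m<2 ^ N. if m = m0 then \<Sum>z<2 ^ N. c m0 z * of_real (chi N z y) else 0)"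
    by (intro sum.cong refl) (auto simp: pauli_index xy m0)
  also have "\<dots> = (\<Sum>z<2 ^ N. c m0 z * of_real (chi N z y))" using m0 by simp
  also have "\<dots> = (\<Sum>z<2 ^ N. \<Sum>w<2 ^ N. U $$ (xor w m0, w) * of_real (chi N z w * chi N z y)) / 2 ^
      N"
    by (simp add: c_def sum_divide_distrib sum_distrib_right mult.assoc)
  also have "\<dots> = (\<Sum>w<2 ^ N. U $$ (xor w m0, w) * of_real (\<Sum>z<2 ^ N. chi N z w * chi N z y)) / 2 ^
      N"
    by (subst sum.swap) (simp add: sum_distrib_left)
  also have "\<dots> = (\<Sum>w<2 ^ N. if w = y then U $$ (xor y m0, y) * 2 ^ N else 0) / 2 ^ N"
    using xy by (intro arg_cong[where f = "\<lambda>s. s / 2 ^ N"] sum.cong refl)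
        (auto simp: sum_chi_delta)
  also have "\<dots> = U $$ (x, y)"
    using xy m0(2)[of m0] by simp
  finally show ?thesis by (simp add: c_def)
qed

context
  fixes Lq Lf Aq Af :: nat
begin

definition sys_op :: "complex mat \<Rightarrow> bool" where
  "sys_op U \<longleftrightarrow> (\<exists>U'. joint_action Lq Lf Aq Af U U')"

lemma sys_op_add: "sys_op U \<Longrightarrow> sys_op V \<Longrightarrow> sys_op (U + V)"
  and sys_op_mult: "sys_op U \<Longrightarrow> sys_op V \<Longrightarrow> sys_op (U * V)"
  and sys_op_smult: "sys_op U \<Longrightarrow> sys_op (c \<cdot>\<^sub>m U)"
  and sys_op_one: "sys_op (1\<^sub>m (fock_dim Lq Lf))"
  unfolding sys_op_def by (blast intro: joint_action.intros)+

lemma sys_op_pauli_mult: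
  assumes m: "m < 2 ^ (Lq + Lf)" "m' < 2 ^ (Lq + Lf)"
    and P: "sys_op (pauli (Lq + Lf) m z)" "sys_op (pauli (Lq + Lf) m' z')"
  shows "sys_op (pauli (Lq + Lf) (xor m m') (xor z z'))"
proof -
  let ?c = "complex_of_real (chi (Lq + Lf) z m')"
  have "?c * ?c = 1" by (simp flip: of_real_mult)
  then have "?c \<cdot>\<^sub>m (pauli (Lq + Lf) m z * pauli (Lq + Lf) m' z') =
      pauli (Lq + Lf) (xor m m') (xor z z')"
    unfolding pauli_mult[OF m] smult_smult_mat by simp
  then show ?thesis using sys_op_smult[OF sys_op_mult[OF P], of ?c] by simp
qed

lemma sys_op_Z: "k < Lq + Lf \<Longrightarrow> sys_op (pauli (Lq + Lf) 0 (2 ^ k))"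
proof (cases "k < Lq")
  case True
  have "qubit_op Lq Lf k (mat_of_rows_list 2 [[1, 0], [0, - 1]]) = pauli (Lq + Lf) 0 (2 ^ k)"
    using True by (intro eq_matI) (auto simp: qubit_op_index pauli_index chi_exp_left)
  moreover have "sys_op (qubit_op Lq Lf k (mat_of_rows_list 2 [[1, 0], [0, - 1]]))"
    unfolding sys_op_def using True by (blast intro: joint_action.qubit
        mat_of_rows_list_2_carrier)
  ultimately show ?thesis by simp
next
  case False
  assume k: "k < Lq + Lf"
  define j where "j = k - Lq"
  have j: "j < Lf" "Lq + j = k" using False k by (simp_all add: j_def)
  have "1\<^sub>m (fock_dim Lq Lf) + (- 2) \<cdot>\<^sub>m site_number Lq Lf j = pauli (Lq + Lf) 0 (2 ^ k)"
    using k j carrier_matD[OF site_number_carrier]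
    by (intro eq_matI) (auto simp: site_number_index pauli_index chi_exp_left)
  moreover have "sys_op (site_number Lq Lf j)"
    unfolding site_number_def
    by (rule sys_op_mult) (use j in \<open>auto simp: sys_op_def intro: joint_action.intros\<close>)
  ultimately show ?thesis using sys_op_add sys_op_one sys_op_smult by metis
qed

text \<open>On a site the flip comes with Jordan-Wigner signs. The sign mask may stay unspecified
  because all pure sign strings are available to correct it.\<close>

lemma sys_op_X:
  assumes k: "k < Lq + Lf"
  obtains z where "sys_op (pauli (Lq + Lf) (2 ^ k) z)"
proof (cases "k < Lq")
  case True
  have "qubit_op Lq Lf k (mat_of_rows_list 2 [[0, 1], [1, 0]]) = pauli (Lq + Lf) (2 ^ k) 0"
    using True by (intro eq_matI) (auto simp: qubit_op_index pauli_index)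
  moreover have "sys_op (qubit_op Lq Lf k (mat_of_rows_list 2 [[0, 1], [1, 0]]))"
    unfolding sys_op_def using True by (blast intro: joint_action.qubit
        mat_of_rows_list_2_carrier)
  ultimately show ?thesis using that by simp
next
  case False
  define j where "j = k - Lq"
  have j: "j < Lf" "Lq + j = k" using False k by (simp_all add: j_def)
  have "sys_op (creat Lq Lf j + annih Lq Lf j)"
    by (rule sys_op_add) (use j in \<open>auto simp: sys_op_def intro: joint_action.intros\<close>)
  then show ?thesis using that unfolding creat_plus_annih[OF j(1)] j(2) by blast
qed

lemma sys_op_pauli:
  assumes "m < 2 ^ (Lq + Lf)" "z < 2 ^ (Lq + Lf)"
  shows "sys_op (pauli (Lq + Lf) m z)"
proof -
  let ?N = "Lq + Lf"
  have Z: "sys_op (pauli ?N 0 z)" if "\<forall>k. bit z k \<longrightarrow> k \<in> {..<?N}" for z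
    using that
  proof (induction z rule: bit_string_induct)
    case zero
    then show ?case using sys_op_one by (simp add: pauli_zero)
  next
    case (flip z k)
    then show ?case using sys_op_pauli_mult[of 0 0 z "2 ^ k"] sys_op_Z[of k] by simp
  qed
  have "\<forall>z. (\<forall>k. bit z k \<longrightarrow> k \<in> {..<?N}) \<longrightarrow> sys_op (pauli ?N m z)"
    if "\<forall>k. bit m k \<longrightarrow> k \<in> {..<?N}" for m
  proof -
    have "(\<forall>k. bit m k \<longrightarrow> k \<in> {..<?N}) \<and>
        (\<forall>z. (\<forall>k. bit z k \<longrightarrow> k \<in> {..<?N}) \<longrightarrow> sys_op (pauli ?N m z))"
      using that
    proof (induction m rule: bit_string_induct)
      case zero
      then show ?case using Z by simp
    next
      case (flip m k)
      have k: "k < ?N" using flip by simp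
      obtain z0 where "sys_op (pauli ?N (2 ^ k) z0)" using sys_op_X[OF k] .
      \<comment> \<open>Bits of \<open>z0\<close> outside the space do not affect the matrix;
        cutting them off makes the induction hypothesis applicable to the combined sign
        mask.\<close>
      have z0: "pauli ?N (2 ^ k) z0 = pauli ?N (2 ^ k) (take_bit ?N z0)"
        by (rule eq_matI) (auto simp: pauli_index chi_def bit_take_bit_iff intro!: prod.cong)
      have "sys_op (pauli ?N (xor m (2 ^ k)) z)" if z: "\<forall>k. bit z k \<longrightarrow> k \<in> {..<?N}" for z
      proof -
        let ?z0 = "take_bit ?N z0"
        have "\<forall>k. bit (xor z ?z0) k \<longrightarrow> k \<in> {..<?N}" using z by
            (auto simp: bit_xor_iff bit_take_bit_iff)
        then have "sys_op (pauli ?N m (xor z ?z0))" using flip by blast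
        moreover have "m < 2 ^ ?N" by (rule nat_bit_less) (use flip in auto)
        moreover have "(2 ^ k :: nat) < 2 ^ ?N" using k by simp
        ultimately have "sys_op (pauli ?N (xor m (2 ^ k)) (xor (xor z ?z0) ?z0))"
          using sys_op_pauli_mult \<open>sys_op (pauli ?N (2 ^ k) z0)\<close> unfolding z0 by blast
        then show ?thesis by simp
      qed
      then show ?case using flip by (auto simp: bit_xor_iff)
    qed
    then show ?thesis by blast
  qed
  then show ?thesis using assms nat_bit_bound by blast
qed

lemma sys_op_sum:
  assumes "finite I" "\<And>i. i \<in> I \<Longrightarrow> sys_op (F i)" "\<And>i. i \<in> I \<Longrightarrow> F i \<in> fock_ops Lq Lf"
  shows "sys_op (mat (fock_dim Lq Lf) (fock_dim Lq Lf) (\<lambda>xy. \<Sum>i\<in>I. F i $$ xy))"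
  using assms
proof (induction I rule: finite_induct)
  case empty
  have "mat (fock_dim Lq Lf) (fock_dim Lq Lf) (\<lambda>xy. \<Sum>i\<in>{}. F i $$ xy) =
      0 \<cdot>\<^sub>m 1\<^sub>m (fock_dim Lq Lf)"
    by (rule eq_matI) auto
  then show ?case using sys_op_smult[OF sys_op_one] by metis
next
  case (insert i I)
  have "F i \<in> fock_ops Lq Lf" using insert by simp
  then have "mat (fock_dim Lq Lf) (fock_dim Lq Lf) (\<lambda>xy. \<Sum>i\<in>insert i I. F i $$ xy) =
      F i + mat (fock_dim Lq Lf) (fock_dim Lq Lf) (\<lambda>xy. \<Sum>i\<in>I. F i $$ xy)"
    using insert by (intro eq_matI) auto
  then show ?case using sys_op_add insert by simp
qed

text \<open>All strings, hence all matrices, are expressions in the system operators, so some joint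
  counterpart exists; by uniqueness it is the explicit extension.\<close>

theorem joint_action_joint_ext:
  assumes U: "U \<in> fock_ops Lq Lf"
  shows "joint_action Lq Lf Aq Af U (joint_ext Lq Lf Aq Af U)"
proof -
  let ?N = "Lq + Lf"
  define c where "c m z = (\<Sum>w<2 ^ ?N. U $$ (xor w m, w) * of_real (chi ?N z w)) / 2 ^ ?N" for m z
  define F where "F p = c (fst p) (snd p) \<cdot>\<^sub>m pauli ?N (fst p) (snd p)" for p
  define I where "I = {..<(2 ^ ?N :: nat)} \<times> {..<(2 ^ ?N :: nat)}"
  have "U = mat (fock_dim Lq Lf) (fock_dim Lq Lf) (\<lambda>xy. \<Sum>p\<in>I. F p $$ xy)"
  proof (rule eq_matI)
    fix x y assume "x < dim_row (mat (fock_dim Lq Lf) (fock_dim Lq Lf) (\<lambda>xy. \<Sum>p\<in>I. F p $$ xy))"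
      "y < dim_col (mat (fock_dim Lq Lf) (fock_dim Lq Lf) (\<lambda>xy. \<Sum>p\<in>I. F p $$ xy))"
    then have xy: "x < 2 ^ ?N" "y < 2 ^ ?N" by simp_all
    have "U $$ (x, y) = (\<Sum>m<2 ^ ?N. \<Sum>z<2 ^ ?N. F (m, z) $$ (x, y))"
      unfolding pauli_expansion[OF U xy] F_def c_def[symmetric] using xy by simp
    also have "\<dots> = (\<Sum>p\<in>I. F p $$ (x, y))"
      unfolding I_def by (simp add: sum.cartesian_product case_prod_unfold)
    finally show "U $$ (x, y) = mat (fock_dim Lq Lf) (fock_dim Lq Lf) (\<lambda>xy. \<Sum>p\<in>I. F p $$ xy) $$
        (x, y)"
      using xy by simp
  qed (use U in auto)
  moreover have "sys_op (mat (fock_dim Lq Lf) (fock_dim Lq Lf) (\<lambda>xy. \<Sum>p\<in>I. F p $$ xy))"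
    by (rule sys_op_sum) (auto simp: I_def F_def intro!: sys_op_smult sys_op_pauli)
  ultimately have "sys_op U" by simp
  then show ?thesis using joint_action_ext unfolding sys_op_def by blast
qed

end

subsection \<open>Exponentials and gates\<close>

lemma exp_sums: "(\<lambda>k. z ^ k / fact k) sums exp (z :: complex)"
  using exp_converges[of z] by (simp add: scaleR_conv_of_real divide_inverse mult.commute)

definition diag_op :: "nat \<Rightarrow> (nat \<Rightarrow> complex) \<Rightarrow> complex mat" where
  "diag_op n d = mat n n (\<lambda>(x, y). if x = y then d x else 0)"

lemma diag_op_carrier [simp]: "diag_op n d \<in> carrier_mat n n"
  by (simp add: diag_op_def)

lemma diag_op_mult_index:
  assumes B: "B \<in> carrier_mat n n" and xy: "x < n" "y < n"
  shows "(diag_op n d * B) $$ (x, y) = d x * B $$ (x, y)"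
      "(B * diag_op n d) $$ (x, y) = B $$ (x, y) * d y"
proof -
  have "(diag_op n d * B) $$ (x, y) = (\<Sum>w<n. if w = x then d x * B $$ (x, y) else 0)"
    unfolding mult_index[OF diag_op_carrier B xy]
    by (intro sum.cong) (use xy in \<open>auto simp: diag_op_def\<close>)
  then show "(diag_op n d * B) $$ (x, y) = d x * B $$ (x, y)" using xy by simp
  have "(B * diag_op n d) $$ (x, y) = (\<Sum>w<n. if w = y then B $$ (x, y) * d y else 0)"
    unfolding mult_index[OF B diag_op_carrier xy]
    by (intro sum.cong) (use xy in \<open>auto simp: diag_op_def\<close>)
  then show "(B * diag_op n d) $$ (x, y) = B $$ (x, y) * d y" using xy by simp
qed

lemma diag_op_mult: "diag_op n d * diag_op n e = diag_op n (\<lambda>x. d x * e x)"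
proof (rule eq_matI)
  fix x y assume "x < dim_row (diag_op n (\<lambda>x. d x * e x))"
      "y < dim_col (diag_op n (\<lambda>x. d x * e x))"
  then have xy: "x < n" "y < n" by (simp_all add: diag_op_def)
  show "(diag_op n d * diag_op n e) $$ (x, y) = diag_op n (\<lambda>x. d x * e x) $$ (x, y)"
    unfolding diag_op_mult_index(1)[OF diag_op_carrier xy] using xy by (simp add: diag_op_def)
qed (simp_all add: diag_op_def)

lemma smult_diag_op: "c \<cdot>\<^sub>m diag_op n d = diag_op n (\<lambda>x. c * d x)"
  by (rule eq_matI) (auto simp: diag_op_def)

lemma mat_exp_diag_op: "mat_exp (diag_op n d) = diag_op n (\<lambda>x. exp (d x))"
proof -
  have pow: "diag_op n d ^\<^sub>m k = diag_op n (\<lambda>x. d x ^ k)" for k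
  proof (induction k)
    case 0
    show ?case by (rule eq_matI) (auto simp: diag_op_def)
  next
    case (Suc k)
    then show ?case by (simp add: diag_op_mult mult.commute)
  qed
  have "(\<Sum>k. (diag_op n d ^\<^sub>m k) $$ (x, y) / fact k) = diag_op n (\<lambda>x. exp (d x)) $$ (x, y)"
    if "x < n" "y < n" for x y
    using that exp_sums[of "d y", THEN sums_unique] unfolding pow by (auto simp: diag_op_def)
  then show ?thesis
    unfolding mat_exp_def by (intro eq_matI) (auto simp: diag_op_def)
qed

text \<open>The powers split along the spectral projections \<open>(1 + A) / 2\<close> and
  \<open>(1 - A) / 2\<close>, on which \<open>A\<close> is 1 and -1.\<close>

lemma mat_exp_involution:
  assumes A: "A \<in> carrier_mat n n" and AA: "A * A = 1\<^sub>m n"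
  shows "mat_exp ((\<i> * of_real t) \<cdot>\<^sub>m A) = rot A t"
proof -
  define c where "c = \<i> * complex_of_real t"
  have pow: "(c \<cdot>\<^sub>m A) ^\<^sub>m k = (c ^ k / 2) \<cdot>\<^sub>m (1\<^sub>m n + A) + ((- c) ^ k / 2) \<cdot>\<^sub>m (1\<^sub>m n - A)" for
      k
  proof (induction k)
    case 0
    show ?case using A by (intro eq_matI) (auto simp: algebra_simps)
  next
    case (Suc k)
    have dims: "1\<^sub>m n + A \<in> carrier_mat n n" "1\<^sub>m n - A \<in> carrier_mat n n"
        "c \<cdot>\<^sub>m A \<in> carrier_mat n n"
      using A by auto
    have 1: "(1\<^sub>m n + A) * (c \<cdot>\<^sub>m A) = c \<cdot>\<^sub>m (1\<^sub>m n + A)"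
      unfolding mult_smult_distrib[OF dims(1) A] add_mult_distrib_mat[OF one_carrier_mat A A] AA
      using A by (simp add: comm_add_mat[of A n n])
    have 2: "(1\<^sub>m n - A) * (c \<cdot>\<^sub>m A) = (- c) \<cdot>\<^sub>m (1\<^sub>m n - A)"
      unfolding mult_smult_distrib[OF dims(2) A] minus_mult_distrib_mat[OF one_carrier_mat A A] AA
      using A by (intro eq_matI) (auto simp: algebra_simps)
    have "(c \<cdot>\<^sub>m A) ^\<^sub>m Suc k =
        ((c ^ k / 2) \<cdot>\<^sub>m (1\<^sub>m n + A)) * (c \<cdot>\<^sub>m A) + (((- c) ^ k / 2) \<cdot>\<^sub>m (1\<^sub>m n - A)) * (c \<cdot>\<^sub>m A)"
      unfolding pow_mat.simps Suc using dims by (intro add_mult_distrib_mat[of _ n n]) auto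
    also have "\<dots> = (c ^ k / 2) \<cdot>\<^sub>m ((1\<^sub>m n + A) * (c \<cdot>\<^sub>m A)) + ((- c) ^ k / 2) \<cdot>\<^sub>m
        ((1\<^sub>m n - A) * (c \<cdot>\<^sub>m A))"
      unfolding mult_smult_assoc_mat[OF dims(1,3)] mult_smult_assoc_mat[OF dims(2,3)] ..
    also have "\<dots> = (c ^ Suc k / 2) \<cdot>\<^sub>m (1\<^sub>m n + A) + ((- c) ^ Suc k / 2) \<cdot>\<^sub>m (1\<^sub>m n - A)"
      unfolding 1 2 smult_smult_mat by (simp add: mult.commute)
    finally show ?case .
  qed
  have "(\<Sum>k. ((c \<cdot>\<^sub>m A) ^\<^sub>m k) $$ (x, y) / fact k) = rot A t $$ (x, y)" if xy: "x < n" "y < n" for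
      x y
  proof -
    define p q where "p = ((if x = y then 1 else 0) + A $$ (x, y)) / 2"
      and "q = ((if x = y then 1 else 0) - A $$ (x, y)) / 2"
    have "((c \<cdot>\<^sub>m A) ^\<^sub>m k) $$ (x, y) / fact k = p * (c ^ k / fact k) + q * ((- c) ^ k / fact k)"
        for k
      unfolding pow using A xy by (auto simp: p_def q_def field_simps)
    moreover have "(\<lambda>k. p * (c ^ k / fact k) + q * ((- c) ^ k / fact k)) sums
        (p * exp c + q * exp (- c))"
      by (intro sums_add sums_mult exp_sums)
    ultimately have "(\<lambda>k. ((c \<cdot>\<^sub>m A) ^\<^sub>m k) $$ (x, y) / fact k) sums (p * exp c + q * exp (- c))"
      by (simp only:)
    then have "(\<Sum>k. ((c \<cdot>\<^sub>m A) ^\<^sub>m k) $$ (x, y) / fact k) = p * exp c + q * exp (- c)"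
      by (rule sums_unique[symmetric])
    also have "exp c = of_real (cos t) + \<i> * of_real (sin t)"
      unfolding c_def by (simp add: exp_Euler cos_of_real sin_of_real)
    also have "exp (- c) = of_real (cos t) - \<i> * of_real (sin t)"
      using exp_Euler[of "- complex_of_real t"] unfolding c_def by
          (simp add: cos_of_real sin_of_real)
    also have "p * (of_real (cos t) + \<i> * of_real (sin t)) + q *
        (of_real (cos t) - \<i> * of_real (sin t)) =
        rot A t $$ (x, y)"
      unfolding rot_index[OF A xy] by (cases "x = y") (simp_all add: p_def q_def field_simps)
    finally show ?thesis .
  qed
  then show ?thesis
    unfolding mat_exp_def c_def[symmetric] using A by (intro eq_matI) (auto simp: rot_def)
qed

lemma herm_pauli_dim [simp]: "dim_row (herm_pauli N m z) = 2 ^ N"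
    "dim_col (herm_pauli N m z) = 2 ^ N"
  by (simp_all add: herm_pauli_def)

lemma rot_dim [simp]: "dim_row (rot P t) = dim_row P" "dim_col (rot P t) = dim_col P"
  by (simp_all add: rot_def)

lemma herm_pauli_Z_index:
  "k < N \<Longrightarrow> x < 2 ^ N \<Longrightarrow> y < 2 ^ N \<Longrightarrow>
    herm_pauli N 0 (2 ^ k) $$ (x, y) = (if x = y then if bit x k then - 1 else 1 else 0)"
  by (simp add: herm_pauli_def pauli_phase_def pauli_index chi_exp_left)

lemma herm_pauli_X_index:
  "k < N \<Longrightarrow> x < 2 ^ N \<Longrightarrow> y < 2 ^ N \<Longrightarrow>
    herm_pauli N (2 ^ k) 0 $$ (x, y) = (if x = xor y (2 ^ k) then 1 else 0)"
  by (simp add: herm_pauli_def pauli_phase_def pauli_index)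

text \<open>Up to a global phase, a phase \<open>t\<close> on the set bit is a rotation about
  \<open>Z\<close> by half that angle. This turns the pi/4 of \<open>T\<close> and
  \<open>T^f\<close> into pi/8, and \<open>S\<close> into pi/4.\<close>

lemma diag_phase_gate:
  assumes k: "k < N"
  shows "diag_op (2 ^ N) (\<lambda>x. if bit x k then cis t else 1) =
      cis (t / 2) \<cdot>\<^sub>m rot (herm_pauli N 0 (2 ^ k)) (- (t / 2))"
proof -
  have "cis (t / 2) * (of_real (cos (t / 2)) - \<i> * of_real (sin (t / 2))) = 1"
    "cis (t / 2) * (of_real (cos (t / 2)) + \<i> * of_real (sin (t / 2))) = cis t"
  proof -
    have "of_real (cos u) - \<i> * of_real (sin u) = cis (- u)"
        "of_real (cos u) + \<i> * of_real (sin u) = cis u" for u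
      by (simp_all add: complex_eq_iff)
    then show "cis (t / 2) * (of_real (cos (t / 2)) - \<i> * of_real (sin (t / 2))) = 1"
      "cis (t / 2) * (of_real (cos (t / 2)) + \<i> * of_real (sin (t / 2))) = cis t"
      by (simp_all add: cis_mult)
  qed
  then show ?thesis
    using k by (intro eq_matI)
      (auto simp: diag_op_def herm_pauli_Z_index rot_index[OF herm_pauli_carrier])
qed

lemma T_gate_eq: "i < Nq \<Longrightarrow> T_gate Nq Nf i = cis (pi / 8) \<cdot>\<^sub>m rot (herm_pauli (Nq + Nf) 0 (2 ^ i))
    (- (pi / 8))"
proof -
  assume i: "i < Nq"
  have "T_gate Nq Nf i = diag_op (2 ^ (Nq + Nf)) (\<lambda>x. if bit x i then cis (pi / 4) else 1)"
    unfolding T_gate_def using i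
    by (intro eq_matI) (auto simp: qubit_op_index diag_op_def cis_conv_exp)
  then show ?thesis using diag_phase_gate[of i "Nq + Nf" "pi / 4"] i by simp
qed

lemma S_gate_eq: "i < Nq \<Longrightarrow> S_gate Nq Nf i = cis (pi / 4) \<cdot>\<^sub>m rot (herm_pauli (Nq + Nf) 0 (2 ^ i))
    (- (pi / 4))"
proof -
  assume i: "i < Nq"
  have "S_gate Nq Nf i = diag_op (2 ^ (Nq + Nf)) (\<lambda>x. if bit x i then cis (pi / 2) else 1)"
    unfolding S_gate_def using i
    by (intro eq_matI) (auto simp: qubit_op_index diag_op_def)
  then show ?thesis using diag_phase_gate[of i "Nq + Nf" "pi / 2"] i by simp
qed

lemma site_number_eq: "site_number Nq Nf j = diag_op (2 ^ (Nq + Nf))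
    (\<lambda>x. of_bool (bit x (Nq + j)))"
  using carrier_matD[OF site_number_carrier]
  by (intro eq_matI) (auto simp: site_number_index diag_op_def)

lemma qubit_number_eq: "qubit_number Nq Nf i = diag_op (2 ^ (Nq + Nf)) (\<lambda>x. of_bool (bit x i))"
  unfolding qubit_number_def
  by (intro eq_matI) (auto simp: qubit_op_index diag_op_def)

lemma Tf_gate_eq:
  "j < Nf \<Longrightarrow> Tf_gate Nq Nf j = cis (pi / 8) \<cdot>\<^sub>m rot (herm_pauli (Nq + Nf) 0 (2 ^ (Nq + j)))
      (- (pi / 8))"
proof -
  assume j: "j < Nf"
  have "Tf_gate Nq Nf j = diag_op (2 ^ (Nq + Nf))
      (\<lambda>x. if bit x (Nq + j) then cis (pi / 4) else 1)"
    unfolding Tf_gate_def site_number_eq smult_diag_op mat_exp_diag_op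
    by (rule arg_cong2[where f = diag_op]) (auto simp: cis_conv_exp)
  then show ?thesis using diag_phase_gate[of "Nq + j" "Nq + Nf" "pi / 4"] j by simp
qed

lemma CZqf_gate_eq:
  "CZqf_gate Nq Nf i j = diag_op (2 ^ (Nq + Nf))
      (\<lambda>x. if bit x i \<and> bit x (Nq + j) then - 1 else 1)"
  unfolding CZqf_gate_def site_number_eq qubit_number_eq diag_op_mult smult_diag_op
      mat_exp_diag_op
  by (rule arg_cong2[where f = diag_op]) auto

text \<open>The gate is (Z + X) / sqrt 2, in quaternion terms a half turn about the bisector of the
  two axes; -i restores the phase.\<close>

lemma H_gate_eq:
  "i < Nq \<Longrightarrow> H_gate Nq Nf i = (- \<i>) \<cdot>\<^sub>m quat (herm_pauli (Nq + Nf) 0 (2 ^ i))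
      (herm_pauli (Nq + Nf) (2 ^ i) 0)
    0 (1 / sqrt 2) (1 / sqrt 2) 0"
proof -
  assume i: "i < Nq"
  let ?Z = "herm_pauli (Nq + Nf) 0 (2 ^ i)" and ?X = "herm_pauli (Nq + Nf) (2 ^ i) 0"
  have m: "complex_of_real (1 / sqrt 2) \<cdot>\<^sub>m mat_of_rows_list 2 [[1, 1], [1, - 1]] =
      mat_of_rows_list 2 [[complex_of_real (1 / sqrt 2), complex_of_real (1 / sqrt 2)],
        [complex_of_real (1 / sqrt 2), - complex_of_real (1 / sqrt 2)]]"
    by (rule eq_matI) (auto simp: mat_of_rows_list_def less_Suc_eq numeral_2_eq_2)
  show ?thesis
  proof (rule eq_matI)
    fix x y
    assume "x < dim_row ((- \<i>) \<cdot>\<^sub>m quat ?Z ?X 0 (1 / sqrt 2) (1 / sqrt 2) 0)"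
      "y < dim_col ((- \<i>) \<cdot>\<^sub>m quat ?Z ?X 0 (1 / sqrt 2) (1 / sqrt 2) 0)"
    then have xy: "x < 2 ^ (Nq + Nf)" "y < 2 ^ (Nq + Nf)" by
        (simp_all add: quat_def herm_pauli_def)
    have "((- \<i>) \<cdot>\<^sub>m quat ?Z ?X 0 (1 / sqrt 2) (1 / sqrt 2) 0) $$ (x, y) =
        of_real (1 / sqrt 2) * (?Z $$ (x, y) + ?X $$ (x, y))"
      using xy carrier_matD[OF herm_pauli_carrier[of "Nq + Nf"]]
      by (simp add: quat_def algebra_simps del: index_mult_mat(1))
    also have "\<dots> = H_gate Nq Nf i $$ (x, y)"
      unfolding H_gate_def m qubit_op_index[OF xy] using xy i
      by (auto simp: herm_pauli_Z_index herm_pauli_X_index)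
    finally show "H_gate Nq Nf i $$ (x, y) = ((- \<i>) \<cdot>\<^sub>m quat ?Z ?X 0 (1 / sqrt 2) (1 / sqrt 2) 0)
        $$ (x, y)"
      by simp
  qed (simp_all add: H_gate_def quat_def herm_pauli_def)
qed

text \<open>The Jordan-Wigner signs below site \<open>i\<close> cancel, and the \<open>Z\<close> on
  site \<open>i\<close> brought by the minus sign cancels the one in the tail of \<open>j\<close>.
  The signs strictly between the sites remain, and the string is an involution.\<close>

lemma braid_gate_eq:
  assumes ij: "i < j" "j < Nf"
  shows "braid_gate Nq Nf i j =
    rot (herm_pauli (Nq + Nf) (xor (2 ^ (Nq + i)) (2 ^ (Nq + j)))
        (between_mask (Nq + i) (Nq + j))) (pi / 4)"
proof -
  let ?N = "Nq + Nf" and ?a = "Nq + i" and ?b = "Nq + j"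
  have m: "2 ^ ?a < (2 ^ ?N :: nat)" "2 ^ ?b < (2 ^ ?N :: nat)" using ij by simp_all
  have z: "xor (xor (site_mask Nq ?a) (2 ^ ?a)) (site_mask Nq ?b) = between_mask ?a ?b"
    using ij by (intro bit_eqI) (auto simp: bit_xor_iff bit_site_mask bit_between_mask)
  have "chi ?N (xor (site_mask Nq ?a) (2 ^ ?a)) (2 ^ ?b) = 1"
    using ij by (auto simp: chi_exp_right bit_xor_iff bit_site_mask)
  then have A: "(creat Nq Nf i - annih Nq Nf i) * (creat Nq Nf j + annih Nq Nf j) =
      pauli ?N (xor (2 ^ ?a) (2 ^ ?b)) (between_mask ?a ?b)"
    using ij by (simp add: creat_minus_annih creat_plus_annih pauli_mult[OF m] z)
  have "chi ?N (between_mask ?a ?b) (xor (2 ^ ?a) (2 ^ ?b)) = 1"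
    using ij by (simp add: chi_xor_right chi_exp_right bit_between_mask)
  then have h: "pauli ?N (xor (2 ^ ?a) (2 ^ ?b)) (between_mask ?a ?b) =
      herm_pauli ?N (xor (2 ^ ?a) (2 ^ ?b)) (between_mask ?a ?b)"
    by (simp add: herm_pauli_def pauli_phase_def chi_commute)
  show ?thesis
    unfolding braid_gate_def A h
    using mat_exp_involution[OF herm_pauli_carrier herm_pauli_square[OF xor_less_exp[OF m]], of
        "pi / 4"] by simp
qed

subsection \<open>Approximable operators\<close>

text \<open>The phase is chosen together with the circuit, since several gates equal rotations only
  up to a phase.\<close>

definition circuit_closure :: "nat \<Rightarrow> nat \<Rightarrow> complex mat set \<Rightarrow> complex mat set" where
  "circuit_closure Nq Nf \<G> = {A \<in> fock_ops Nq Nf. \<forall>e>0. \<exists>gs c. set gs \<subseteq> \<G> \<and> cmod c = 1 \<and>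
     (\<forall>x<fock_dim Nq Nf. \<forall>y<fock_dim Nq Nf. cmod
         ((c \<cdot>\<^sub>m circuit Nq Nf gs) $$ (x, y) - A $$ (x, y)) \<le> e)}"

lemma circuit_carrier: "\<G> \<subseteq> fock_ops Nq Nf \<Longrightarrow> set gs \<subseteq> \<G> \<Longrightarrow> circuit Nq Nf gs \<in> fock_ops Nq Nf"
proof (induction gs)
  case (Cons g gs)
  then show ?case
    using mult_carrier_mat[of g "fock_dim Nq Nf" "fock_dim Nq Nf" "circuit Nq Nf gs"] by
        (auto simp: circuit_def)
qed (simp add: circuit_def)

lemma circuit_append:
  assumes "\<G> \<subseteq> fock_ops Nq Nf" "set gs \<subseteq> \<G>" "set hs \<subseteq> \<G>"
  shows "circuit Nq Nf (gs @ hs) = circuit Nq Nf gs * circuit Nq Nf hs"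
  using assms
proof (induction gs)
  case Nil
  then show ?case using left_mult_one_mat[OF circuit_carrier[of \<G> Nq Nf hs]] by
      (simp add: circuit_def)
next
  case (Cons g gs)
  then have "circuit Nq Nf (g # gs @ hs) = g * (circuit Nq Nf gs * circuit Nq Nf hs)"
    by (simp add: circuit_def)
  also have "\<dots> = (g * circuit Nq Nf gs) * circuit Nq Nf hs"
    by (rule assoc_mult_mat[symmetric, of g "fock_dim Nq Nf" "fock_dim Nq Nf" _ "fock_dim Nq Nf" _
        "fock_dim Nq Nf"])
      (use Cons.prems in \<open>auto intro: circuit_carrier\<close>)
  finally show ?case by (simp add: circuit_def)
qed

lemma circuit_closureI:
  assumes "\<G> \<subseteq> fock_ops Nq Nf" "set gs \<subseteq> \<G>" "cmod c = 1"
  shows "c \<cdot>\<^sub>m circuit Nq Nf gs \<in> circuit_closure Nq Nf \<G>"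
  unfolding circuit_closure_def
  using circuit_carrier[OF assms(1,2)] assms(2,3)
  by (auto intro!: exI[of _ gs] exI[of _ c])

lemma gate_in_circuit_closure:
  assumes "\<G> \<subseteq> fock_ops Nq Nf" "g \<in> \<G>"
  shows "g \<in> circuit_closure Nq Nf \<G>"
proof -
  have "1 \<cdot>\<^sub>m circuit Nq Nf [g] = g"
    using assms right_mult_one_mat[of g "fock_dim Nq Nf" "fock_dim Nq Nf"] by
        (auto simp: circuit_def)
  then show ?thesis using circuit_closureI[OF assms(1), of "[g]" 1] assms(2) by simp
qed

lemma approx_monoid_circuit_closure:
  assumes \<G>: "\<G> \<subseteq> fock_ops Nq Nf"
  shows "approx_monoid (fock_dim Nq Nf) (circuit_closure Nq Nf \<G>)"
proof
  let ?n = "fock_dim Nq Nf" and ?C = "circuit_closure Nq Nf \<G>"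
  show carrier: "A \<in> ?C \<Longrightarrow> A \<in> carrier_mat ?n ?n" for A
    by (simp add: circuit_closure_def)
  show "1\<^sub>m ?n \<in> ?C"
    using circuit_closureI[OF \<G>, of "[]" 1] by (simp add: circuit_def)
  show "c \<cdot>\<^sub>m A \<in> ?C" if A: "A \<in> ?C" and c: "cmod c = 1" for A c
    unfolding circuit_closure_def
  proof (intro CollectI conjI allI impI)
    show "c \<cdot>\<^sub>m A \<in> carrier_mat ?n ?n" using carrier[OF A] by simp
    fix e :: real assume "e > 0"
    then obtain gs d where g: "set gs \<subseteq> \<G>" "cmod d = 1"
      "\<And>x y. x < ?n \<Longrightarrow> y < ?n \<Longrightarrow> cmod ((d \<cdot>\<^sub>m circuit Nq Nf gs) $$ (x, y) - A $$ (x, y)) \<le> e"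
      using A unfolding circuit_closure_def by blast
    note cc = circuit_carrier[OF \<G> g(1)]
    have "cmod (((c * d) \<cdot>\<^sub>m circuit Nq Nf gs) $$ (x, y) - (c \<cdot>\<^sub>m A) $$ (x, y)) \<le> e"
      if xy: "x < ?n" "y < ?n" for x y
    proof -
      have "((c * d) \<cdot>\<^sub>m circuit Nq Nf gs) $$ (x, y) - (c \<cdot>\<^sub>m A) $$ (x, y) =
          c * ((d \<cdot>\<^sub>m circuit Nq Nf gs) $$ (x, y) - A $$ (x, y))"
        using cc carrier[OF A] xy by (simp add: algebra_simps)
      then show ?thesis using g(3)[OF xy] c by (simp add: norm_mult)
    qed
    then show "\<exists>gs d. set gs \<subseteq> \<G> \<and> cmod d = 1 \<and>
        (\<forall>x<?n. \<forall>y<?n. cmod ((d \<cdot>\<^sub>m circuit Nq Nf gs) $$ (x, y) - (c \<cdot>\<^sub>m A) $$ (x, y)) \<le> e)"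
      using g(1,2) c by (intro exI[of _ gs] exI[of _ "c * d"]) (auto simp: norm_mult)
  qed
  show "A \<in> ?C" if A: "A \<in> carrier_mat ?n ?n"
    and lim: "\<And>e. e > 0 \<Longrightarrow> \<exists>B\<in>?C. \<forall>x<?n. \<forall>y<?n. cmod (B $$ (x, y) - A $$ (x, y)) \<le> e" for A
    unfolding circuit_closure_def
  proof (intro CollectI conjI allI impI)
    fix e :: real assume e: "e > 0"
    then obtain B where B: "B \<in> ?C" "\<And>x y. x < ?n \<Longrightarrow> y < ?n \<Longrightarrow> cmod (B $$ (x, y) - A $$ (x, y)) \<le>
        e / 2"
      using lim[of "e / 2"] by auto
    from e have "e / 2 > 0" by simp
    then obtain gs d where g: "set gs \<subseteq> \<G>" "cmod d = 1"
      "\<And>x y. x < ?n \<Longrightarrow> y < ?n \<Longrightarrow> cmod ((d \<cdot>\<^sub>m circuit Nq Nf gs) $$ (x, y) - B $$ (x, y)) \<le> e / 2"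
      using B(1) unfolding circuit_closure_def by blast
    have "cmod ((d \<cdot>\<^sub>m circuit Nq Nf gs) $$ (x, y) - A $$ (x, y)) \<le> e" if "x < ?n" "y < ?n" for x
        y
      using norm_triangle_le[OF add_mono[OF g(3)[OF that] B(2)[OF that]]] by simp
    then show "\<exists>gs d. set gs \<subseteq> \<G> \<and> cmod d = 1 \<and>
        (\<forall>x<?n. \<forall>y<?n. cmod ((d \<cdot>\<^sub>m circuit Nq Nf gs) $$ (x, y) - A $$ (x, y)) \<le> e)"
      using g(1,2) by blast
  qed (rule A)
  show "A * B \<in> ?C" if AB: "A \<in> ?C" "B \<in> ?C" for A B
    unfolding circuit_closure_def
  proof (intro CollectI conjI allI impI)
    note Ac = carrier[OF AB(1)] and Bc = carrier[OF AB(2)]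
    show "A * B \<in> carrier_mat ?n ?n" using Ac Bc by simp
    fix e :: real assume e: "e > 0"
    define K where "K = 1 + (\<Sum>x<?n. \<Sum>y<?n. cmod (A $$ (x, y))) +
        (\<Sum>x<?n. \<Sum>y<?n. cmod (B $$ (x, y)))"
    have entry_le: "cmod (M $$ (x, y)) \<le> (\<Sum>x<?n. \<Sum>y<?n. cmod (M $$ (x, y)))" if "x < ?n" "y < ?n"
        for x y and M :: "complex mat"
    proof -
      have "cmod (M $$ (x, y)) \<le> (\<Sum>y<?n. cmod (M $$ (x, y)))"
        using that by (intro member_le_sum) auto
      also have "\<dots> \<le> (\<Sum>x<?n. \<Sum>y<?n. cmod (M $$ (x, y)))"
        using that by (intro member_le_sum[of x _ "\<lambda>x. \<Sum>y<?n. cmod (M $$ (x, y))"] sum_nonneg)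
            auto
      finally show ?thesis .
    qed
    have nonneg: "0 \<le> (\<Sum>x<?n. \<Sum>y<?n. cmod (M $$ (x, y)))" for M :: "complex mat"
      by (intro sum_nonneg) auto
    have K: "K > 0" "x < ?n \<Longrightarrow> y < ?n \<Longrightarrow> cmod (A $$ (x, y)) \<le> K"
      "x < ?n \<Longrightarrow> y < ?n \<Longrightarrow> cmod (B $$ (x, y)) + 1 \<le> K" for x y
      using entry_le[of x y A] entry_le[of x y B] nonneg[of A] nonneg[of B] unfolding K_def by
          linarith+
    \<comment> \<open>The bound 1 keeps the entries of the approximant \<open>W\<close> below
      \<open>K\<close>; each summand of the product then errs by at most
      \<open>2 * d * K\<close>.\<close>
    define d where "d = min 1 (e / (2 * real ?n * K))"
    have d: "d > 0" "d \<le> 1" "d \<le> e / (2 * real ?n * K)" using e K(1) by (auto simp: d_def)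
    obtain gs a where g: "set gs \<subseteq> \<G>" "cmod a = 1"
      "\<And>x y. x < ?n \<Longrightarrow> y < ?n \<Longrightarrow> cmod ((a \<cdot>\<^sub>m circuit Nq Nf gs) $$ (x, y) - A $$ (x, y)) \<le> d"
      using AB(1) d(1) unfolding circuit_closure_def by blast
    obtain hs b where h: "set hs \<subseteq> \<G>" "cmod b = 1"
      "\<And>x y. x < ?n \<Longrightarrow> y < ?n \<Longrightarrow> cmod ((b \<cdot>\<^sub>m circuit Nq Nf hs) $$ (x, y) - B $$ (x, y)) \<le> d"
      using AB(2) d(1) unfolding circuit_closure_def by blast
    define V W where "V = a \<cdot>\<^sub>m circuit Nq Nf gs" and "W = b \<cdot>\<^sub>m circuit Nq Nf hs"
    have c: "circuit Nq Nf gs \<in> carrier_mat ?n ?n" "circuit Nq Nf hs \<in> carrier_mat ?n ?n"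
      "V \<in> carrier_mat ?n ?n" "W \<in> carrier_mat ?n ?n"
      using circuit_carrier[OF \<G>] g(1) h(1) by (auto simp: V_def W_def)
    have VW: "(a * b) \<cdot>\<^sub>m circuit Nq Nf (gs @ hs) = V * W"
      unfolding circuit_append[OF \<G> g(1) h(1)] V_def W_def
      using c by (simp add: mult_smult_assoc_mat[OF c(1) smult_carrier_mat[OF c(2)]]
        mult_smult_distrib[OF c(1,2)] smult_smult_mat)
    have "cmod ((V * W) $$ (x, y) - (A * B) $$ (x, y)) \<le> e" if xy: "x < ?n" "y < ?n" for x y
    proof -
      have "(V * W) $$ (x, y) - (A * B) $$ (x, y) =
          (\<Sum>z<?n. (V $$ (x, z) - A $$ (x, z)) * W $$ (z, y)
          + A $$ (x, z) * (W $$ (z, y) - B $$ (z, y)))"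
        unfolding mult_index[OF c(3,4) xy] mult_index[OF Ac Bc xy] sum_subtractf[symmetric]
        by (intro sum.cong) (auto simp: algebra_simps)
      also have "cmod \<dots> \<le> (\<Sum>z<?n. d * K + K * d)"
      proof (intro sum_norm_le)
        fix z assume "z \<in> {..<?n}"
        then have z: "z < ?n" by simp
        have "cmod (W $$ (z, y)) \<le> cmod (B $$ (z, y)) + d"
          using h(3)[OF z xy(2)] norm_triangle_sub[of "W $$ (z, y)" "B $$ (z, y)"] unfolding W_def
              by linarith
        then have W: "cmod (W $$ (z, y)) \<le> K" using K(3)[OF z xy(2)] d(2) by linarith
        have "cmod ((V $$ (x, z) - A $$ (x, z)) * W $$ (z, y)) \<le> d * K"
          unfolding norm_mult using g(3)[OF xy(1) z] W d(1) by (intro mult_mono)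
              (auto simp: V_def)
        moreover have "cmod (A $$ (x, z) * (W $$ (z, y) - B $$ (z, y))) \<le> K * d"
          unfolding norm_mult using h(3)[OF z xy(2)] K(1) K(2)[OF xy(1) z] by (intro mult_mono)
              (auto simp: W_def)
        ultimately show "cmod ((V $$ (x, z) - A $$ (x, z)) * W $$ (z, y)
          + A $$ (x, z) * (W $$ (z, y) - B $$ (z, y))) \<le> d * K + K * d"
          by (rule norm_triangle_le[OF add_mono])
      qed
      also have "\<dots> = d * (2 * real ?n * K)" by simp
      also have "\<dots> \<le> e / (2 * real ?n * K) * (2 * real ?n * K)"
        using d(3) K(1) by (intro mult_right_mono) auto
      also have "\<dots> = e" using K(1) by simp
      finally show ?thesis .
    qed
    then show "\<exists>gs c. set gs \<subseteq> \<G> \<and> cmod c = 1 \<and>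
        (\<forall>x<?n. \<forall>y<?n. cmod ((c \<cdot>\<^sub>m circuit Nq Nf gs) $$ (x, y) - (A * B) $$ (x, y)) \<le> e)"
      using g(1,2) h(1,2) by (intro exI[of _ "gs @ hs"] exI[of _ "a * b"])
          (auto simp: VW norm_mult)
  qed
qed

subsection \<open>The operator norm\<close>

text \<open>The Euclidean norm is at most the sum of the moduli, and coordinates of vectors in the
  unit ball have modulus at most 1. This crude bound suffices because the dimension will not depend
  on the accuracy.\<close>

lemma op_norm_le_sum:
  assumes A: "A \<in> carrier_mat n n"
  shows "op_norm A \<le> (\<Sum>x<n. \<Sum>y<n. cmod (A $$ (x, y)))"
  unfolding op_norm_def
proof (rule cSUP_least)
  have norm_eq: "vec_l2norm v = L2_set (\<lambda>i. cmod (v $ i)) {..<dim_vec v}" for v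
  proof -
    have "v \<bullet>c v = of_real (\<Sum>i<dim_vec v. (cmod (v $ i))\<^sup>2)"
      unfolding scalar_prod_def of_real_sum complex_norm_square atLeast0LessThan by simp
    then show ?thesis by (simp add: vec_l2norm_def L2_set_def)
  qed
  have "0\<^sub>v n \<in> {v \<in> carrier_vec (dim_col A). vec_l2norm v \<le> 1}"
    using A by (simp add: norm_eq L2_set_def)
  then show "{v \<in> carrier_vec (dim_col A). vec_l2norm v \<le> 1} \<noteq> {}" by blast
  fix v assume "v \<in> {v \<in> carrier_vec (dim_col A). vec_l2norm v \<le> 1}"
  then have v: "dim_vec v = n" "vec_l2norm v \<le> 1" using A by auto
  have v1: "cmod (v $ i) \<le> 1" if "i < n" for i
    using member_le_L2_set[of "{..<n}" i "\<lambda>i. cmod (v $ i)"] that v unfolding norm_eq by simp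
  have "vec_l2norm (A *\<^sub>v v) \<le> (\<Sum>x<n. cmod ((A *\<^sub>v v) $ x))"
  proof -
    have dim: "dim_vec (A *\<^sub>v v) = n" using A by simp
    show ?thesis unfolding norm_eq dim by (rule L2_set_le_sum) simp
  qed
  also have "\<dots> \<le> (\<Sum>x<n. \<Sum>y<n. cmod (A $$ (x, y)))"
  proof (rule sum_mono)
    fix x assume x: "x \<in> {..<n}"
    then have "(A *\<^sub>v v) $ x = (\<Sum>y<n. A $$ (x, y) * v $ y)"
      using A v by (simp add: scalar_prod_def atLeast0LessThan)
    also have "cmod \<dots> \<le> (\<Sum>y<n. cmod (A $$ (x, y)))"
      using v1 by (intro sum_norm_le) (auto simp: norm_mult intro!: mult_left_le)
    finally show "cmod ((A *\<^sub>v v) $ x) \<le> (\<Sum>y<n. cmod (A $$ (x, y)))" .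
  qed
  finally show "vec_l2norm (A *\<^sub>v v) \<le> (\<Sum>x<n. \<Sum>y<n. cmod (A $$ (x, y)))" .
qed

subsection \<open>The gate sets generate all rotations about even Pauli strings\<close>

text \<open>\<open>h\<close> is the half turn about the bisector of \<open>P\<close> and
  \<open>Q\<close>, which exchanges them; the minus sign is there because \<open>h\<close> squares
  to -1.\<close>

lemma hadamard_conj:
  assumes "P \<in> carrier_mat n n" "Q \<in> carrier_mat n n" "P * P = 1\<^sub>m n" "Q * Q = 1\<^sub>m n"
    "Q * P = (- 1) \<cdot>\<^sub>m (P * Q)"
  defines "h \<equiv> quat P Q 0 (1 / sqrt 2) (1 / sqrt 2) 0"
  shows "rot Q t = (- 1) \<cdot>\<^sub>m (h * rot P t * h)"
proof -
  have "h * rot P t * h = quat P Q (- cos t) 0 (- sin t) 0"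
    unfolding h_def rot_eq_quat[OF assms(1-5)] quat_mult[OF assms(1-5)] by (simp add: field_simps)
  moreover have "(- 1) \<cdot>\<^sub>m quat P Q (- cos t) 0 (- sin t) 0 = quat P Q (cos t) 0 (sin t) 0"
    using anticommuting_dims[OF assms(1-5)] by (intro eq_matI)
        (simp_all add: quat_def del: index_mult_mat(1))
  ultimately show ?thesis unfolding rot_eq_quat[OF assms(1-5)] by simp
qed

lemma diag_op_conj_rot:
  assumes P: "P \<in> carrier_mat n n" and d: "\<And>x. d x * d x = 1"
  shows "diag_op n d * rot P t * diag_op n d = rot (diag_op n d * P * diag_op n d) t"
proof (rule eq_matI)
  fix x y assume "x < dim_row (rot (diag_op n d * P * diag_op n d) t)"
      "y < dim_col (rot (diag_op n d * P * diag_op n d) t)"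
  then have xy: "x < n" "y < n" by (simp_all add: diag_op_def)
  have c: "diag_op n d * A \<in> carrier_mat n n" "diag_op n d * A * diag_op n d \<in> carrier_mat n n"
    if "A \<in> carrier_mat n n" for A
    using that by (auto simp: diag_op_def)
  show "(diag_op n d * rot P t * diag_op n d) $$ (x, y) =
      rot (diag_op n d * P * diag_op n d) t $$ (x, y)"
    unfolding rot_index[OF c(2)[OF P] xy] diag_op_mult_index(2)[OF c(1)[OF rot_carrier[OF P]] xy]
      diag_op_mult_index(2)[OF c(1)[OF P] xy] diag_op_mult_index(1)[OF rot_carrier[OF P] xy]
      diag_op_mult_index(1)[OF P xy] rot_index[OF P xy]
    using d[of y] by (auto simp: algebra_simps)
qed (simp_all add: diag_op_def)

lemma involution_conj:
  fixes D P :: "complex mat"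
  assumes D: "D \<in> carrier_mat n n" and P: "P \<in> carrier_mat n n" and DD: "D * D = 1\<^sub>m n" and PP:
      "P * P = 1\<^sub>m n"
  shows "(D * P * D) * (D * P * D) = 1\<^sub>m n"
proof -
  note PD = mult_carrier_mat[OF P D] and DP = mult_carrier_mat[OF D P]
  note DPD = mult_carrier_mat[OF D PD]
  have "(D * P * D) * (D * P * D) = (D * (P * D)) * (D * (P * D))"
    unfolding assoc_mult_mat[OF D P D] ..
  also have "\<dots> = D * ((P * D) * (D * (P * D)))" by (rule assoc_mult_mat[OF D PD DPD])
  also have "(P * D) * (D * (P * D)) = P * (D * (D * (P * D)))" by
      (rule assoc_mult_mat[OF P D DPD])
  also have "D * (D * (P * D)) = P * D"
    unfolding assoc_mult_mat[OF D D PD, symmetric] DD by (rule left_mult_one_mat[OF PD])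
  also have "P * (P * D) = D"
    unfolding assoc_mult_mat[OF P P D, symmetric] PP by (rule left_mult_one_mat[OF D])
  finally show ?thesis unfolding DD .
qed

text \<open>Flipping bit \<open>i\<close> changes the controlled sign by the value of bit
  \<open>j\<close>, and vice versa, which produces the \<open>Z\<close> factors. The scalar is
  compared with the phase convention only through its square.\<close>

lemma CZ_conj_pauli:
  fixes m z :: nat
  assumes ij: "i < N" "j < N" "i \<noteq> j" and m: "m < 2 ^ N"
  defines "D \<equiv> diag_op (2 ^ N) (\<lambda>x. if bit x i \<and> bit x j then - 1 else 1)"
  defines "z' \<equiv> xor z (xor (if bit m i then 2 ^ j else 0) (if bit m j then 2 ^ i else 0))"
  shows "D * herm_pauli N m z * D = herm_pauli N m z' \<or> D * herm_pauli N m z * D =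
      (- 1) \<cdot>\<^sub>m herm_pauli N m z'"
proof -
  define c where "c = (if bit m i \<and> bit m j then - 1 else 1) * pauli_phase N m z"
  let ?P = "herm_pauli N m z"
  have D: "D \<in> carrier_mat (2 ^ N) (2 ^ N)" by (simp add: D_def)
  have DP: "D * ?P \<in> carrier_mat (2 ^ N) (2 ^ N)" by
      (rule mult_carrier_mat[OF D herm_pauli_carrier])
  have DPD: "D * ?P * D \<in> carrier_mat (2 ^ N) (2 ^ N)" by (rule mult_carrier_mat[OF DP D])
  have DD: "D * D = 1\<^sub>m (2 ^ N)"
    unfolding D_def diag_op_mult by (rule eq_matI) (auto simp: diag_op_def)
  have eq: "D * ?P * D = c \<cdot>\<^sub>m pauli N m z'"
  proof (rule eq_matI)
    fix x y assume "x < dim_row (c \<cdot>\<^sub>m pauli N m z')" "y < dim_col (c \<cdot>\<^sub>m pauli N m z')"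
    then have xy: "x < 2 ^ N" "y < 2 ^ N" by simp_all
    show "(D * ?P * D) $$ (x, y) = (c \<cdot>\<^sub>m pauli N m z') $$ (x, y)"
      unfolding D_def diag_op_mult_index(2)[OF DP[unfolded D_def] xy]
          diag_op_mult_index(1)[OF herm_pauli_carrier xy]
      using xy ij
      by (cases "bit m i"; cases "bit m j"; cases "bit y i"; cases "bit y j")
        (auto simp: herm_pauli_def pauli_index c_def z'_def chi_xor_left chi_exp_left bit_xor_iff)
  qed (use DPD in auto)
  have "(D * ?P * D) * (D * ?P * D) = 1\<^sub>m (2 ^ N)"
    by (rule involution_conj[OF D herm_pauli_carrier DD herm_pauli_square[OF m]])
  then show ?thesis
    unfolding eq by (intro smult_pauli_eq_herm_pauli[OF m])
qed

lemma gate_monoid_circuit_closure: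
  assumes G: "common_gates Nq Nf \<subseteq> \<G>" "\<G> \<subseteq> fock_ops Nq Nf" and q: "q < Nq" and Nf: "2 \<le> Nf"
  shows "gate_monoid (Nq + Nf) (circuit_closure Nq Nf \<G>) Nq q"
proof -
  let ?N = "Nq + Nf" and ?C = "circuit_closure Nq Nf \<G>"
  interpret pauli_monoid ?N ?C
    unfolding pauli_monoid_def by (rule approx_monoid_circuit_closure[OF G(2)])
  have gate: "g \<in> ?C" if "g \<in> common_gates Nq Nf" for g
    using gate_in_circuit_closure[OF G(2)] G(1) that by blast
  have unphase: "A \<in> ?C" if "c \<cdot>\<^sub>m A \<in> ?C" "cmod c = 1" for c A
  proof -
    have "inverse c \<cdot>\<^sub>m (c \<cdot>\<^sub>m A) \<in> ?C" using that(2) by (intro phase[OF that(1)])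
        (simp add: norm_inverse)
    moreover have "c \<noteq> 0" using that by auto
    ultimately show ?thesis by (simp add: smult_smult_mat)
  qed
  have Z: "pauli_angle ?C ?N (pi / 4) 0 (2 ^ i)" if i: "i < Nq" for i
  proof -
    have "S_gate Nq Nf i \<in> ?C" using i by (intro gate) (auto simp: common_gates_def)
    then have "rot (herm_pauli ?N 0 (2 ^ i)) (- (pi / 4)) \<in> ?C"
      unfolding S_gate_eq[OF i] by (rule unphase) simp
    \<comment> \<open>Eight steps of pi/4 make a full turn, so \<open>S\<close> yields both signs of
      the angle.\<close>
    then have "pauli_angle ?C ?N (- (pi / 4)) 0 (2 ^ i)"
      by (intro pauli_angle_minus[where k = 8]) auto
    then show ?thesis by (simp add: pauli_angle_def)
  qed
  show ?thesis
  proof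
    show "q < Nq" "Nq + 2 \<le> ?N" using q Nf by simp_all
    show "pauli_angle ?C ?N (pi / 4) 0 (2 ^ i)" if "i < Nq" for i by (rule Z[OF that])
    show "pauli_angle ?C ?N (pi / 4) (2 ^ i) 0" if i: "i < Nq" for i
    proof -
      let ?h = "quat (herm_pauli ?N 0 (2 ^ i)) (herm_pauli ?N (2 ^ i) 0) 0 (1 / sqrt 2)
          (1 / sqrt 2) 0"
      have "H_gate Nq Nf i \<in> ?C" using i by (intro gate) (auto simp: common_gates_def)
      then have h: "?h \<in> ?C" unfolding H_gate_eq[OF i] by (rule unphase) simp
      have m: "(0::nat) < 2 ^ ?N" "(2 ^ i :: nat) < 2 ^ ?N" using i by simp_all
      have "anticomm ?N 0 (2 ^ i) (2 ^ i) 0" using i by (simp add: anticomm_def chi_exp_left)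
      note hc = hadamard_conj[OF herm_pauli_carrier herm_pauli_carrier herm_pauli_square[OF m(1)]
          herm_pauli_square[OF m(2)] herm_pauli_anticommute[OF m this]]
      have "rot (herm_pauli ?N (2 ^ i) 0) t \<in> ?C" if "rot (herm_pauli ?N 0 (2 ^ i)) t \<in> ?C" for t
        unfolding hc by (rule phase[OF mult[OF mult[OF h that] h]]) simp
      then show ?thesis using Z[OF i] m unfolding pauli_angle_def by blast
    qed
    show "pauli_angle ?C ?N (pi / 4) (xor (2 ^ j) (2 ^ k)) (between_mask j k)"
      if jk: "Nq \<le> j" "j < k" "k < ?N" for j k
    proof (rule pauli_angle_minus[where k = 8])
      show "xor (2 ^ j) (2 ^ k) < (2 ^ ?N :: nat)" using jk by (intro xor_less_exp) simp_all
      have "j - Nq < Nf" "k - Nq < Nf" "j - Nq \<noteq> k - Nq" using jk by auto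
      then have "braid_gate Nq Nf (j - Nq) (k - Nq) \<in> ?C"
        by (intro gate) (unfold common_gates_def, blast)
      then show "rot (herm_pauli ?N (xor (2 ^ j) (2 ^ k)) (between_mask j k)) (pi / 4) \<in> ?C"
        using braid_gate_eq[of "j - Nq" "k - Nq" Nf Nq] jk by simp
    qed simp
    show "pauli_angle ?C ?N (pi / 4) m (xor z
        (xor (if bit m i then 2 ^ j else 0) (if bit m j then 2 ^ i else 0)))"
      if i: "i < Nq" and j: "Nq \<le> j" "j < ?N" and S: "pauli_angle ?C ?N (pi / 4) m z" for i j m z
    proof -
      let ?d = "\<lambda>x. if bit x i \<and> bit x j then - 1 else 1 :: complex"
      let ?D = "diag_op (2 ^ ?N) ?d"
      have m: "m < 2 ^ ?N" using S by (simp add: pauli_angle_def)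
      have "j - Nq < Nf" using j by auto
      with i have "CZqf_gate Nq Nf i (j - Nq) \<in> ?C"
        by (intro gate) (unfold common_gates_def, blast)
      then have D: "?D \<in> ?C" unfolding CZqf_gate_eq using j by simp
      have r: "rot (?D * herm_pauli ?N m z * ?D) t = ?D * rot (herm_pauli ?N m z) t * ?D" for t
        by (rule diag_op_conj_rot[symmetric]) auto
      have ij: "i < ?N" "j < ?N" "i \<noteq> j" using i j by simp_all
      show ?thesis
        unfolding pauli_angle_iff[OF CZ_conj_pauli[OF ij m]] r
        using S m mult[OF mult[OF D] D] unfolding pauli_angle_def by blast
    qed
  qed
qed

subsection \<open>Restriction to the ancilla subspace\<close>

text \<open>In a joint index the ancilla qubits lie between system qubits and system sites. The
  embedding leaves zeros there, and \<open>sys_index\<close> recovers the mask.\<close>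

definition embed_mask :: "nat \<Rightarrow> nat \<Rightarrow> nat \<Rightarrow> nat" where
  "embed_mask Lq Aq m = or (take_bit Lq m) (push_bit (Lq + Aq) (drop_bit Lq m))"

lemma bit_embed_mask:
  "bit (embed_mask Lq Aq m) k \<longleftrightarrow> (if k < Lq then bit m k else Lq + Aq \<le> k \<and> bit m (k - Aq))"
proof -
  have "Lq + Aq \<le> k \<Longrightarrow> Lq + (k - (Lq + Aq)) = k - Aq" by simp
  then show ?thesis
    unfolding embed_mask_def bit_or_iff bit_take_bit_iff bit_push_bit_iff bit_drop_bit_eq by auto
qed

lemma embed_mask_less: "m < 2 ^ (Lq + Lf) \<Longrightarrow> embed_mask Lq Aq m < 2 ^ (Lq + Aq + (Lf + Af))"
  by (rule nat_bit_less) (auto simp: bit_embed_mask split: if_splits dest!: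
      nat_bit_bound[where n = "Lq + Lf"])

lemma sys_index_embed_mask: "m < 2 ^ (Lq + Lf) \<Longrightarrow> sys_index Lq Lf Aq (embed_mask Lq Aq m) = m"
  by (rule bit_eqI) (auto simp: bit_sys_index bit_embed_mask dest: nat_bit_bound)

lemma sys_index_xor: "sys_index Lq Lf Aq (xor x y) =
    xor (sys_index Lq Lf Aq x) (sys_index Lq Lf Aq y)"
  by (rule bit_eqI) (auto simp: bit_sys_index bit_xor_iff)

lemma anc_eq_xor_embed_mask:
  assumes "m < 2 ^ (Lq + Lf)"
  shows "anc_eq Lq Lf Aq x (xor y (embed_mask Lq Aq m)) \<longleftrightarrow> anc_eq Lq Lf Aq x y"
proof -
  have "\<not> bit (embed_mask Lq Aq m) k" if "Lq \<le> k \<and> k < Lq + Aq \<or> Lq + Aq + Lf \<le> k" for k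
    using that nat_bit_bound[OF _ assms, of "k - Aq"] by (auto simp: bit_embed_mask)
  then show ?thesis by (auto simp: anc_eq_def bit_xor_iff)
qed

lemma chi_embed_mask:
  assumes z: "z < 2 ^ (Lq + Lf)"
  shows "chi (Lq + Aq + (Lf + Af)) (embed_mask Lq Aq z) y =
      chi (Lq + Lf) z (sys_index Lq Lf Aq y)"
proof -
  define e where "e k = (if k < Lq then k else k + Aq)" for k
  define g where "g k = (if bit (embed_mask Lq Aq z) k \<and> bit y k then - 1 else 1 :: real)" for k
  have inj: "inj_on e {..<Lq + Lf}" by (auto simp: inj_on_def e_def split: if_splits)
  have "chi (Lq + Lf) z (sys_index Lq Lf Aq y) = (\<Prod>k<Lq + Lf. g (e k))"
    unfolding chi_def by (intro prod.cong) (auto simp: g_def e_def bit_embed_mask bit_sys_index)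
  also have "\<dots> = (\<Prod>k\<in>e ` {..<Lq + Lf}. g k)" using prod.reindex[OF inj, of g] by simp
  also have "\<dots> = (\<Prod>k<Lq + Aq + (Lf + Af). g k)"
  proof (rule prod.mono_neutral_left)
    show "e ` {..<Lq + Lf} \<subseteq> {..<Lq + Aq + (Lf + Af)}" by (auto simp: e_def)
    show "\<forall>k\<in>{..<Lq + Aq + (Lf + Af)} - e ` {..<Lq + Lf}. g k = 1"
    proof
      fix k assume k: "k \<in> {..<Lq + Aq + (Lf + Af)} - e ` {..<Lq + Lf}"
      have "\<not> bit (embed_mask Lq Aq z) k"
      proof
        assume "bit (embed_mask Lq Aq z) k"
        then consider "k < Lq" | "Lq + Aq \<le> k" "bit z (k - Aq)" by
            (auto simp: bit_embed_mask split: if_splits)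
        then have "k \<in> e ` {..<Lq + Lf}"
        proof cases
          case 1
          then show ?thesis by (intro image_eqI[of _ _ k]) (auto simp: e_def)
        next
          case 2
          then show ?thesis using nat_bit_bound[OF 2(2) z]
            by (intro image_eqI[of _ _ "k - Aq"]) (auto simp: e_def)
        qed
        then show False using k by blast
      qed
      then show "g k = 1" by (simp add: g_def)
    qed
  qed simp
  also have "\<dots> = chi (Lq + Aq + (Lf + Af)) (embed_mask Lq Aq z) y" by (simp add: chi_def g_def)
  finally show ?thesis ..
qed

lemma chi_site_mask_embed:
  assumes m: "m < 2 ^ (Lq + Lf)"
  shows "chi (Lq + Aq + (Lf + Af)) (site_mask (Lq + Aq) (Lq + Aq + (Lf + Af)))
      (embed_mask Lq Aq m) =
    chi (Lq + Lf) (site_mask Lq (Lq + Lf)) m"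
proof -
  have "sys_index Lq Lf Aq (site_mask (Lq + Aq) (Lq + Aq + (Lf + Af))) = site_mask Lq (Lq + Lf)"
    by (rule bit_eqI) (auto simp: bit_sys_index bit_site_mask)
  then show ?thesis
    using chi_embed_mask[OF m, of Aq Af "site_mask (Lq + Aq) (Lq + Aq + (Lf + Af))"] by
        (simp add: chi_commute)
qed

lemma fermion_parity_eq:
  "fermion_parity Lq Lf = diag_op (fock_dim Lq Lf)
      (\<lambda>x. of_real (chi (Lq + Lf) (site_mask Lq (Lq + Lf)) x))"
proof -
  have "(\<i> * pi) \<cdot>\<^sub>m total_site_number Lq Lf =
      diag_op (fock_dim Lq Lf) (\<lambda>x. \<Sum>j<Lf. \<i> * pi * of_bool (bit x (Lq + j)))"
    unfolding total_site_number_def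
    by (rule eq_matI) (auto simp: diag_op_def site_number_index sum_distrib_left)
  moreover have "exp (\<Sum>j<Lf. \<i> * pi * of_bool (bit x (Lq + j))) = jw_sign Lq Lf x" for x
    unfolding jw_sign_prod exp_sum[OF finite_lessThan] by (intro prod.cong) auto
  ultimately show ?thesis
    unfolding fermion_parity_def by (simp add: mat_exp_diag_op jw_sign_eq_chi[OF order_refl])
qed

lemma even_entries:
  assumes U: "U \<in> fock_ops Lq Lf" and comm: "U * fermion_parity Lq Lf = fermion_parity Lq Lf * U"
    and xy: "x < fock_dim Lq Lf" "y < fock_dim Lq Lf"
    and neq: "chi (Lq + Lf) (site_mask Lq (Lq + Lf)) x \<noteq> chi (Lq + Lf) (site_mask Lq (Lq + Lf)) y"
  shows "U $$ (x, y) = 0"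
proof -
  have "(U * fermion_parity Lq Lf) $$ (x, y) = (fermion_parity Lq Lf * U) $$ (x, y)" using comm by
      simp
  then show ?thesis
    unfolding fermion_parity_eq diag_op_mult_index[OF U xy] using neq by simp
qed

lemma ancilla_proj_eq:
  "ancilla_proj Lq Lf Aq Af bq bf = diag_op (fock_dim (Lq + Aq) (Lf + Af)) (\<lambda>y. of_bool
     ((\<forall>k<Aq. bit y (Lq + k) = bq k) \<and> (\<forall>k<Af. bit y (Lq + Aq + (Lf + k)) = bf k)))"
  unfolding ancilla_proj_def by (rule eq_matI) (auto simp: diag_op_def)

lemma ancilla_proj_carrier [simp]: "ancilla_proj Lq Lf Aq Af bq bf \<in> fock_ops (Lq + Aq) (Lf + Af)"
  by (simp add: ancilla_proj_def)

lemma joint_ext_carrier [simp]: "joint_ext Lq Lf Aq Af V \<in> fock_ops (Lq + Aq) (Lf + Af)"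
  by (simp add: joint_ext_def)

text \<open>The projector reads only ancilla bits, and an extended system operator connects only
  indices that agree on those.\<close>

lemma ancilla_proj_commute:
  "ancilla_proj Lq Lf Aq Af bq bf * joint_ext Lq Lf Aq Af V =
      joint_ext Lq Lf Aq Af V * ancilla_proj Lq Lf Aq Af bq bf"
proof (rule eq_matI)
  let ?b = "\<lambda>y. (\<forall>k<Aq. bit y (Lq + k) = bq k) \<and> (\<forall>k<Af. bit y (Lq + Aq + (Lf + k)) = bf k)"
  fix x y assume "x < dim_row (joint_ext Lq Lf Aq Af V * ancilla_proj Lq Lf Aq Af bq bf)"
    "y < dim_col (joint_ext Lq Lf Aq Af V * ancilla_proj Lq Lf Aq Af bq bf)"
  then have xy: "x < fock_dim (Lq + Aq) (Lf + Af)" "y < fock_dim (Lq + Aq) (Lf + Af)"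
    by (simp_all add: joint_ext_def ancilla_proj_def)
  have "?b x = ?b y" if "anc_eq Lq Lf Aq x y" using that by (auto simp: anc_eq_def)
  then have "of_bool (?b x) * joint_ext Lq Lf Aq Af V $$ (x, y) =
      joint_ext Lq Lf Aq Af V $$ (x, y) * of_bool (?b y)"
    using xy by (simp add: joint_ext_def)
  then show "(ancilla_proj Lq Lf Aq Af bq bf * joint_ext Lq Lf Aq Af V) $$ (x, y) =
      (joint_ext Lq Lf Aq Af V * ancilla_proj Lq Lf Aq Af bq bf) $$ (x, y)"
    unfolding ancilla_proj_eq diag_op_mult_index[OF joint_ext_carrier xy] .
qed (simp_all add: joint_ext_def ancilla_proj_def)

lemma herm_pauli_index:
  "x < 2 ^ N \<Longrightarrow> y < 2 ^ N \<Longrightarrow> herm_pauli N m z $$ (x, y) =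
    (if x = xor y m then pauli_phase N m z * of_real (chi N z y) else 0)"
  by (simp add: herm_pauli_def pauli_index)

text \<open>On the ancilla state \<open>0\<close> of qubit \<open>Lq\<close> the factor \<open>Z\<close> on that qubit acts trivially.\<close>

lemma rot_restrict:
  fixes Lq Lf Aq Af m z :: nat
  assumes Aq: "0 < Aq" and m: "m < 2 ^ (Lq + Lf)" and z: "z < 2 ^ (Lq + Lf)"
  defines "Pr \<equiv> ancilla_proj Lq Lf Aq Af (\<lambda>_. False) (\<lambda>_. False)"
  shows "rot (herm_pauli (Lq + Aq + (Lf + Af)) (embed_mask Lq Aq m)
      (xor (embed_mask Lq Aq z) (2 ^ Lq))) t * Pr =
    joint_ext Lq Lf Aq Af (rot (herm_pauli (Lq + Lf) m z) t) * Pr" (is "?R * Pr = ?J * Pr")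
proof (rule eq_matI)
  let ?N = "Lq + Aq + (Lf + Af)" and ?M = "embed_mask Lq Aq m" and ?Z = "embed_mask Lq Aq z"
  let ?s = "sys_index Lq Lf Aq"
  fix x y assume "x < dim_row (?J * Pr)" "y < dim_col (?J * Pr)"
  then have xy: "x < 2 ^ ?N" "y < 2 ^ ?N" by (simp_all add: joint_ext_def Pr_def ancilla_proj_def)
  have R: "?R \<in> carrier_mat (2 ^ ?N) (2 ^ ?N)" by simp
  have "?R $$ (x, y) = ?J $$ (x, y)" if q: "\<not> bit y Lq"
  proof -
    have ph: "pauli_phase ?N ?M (xor ?Z (2 ^ Lq)) = pauli_phase (Lq + Lf) m z"
      using Aq chi_embed_mask[OF z, of Aq Af ?M]
      by (simp add: pauli_phase_def chi_commute[of _ ?M] chi_commute[of _ m] chi_xor_left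
          chi_exp_left
          bit_embed_mask sys_index_embed_mask[OF m])
    have ch: "chi ?N (xor ?Z (2 ^ Lq)) y = chi (Lq + Lf) z (?s y)"
      using q Aq chi_embed_mask[OF z, of Aq Af y] by (simp add: chi_xor_left chi_exp_left)
    have eq: "x = xor y ?M \<longleftrightarrow> anc_eq Lq Lf Aq x y \<and> ?s x = xor (?s y) m"
      unfolding anc_sys_eq[of x "xor y ?M" Lq Lf Aq] anc_eq_xor_embed_mask[OF m] sys_index_xor
        sys_index_embed_mask[OF m] ..
    show ?thesis
      using xy sys_index_less[of Lq Lf Aq]
      by (simp add: rot_index[OF herm_pauli_carrier] herm_pauli_index ph ch eq joint_ext_def
          anc_sys_eq[of x y Lq Lf Aq])
  qed
  moreover have "\<not> (\<forall>k<Aq. bit y (Lq + k) = False)" if "bit y Lq"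
    using that Aq by (auto intro!: exI[of _ 0])
  ultimately show "(?R * Pr) $$ (x, y) = (?J * Pr) $$ (x, y)"
    unfolding Pr_def ancilla_proj_eq
    unfolding diag_op_mult_index(2)[OF R xy] diag_op_mult_index(2)[OF joint_ext_carrier xy]
    by (cases "bit y Lq") simp_all
qed (simp_all add: joint_ext_def)

text \<open>Members \<open>W\<close> of \<open>C\<close> are controlled only on the range of the
  projector. Products inherit this because the projector commutes with extensions:
  \<open>W W' Pr = W Pr J' = J Pr J' = J J' Pr\<close>.\<close>

lemma rotation_monoid_restrict:
  fixes Lq Lf Aq Af :: nat
  assumes Aq: "0 < Aq" and Af: "2 \<le> Lf + Af" and gm:
      "gate_monoid (Lq + Aq + (Lf + Af)) C (Lq + Aq) Lq"
    and t8: "pauli_angle C (Lq + Aq + (Lf + Af)) (pi / 8) 0 (2 ^ k)" "k = Lq \<or> Lq + Aq \<le> k"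
        "k < Lq + Aq + (Lf + Af)"
  defines "Pr \<equiv> ancilla_proj Lq Lf Aq Af (\<lambda>_. False) (\<lambda>_. False)"
  shows "rotation_monoid (Lq + Lf) (site_mask Lq (Lq + Lf))
    {V \<in> fock_ops Lq Lf. \<exists>W\<in>C. W * Pr = joint_ext Lq Lf Aq Af V * Pr}" (is "rotation_monoid _ _
        ?G")
proof
  interpret gate_monoid "Lq + Aq + (Lf + Af)" C "Lq + Aq" Lq by (rule gm)
  let ?N = "Lq + Aq + (Lf + Af)" and ?J = "joint_ext Lq Lf Aq Af"
  have Pr: "Pr \<in> carrier_mat (2 ^ ?N) (2 ^ ?N)" unfolding Pr_def by (rule ancilla_proj_carrier)
  show "V * V' \<in> ?G" if V: "V \<in> ?G" "V' \<in> ?G" for V V'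
  proof -
    obtain W W' where W: "W \<in> C" "W' \<in> C" "W * Pr = ?J V * Pr" "W' * Pr = ?J V' * Pr"
      using V by blast
    have c: "W \<in> carrier_mat (2 ^ ?N) (2 ^ ?N)" "W' \<in> carrier_mat (2 ^ ?N) (2 ^ ?N)"
      "?J V \<in> carrier_mat (2 ^ ?N) (2 ^ ?N)" "?J V' \<in> carrier_mat (2 ^ ?N) (2 ^ ?N)"
      using carrier W by (auto intro: joint_ext_carrier)
    have comm: "Pr * ?J V' = ?J V' * Pr" unfolding Pr_def by (rule ancilla_proj_commute)
    have "(W * W') * Pr = W * (?J V' * Pr)" unfolding W(4)[symmetric] by
        (rule assoc_mult_mat[OF c(1,2) Pr])
    also have "\<dots> = (W * Pr) * ?J V'" unfolding comm[symmetric] by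
        (rule assoc_mult_mat[OF c(1) Pr c(4), symmetric])
    also have "\<dots> = ?J V * (Pr * ?J V')" unfolding W(3) by (rule assoc_mult_mat[OF c(3) Pr c(4)])
    also have "\<dots> = (?J V * ?J V') * Pr" unfolding comm by
        (rule assoc_mult_mat[OF c(3,4) Pr, symmetric])
    also have "?J V * ?J V' = ?J (V * V')" using V by (intro joint_ext_mult[symmetric]) auto
    finally show ?thesis using mult[OF W(1,2)] V by auto
  qed
  show "rot (herm_pauli (Lq + Lf) m z) t \<in> ?G"
    if m: "m < 2 ^ (Lq + Lf)" and z: "z < 2 ^ (Lq + Lf)" and f:
        "chi (Lq + Lf) (site_mask Lq (Lq + Lf)) m = 1" for m z t
  proof -
    have "pauli_angle C ?N t (embed_mask Lq Aq m) (xor (embed_mask Lq Aq z) (2 ^ Lq))"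
    proof (rule pauli_angle_even[OF t8])
      show "chi ?N (site_mask (Lq + Aq) ?N) (embed_mask Lq Aq m) = 1"
        unfolding chi_site_mask_embed[OF m] by (rule f)
    qed (use Aq embed_mask_less[OF m, of Aq Af] embed_mask_less[OF z, of Aq Af] in
        \<open>auto simp: bit_embed_mask\<close>)
    then have "rot (herm_pauli ?N (embed_mask Lq Aq m) (xor (embed_mask Lq Aq z) (2 ^ Lq))) t \<in> C"
      by (simp add: pauli_angle_def)
    then show ?thesis using rot_restrict[OF Aq m z, of Af t] unfolding Pr_def by auto
  qed
qed

text \<open>The gate sets differ only in where an angle pi/8 is available, on a qubit or on a site;
  the hypothesis on \<open>k\<close> covers both.\<close>

lemma universalI:
  assumes G: "\<And>Nq Nf. common_gates Nq Nf \<subseteq> \<G> Nq Nf" "\<And>Nq Nf. \<G> Nq Nf \<subseteq> fock_ops Nq Nf"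
    and t8: "\<And>Nq Nf q. q < Nq \<Longrightarrow> 0 < Nf \<Longrightarrow> \<exists>k. (k = q \<or> Nq \<le> k) \<and> k < Nq + Nf \<and>
      cis (pi / 8) \<cdot>\<^sub>m rot (herm_pauli (Nq + Nf) 0 (2 ^ k)) (- (pi / 8)) \<in> \<G> Nq Nf"
  shows "universal \<G>"
  unfolding universal_def
proof (intro allI ballI impI, elim conjE)
  fix Lq Lf U and \<epsilon> :: real
  assume U: "U \<in> fock_ops Lq Lf" and \<epsilon>: "\<epsilon> > 0" and unitary: "unitary_mat U"
    and comm: "U * fermion_parity Lq Lf = fermion_parity Lq Lf * U"
  \<comment> \<open>Two ancilla sites make a braid possible even for a system without sites.\<close>
  define Aq Af :: nat where "Aq = 1" and "Af = 2"
  define N where "N = Lq + Aq + (Lf + Af)"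
  define C where "C = circuit_closure (Lq + Aq) (Lf + Af) (\<G> (Lq + Aq) (Lf + Af))"
  define Pr where "Pr = ancilla_proj Lq Lf Aq Af (\<lambda>_. False) (\<lambda>_. False)"
  have gm: "gate_monoid N C (Lq + Aq) Lq"
    unfolding C_def N_def by (rule gate_monoid_circuit_closure[OF G])
        (simp_all add: Aq_def Af_def)
  interpret gate_monoid N C "Lq + Aq" Lq by (rule gm)
  have pos: "0 < Aq" "0 < Lf + Af" "2 \<le> Lf + Af" by (simp_all add: Aq_def Af_def)
  obtain k where k: "k = Lq \<or> Lq + Aq \<le> k" "k < N"
    "cis (pi / 8) \<cdot>\<^sub>m rot (herm_pauli N 0 (2 ^ k)) (- (pi / 8)) \<in> \<G> (Lq + Aq) (Lf + Af)"
    using t8[of Lq "Lq + Aq" "Lf + Af"] pos unfolding N_def by auto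
  have "pauli_angle C N (- (pi / 8)) 0 (2 ^ k)"
  proof (rule pauli_angle_minus[where k = 16])
    have "cis (- (pi / 8)) \<cdot>\<^sub>m (cis (pi / 8) \<cdot>\<^sub>m rot (herm_pauli N 0 (2 ^ k)) (- (pi / 8))) \<in> C"
      using gate_in_circuit_closure[OF G(2) k(3)] unfolding C_def[symmetric] by (rule phase) simp
    then show "rot (herm_pauli N 0 (2 ^ k)) (- (pi / 8)) \<in> C" by
        (simp add: smult_smult_mat cis_mult)
  qed simp_all
  then have pa: "pauli_angle C N (pi / 8) 0 (2 ^ k)" by (simp add: pauli_angle_def)
  interpret R: rotation_monoid "Lq + Lf" "site_mask Lq (Lq + Lf)"
    "{V \<in> fock_ops Lq Lf. \<exists>W\<in>C. W * Pr = joint_ext Lq Lf Aq Af V * Pr}"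
    unfolding Pr_def
    by (rule rotation_monoid_restrict[OF pos(1,3) gm[unfolded N_def] pa[unfolded N_def] k(1)
        k(2)[unfolded N_def]])
  have "isometry (2 ^ (Lq + Lf)) U" using U unitary by (auto simp: isometry_def unitary_mat_def)
  moreover have "R.even_op U"
    unfolding R.even_op_def using even_entries[OF U comm] by blast
  ultimately obtain W where W: "W \<in> C" "W * Pr = joint_ext Lq Lf Aq Af U * Pr"
    using R.even_isometry_mem by blast
  \<comment> \<open>The operator norm will be bounded by a sum over \<open>2 ^ N * 2 ^ N\<close>
    entries.\<close>
  define e where "e = \<epsilon> / (2 ^ N * 2 ^ N)"
  have "e > 0" using \<epsilon> by (simp add: e_def)
  then obtain gs c where gs: "set gs \<subseteq> \<G> (Lq + Aq) (Lf + Af)" "cmod c = 1"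
    "\<And>x y. x < 2 ^ N \<Longrightarrow> y < 2 ^ N \<Longrightarrow> cmod ((c \<cdot>\<^sub>m circuit (Lq + Aq) (Lf + Af) gs) $$ (x, y) - W $$
        (x, y)) \<le> e"
    using W(1) unfolding C_def circuit_closure_def N_def by blast
  define V where "V = circuit (Lq + Aq) (Lf + Af) gs"
  define U' where "U' = joint_ext Lq Lf Aq Af U"
  \<comment> \<open>In the closure the phase \<open>c\<close> multiplies the circuit, in the claim
    it multiplies \<open>U\<close>; hence the inverse.\<close>
  define \<phi> where "\<phi> = - Arg c"
  have carr: "V \<in> carrier_mat (2 ^ N) (2 ^ N)" "W \<in> carrier_mat (2 ^ N) (2 ^ N)"
    "U' \<in> carrier_mat (2 ^ N) (2 ^ N)" "Pr \<in> carrier_mat (2 ^ N) (2 ^ N)"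
    using circuit_carrier[OF G(2) gs(1)] carrier[OF W(1)] joint_ext_carrier[of Lq Lf Aq Af U]
      ancilla_proj_carrier[of Lq Lf Aq Af] unfolding V_def U'_def Pr_def N_def by auto
  have "c = cis (Arg c)" using rcis_cmod_Arg[of c] gs(2) by (metis cis_rcis_eq)
  moreover have "exp (\<i> * \<phi>) = cis (- Arg c)" by (simp add: \<phi>_def cis_conv_exp)
  ultimately have c: "c * exp (\<i> * \<phi>) = 1" by (metis cis_mult cis_zero add.right_inverse)
  have diff: "(V - a \<cdot>\<^sub>m A) * Pr = V * Pr - a \<cdot>\<^sub>m (A * Pr)" if A:
      "A \<in> carrier_mat (2 ^ N) (2 ^ N)" for a A
    unfolding minus_mult_distrib_mat[OF carr(1) smult_carrier_mat[OF A] carr(4)]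
      mult_smult_assoc_mat[OF A carr(4)] ..
  \<comment> \<open>Under the projector the extension of \<open>U\<close> may be exchanged for
    \<open>W\<close>, the operator that the circuit approximates.\<close>
  have eq: "(V - exp (\<i> * \<phi>) \<cdot>\<^sub>m U') * Pr = (V - exp (\<i> * \<phi>) \<cdot>\<^sub>m W) * Pr"
    unfolding diff[OF carr(2)] diff[OF carr(3)] unfolding W(2) U'_def ..
  have D: "V - exp (\<i> * \<phi>) \<cdot>\<^sub>m W \<in> carrier_mat (2 ^ N) (2 ^ N)"
    by (rule minus_carrier_mat[OF smult_carrier_mat[OF carr(2)]])
  have entry: "cmod (((V - exp (\<i> * \<phi>) \<cdot>\<^sub>m W) * Pr) $$ (x, y)) \<le> e" if xy: "x < 2 ^ N" "y < 2 ^ N"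
      for x y
  proof -
    define p where "p = (of_bool ((\<forall>k<Aq. bit y (Lq + k) = False) \<and>
        (\<forall>k<Af. bit y (Lq + Aq + (Lf + k)) = False)) :: complex)"
    have "((V - exp (\<i> * \<phi>) \<cdot>\<^sub>m W) * Pr) $$ (x, y) = (V - exp (\<i> * \<phi>) \<cdot>\<^sub>m W) $$ (x, y) * p"
      using diag_op_mult_index(2)[OF D xy] unfolding Pr_def ancilla_proj_eq p_def N_def by blast
    also have "cmod \<dots> \<le> cmod ((V - exp (\<i> * \<phi>) \<cdot>\<^sub>m W) $$ (x, y))"
      by (simp add: norm_mult p_def)
    also have "\<dots> = cmod (c * (V - exp (\<i> * \<phi>) \<cdot>\<^sub>m W) $$ (x, y))" using gs(2) by
        (simp add: norm_mult)
    also have "c * (V - exp (\<i> * \<phi>) \<cdot>\<^sub>m W) $$ (x, y) =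
        (c \<cdot>\<^sub>m V) $$ (x, y) - (c * exp (\<i> * \<phi>)) * W $$ (x, y)"
      using carrier_matD[OF carr(1)] carrier_matD[OF carr(2)] xy by (simp add: right_diff_distrib)
    also have "cmod \<dots> \<le> e" unfolding c using gs(3)[OF xy] by (simp add: V_def)
    finally show ?thesis .
  qed
  have "op_norm ((V - exp (\<i> * \<phi>) \<cdot>\<^sub>m U') * Pr) \<le>
      (\<Sum>x<2 ^ N. \<Sum>y<2 ^ N. cmod (((V - exp (\<i> * \<phi>) \<cdot>\<^sub>m W) * Pr) $$ (x, y)))"
    unfolding eq by (rule op_norm_le_sum[OF mult_carrier_mat[OF D carr(4)]])
  also have "\<dots> \<le> (\<Sum>x<(2 ^ N :: nat). \<Sum>y<(2 ^ N :: nat). e)"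
    by (intro sum_mono entry) auto
  also have "\<dots> = \<epsilon>" by (simp add: e_def)
  finally have "op_norm ((V - exp (\<i> * \<phi>) \<cdot>\<^sub>m U') * Pr) \<le> \<epsilon>" .
  then show "\<exists>Aq Af bq bf gs (\<phi>::real) U'. set gs \<subseteq> \<G> (Lq + Aq) (Lf + Af) \<and>
      joint_action Lq Lf Aq Af U U' \<and>
      op_norm ((circuit (Lq + Aq) (Lf + Af) gs - exp (\<i> * \<phi>) \<cdot>\<^sub>m U') * ancilla_proj Lq Lf Aq Af bq
          bf) \<le> \<epsilon>"
    using gs(1) joint_action_joint_ext[OF U, of Aq Af] unfolding V_def U'_def Pr_def by blast
qed

lemma mat_exp_dim [simp]: "dim_row (mat_exp A) = dim_row A" "dim_col (mat_exp A) = dim_row A"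
  by (simp_all add: mat_exp_def)

lemma common_gates_carrier: "common_gates Nq Nf \<subseteq> fock_ops Nq Nf"
  by (auto simp: common_gates_def braid_gate_def CZf_gate_def CZqf_gate_def H_gate_def S_gate_def
      qubit_number_def site_number_def creat_def annih_def intro!: carrier_matI)

theorem proposition2:
  shows "universal gate_set_T \<and> universal gate_set_Tf"
proof
  show "universal gate_set_T"
  proof (rule universalI)
    show "gate_set_T Nq Nf \<subseteq> fock_ops Nq Nf" for Nq Nf
      using common_gates_carrier by (auto simp: gate_set_T_def T_gate_def)
    show "\<exists>k. (k = q \<or> Nq \<le> k) \<and> k < Nq + Nf \<and>
        cis (pi / 8) \<cdot>\<^sub>m rot (herm_pauli (Nq + Nf) 0 (2 ^ k)) (- (pi / 8)) \<in> gate_set_T Nq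
            Nf" if "q < Nq" for Nq Nf q
      using that T_gate_eq[OF that, of Nf] by (intro exI[of _ q]) (auto simp: gate_set_T_def)
  qed (auto simp: gate_set_T_def)
  show "universal gate_set_Tf"
  proof (rule universalI)
    show "gate_set_Tf Nq Nf \<subseteq> fock_ops Nq Nf" for Nq Nf
      using common_gates_carrier
      by (auto simp: gate_set_Tf_def Tf_gate_def intro!: carrier_matI simp:
          carrier_matD[OF site_number_carrier])
    show "\<exists>k. (k = q \<or> Nq \<le> k) \<and> k < Nq + Nf \<and>
        cis (pi / 8) \<cdot>\<^sub>m rot (herm_pauli (Nq + Nf) 0 (2 ^ k)) (- (pi / 8)) \<in> gate_set_Tf Nq Nf"
      if "0 < Nf" for Nq Nf q :: nat
      \<comment> \<open>Site 0 occupies bit \<open>Nq\<close> of the index.\<close>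
      using that Tf_gate_eq[OF that, of Nq] by (intro exI[of _ Nq]) (auto simp: gate_set_Tf_def)
  qed (auto simp: gate_set_Tf_def)
qed

end
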